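(* Let $F:\mathcal C\to\mathcal D$ be a dominant tensor functor between tensor categories over a field $\Bbbk$ admitting an exact right adjoint, and let $(A,\sigma)$ be its induced central algebra (in $\mathcal C$). Then $F$ is normal if and only if the algebra $A$ is self-trivializing. If such is the case, $\mathfrak{Ker}_F=\langle A\rangle\subset\mathcal C$, so that there is an exact sequence of tensor categories $$\langle A\rangle\longrightarrow\mathcal C\xrightarrow{\ F\ }\mathcal D .$$
   Context: A tensor category over $\Bbbk$ is a $\Bbbk$-linear abelian rigid monoidal category with finite-dimensional Hom spaces, all objects of finite length, monoidal product $\Bbbk$-linear in each variable, and $\operatorname{End}(\mathbf 1)=\Bbbk$. A tensor functor is a $\Bbbk$-linear exact strong monoidal functor between tensor categories. An object is trivial if isomorphic to $\mathbf 1^n$ for some $n$. For a tensor functor $F:\mathcal C\to\mathcal D$: $\mathfrak{Ker}_F\subset\mathcal C$ is the full subcategory of objects $X$ with $F(X)$ trivial; $F$ is dominant if every object of $\mathcal D$ is a subobject of $F(X)$ for some $X$; $F$ is normal if every $X$ in $\mathcal C$ has a subobject $X_0$ such that $F(X_0)$ is the largest trivial subobject of $F(X)$. A sequence of tensor functors $\mathcal C'\xrightarrow{f}\mathcal C\xrightarrow{F}\mathcal C''$ is exact if $F$ is dominant and normal, $f$ is a full embedding and the essential image of $f$ is $\mathfrak{Ker}_F$. $\langle A\rangle$ is the smallest abelian subcategory of $\mathcal C$ containing $A$ and stable under direct sums, subobjects and quotients. For an algebra $(A,m,u)$ in $\mathcal C$, $F_A:\mathcal C\to\mathrm{mod}_{\mathcal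 C}A$, $X\mapsto(X\otimes A,\mathrm{id}_X\otimes m)$, is the free right module functor; $A$ trivializes $X$ if $F_A(X)\simeq F_A(\mathbf 1)^n$ for some natural integer $n$; $A$ is self-trivializing if it trivializes its underlying object. The induced central algebra $(A,\sigma)$ of a tensor functor $F$ with right adjoint $R$: $A=R(\mathbf 1)$ with product $R_2(\mathbf 1,\mathbf 1)$ and unit $R_0$, where $(R_2,R_0)$ is the canonical monoidal structure of $R$; with $\eta$ the adjunction unit, the half-braiding $\sigma_X:A\otimes X\to X\otimes A$ is the unique morphism with $R_2(FX,\mathbf 1)(\eta_X\otimes\mathrm{id}_A)\,\sigma_X=R_2(\mathbf 1,FX)(\mathrm{id}_A\otimes\eta_X)$. *)

theory Defs
  imports Main
begin

section \<open>Categories\<close>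

text \<open>
  A category has a set of objects and a set of arrows, each arrow having a domain and a
  codomain.  Operations are unconstrained outside these carriers.  Composition is written
  applicatively: \<open>g \<cdot> f\<close> means \<open>f\<close> first.
\<close>

record ('o, 'm) cat =
  Ob :: "'o set"
  Arr :: "'m set"
  Dom :: "'m \<Rightarrow> 'o"
  Cod :: "'m \<Rightarrow> 'o"
  Idn :: "'o \<Rightarrow> 'm"
  Comp :: "'m \<Rightarrow> 'm \<Rightarrow> 'm" (infixr "\<cdot>\<index>" 70)

definition Hom :: "('o, 'm, 'z) cat_scheme \<Rightarrow> 'o \<Rightarrow> 'o \<Rightarrow> 'm set" where
  "Hom C X Y = {f \<in> Arr C. Dom C f = X \<and> Cod C f = Y}"

locale category =
  fixes C :: "('o, 'm, 'z) cat_scheme" (structure)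
  assumes Dom_Ob: "f \<in> Arr C \<Longrightarrow> Dom C f \<in> Ob C"
    and Cod_Ob: "f \<in> Arr C \<Longrightarrow> Cod C f \<in> Ob C"
    and Idn_Hom: "X \<in> Ob C \<Longrightarrow> Idn C X \<in> Hom C X X"
    and Comp_Hom: "\<lbrakk>f \<in> Hom C X Y; g \<in> Hom C Y Z\<rbrakk> \<Longrightarrow> g \<cdot> f \<in> Hom C X Z"
    and Comp_Idn: "f \<in> Hom C X Y \<Longrightarrow> f \<cdot> Idn C X = f"
    and Idn_Comp: "f \<in> Hom C X Y \<Longrightarrow> Idn C Y \<cdot> f = f"
    and Comp_assoc: "\<lbrakk>f \<in> Hom C W X; g \<in> Hom C X Y; h \<in> Hom C Y Z\<rbrakk>
      \<Longrightarrow> (h \<cdot> g) \<cdot> f = h \<cdot> (g \<cdot> f)"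

definition is_mono :: "('o, 'm, 'z) cat_scheme \<Rightarrow> 'm \<Rightarrow> bool" where
  "is_mono C m \<longleftrightarrow> m \<in> Arr C \<and>
     (\<forall>T. \<forall>f\<in>Hom C T (Dom C m). \<forall>g\<in>Hom C T (Dom C m). m \<cdot>\<^bsub>C\<^esub> f = m \<cdot>\<^bsub>C\<^esub> g \<longrightarrow> f = g)"

definition is_epi :: "('o, 'm, 'z) cat_scheme \<Rightarrow> 'm \<Rightarrow> bool" where
  "is_epi C e \<longleftrightarrow> e \<in> Arr C \<and>
     (\<forall>T. \<forall>f\<in>Hom C (Cod C e) T. \<forall>g\<in>Hom C (Cod C e) T. f \<cdot>\<^bsub>C\<^esub> e = g \<cdot>\<^bsub>C\<^esub> e \<longrightarrow> f = g)"

definition inverse_arrows :: "('o, 'm, 'z) cat_scheme \<Rightarrow> 'm \<Rightarrow> 'm \<Rightarrow> bool" where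
  "inverse_arrows C f g \<longleftrightarrow> f \<in> Arr C \<and> g \<in> Hom C (Cod C f) (Dom C f) \<and>
     g \<cdot>\<^bsub>C\<^esub> f = Idn C (Dom C f) \<and> f \<cdot>\<^bsub>C\<^esub> g = Idn C (Cod C f)"

definition is_iso :: "('o, 'm, 'z) cat_scheme \<Rightarrow> 'm \<Rightarrow> bool" where
  "is_iso C f \<longleftrightarrow> (\<exists>g. inverse_arrows C f g)"

definition inv_arr :: "('o, 'm, 'z) cat_scheme \<Rightarrow> 'm \<Rightarrow> 'm" where
  "inv_arr C f = (THE g. inverse_arrows C f g)"

definition isomorphic :: "('o, 'm, 'z) cat_scheme \<Rightarrow> 'o \<Rightarrow> 'o \<Rightarrow> bool" where
  "isomorphic C X Y \<longleftrightarrow> (\<exists>f\<in>Hom C X Y. is_iso C f)"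

text \<open>The full subcategory on \<open>S\<close> inherits every further piece of structure unchanged.\<close>

definition full_sub :: "('o, 'm, 'z) cat_scheme \<Rightarrow> 'o set \<Rightarrow> ('o, 'm, 'z) cat_scheme" where
  "full_sub C S = C\<lparr>Ob := S, Arr := {f \<in> Arr C. Dom C f \<in> S \<and> Cod C f \<in> S}\<rparr>"


section \<open>Linear and abelian categories\<close>

text \<open>\<open>Zer C X Y\<close> is the zero arrow from \<open>X\<close> to \<open>Y\<close>; \<open>Add\<close> adds parallel arrows.\<close>

record ('o, 'm) preadd_cat = "('o, 'm) cat" +
  Zer :: "'o \<Rightarrow> 'o \<Rightarrow> 'm"
  Add :: "'m \<Rightarrow> 'm \<Rightarrow> 'm" (infixl "\<oplus>\<index>" 65)

locale preadditive_category = category C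
  for C :: "('o, 'm, 'z) preadd_cat_scheme" (structure) +
  assumes Zer_Hom: "\<lbrakk>X \<in> Ob C; Y \<in> Ob C\<rbrakk> \<Longrightarrow> Zer C X Y \<in> Hom C X Y"
    and Add_Hom: "\<lbrakk>f \<in> Hom C X Y; g \<in> Hom C X Y\<rbrakk> \<Longrightarrow> f \<oplus> g \<in> Hom C X Y"
    and Add_assoc: "\<lbrakk>f \<in> Hom C X Y; g \<in> Hom C X Y; h \<in> Hom C X Y\<rbrakk>
      \<Longrightarrow> (f \<oplus> g) \<oplus> h = f \<oplus> (g \<oplus> h)"
    and Add_commute: "\<lbrakk>f \<in> Hom C X Y; g \<in> Hom C X Y\<rbrakk> \<Longrightarrow> f \<oplus> g = g \<oplus> f"
    and Zer_Add: "f \<in> Hom C X Y \<Longrightarrow> Zer C X Y \<oplus> f = f"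
    and Add_inverse: "f \<in> Hom C X Y \<Longrightarrow> \<exists>g\<in>Hom C X Y. f \<oplus> g = Zer C X Y"
    and Comp_Add: "\<lbrakk>f \<in> Hom C X Y; g \<in> Hom C X Y; h \<in> Hom C Y Z\<rbrakk>
      \<Longrightarrow> h \<cdot> (f \<oplus> g) = (h \<cdot> f) \<oplus> (h \<cdot> g)"
    and Add_Comp: "\<lbrakk>f \<in> Hom C X Y; g \<in> Hom C Y Z; h \<in> Hom C Y Z\<rbrakk>
      \<Longrightarrow> (g \<oplus> h) \<cdot> f = (g \<cdot> f) \<oplus> (h \<cdot> f)"

definition is_zero :: "('o, 'm, 'z) cat_scheme \<Rightarrow> 'o \<Rightarrow> bool" where
  "is_zero C Z \<longleftrightarrow> Z \<in> Ob C \<and> (\<forall>X\<in>Ob C. (\<exists>!f. f \<in> Hom C Z X) \<and> (\<exists>!f. f \<in> Hom C X Z))"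

definition is_dsum :: "('o, 'm, 'z) preadd_cat_scheme \<Rightarrow> 'o \<Rightarrow> 'o \<Rightarrow> 'o \<Rightarrow> bool" where
  "is_dsum C X Y P \<longleftrightarrow>
     (\<exists>i\<in>Hom C X P. \<exists>j\<in>Hom C Y P. \<exists>p\<in>Hom C P X. \<exists>q\<in>Hom C P Y.
        p \<cdot>\<^bsub>C\<^esub> i = Idn C X \<and> q \<cdot>\<^bsub>C\<^esub> j = Idn C Y \<and>
        p \<cdot>\<^bsub>C\<^esub> j = Zer C Y X \<and> q \<cdot>\<^bsub>C\<^esub> i = Zer C X Y \<and>
        (i \<cdot>\<^bsub>C\<^esub> p) \<oplus>\<^bsub>C\<^esub> (j \<cdot>\<^bsub>C\<^esub> q) = Idn C P)"

text \<open>\<open>is_power C X n P\<close>: \<open>P\<close> is a direct sum of \<open>n\<close> copies of \<open>X\<close>.\<close>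

primrec is_power :: "('o, 'm, 'z) preadd_cat_scheme \<Rightarrow> 'o \<Rightarrow> nat \<Rightarrow> 'o \<Rightarrow> bool" where
  "is_power C X 0 P \<longleftrightarrow> is_zero C P"
| "is_power C X (Suc n) P \<longleftrightarrow> (\<exists>Q. is_power C X n Q \<and> is_dsum C Q X P)"

definition is_kernel :: "('o, 'm, 'z) preadd_cat_scheme \<Rightarrow> 'm \<Rightarrow> 'm \<Rightarrow> bool" where
  "is_kernel C k f \<longleftrightarrow> f \<in> Arr C \<and> k \<in> Arr C \<and> Cod C k = Dom C f \<and>
     f \<cdot>\<^bsub>C\<^esub> k = Zer C (Dom C k) (Cod C f) \<and>
     (\<forall>T. \<forall>h\<in>Hom C T (Dom C f). f \<cdot>\<^bsub>C\<^esub> h = Zer C T (Cod C f) \<longrightarrow>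
        (\<exists>!h'. h' \<in> Hom C T (Dom C k) \<and> k \<cdot>\<^bsub>C\<^esub> h' = h))"

definition is_cokernel :: "('o, 'm, 'z) preadd_cat_scheme \<Rightarrow> 'm \<Rightarrow> 'm \<Rightarrow> bool" where
  "is_cokernel C q f \<longleftrightarrow> f \<in> Arr C \<and> q \<in> Arr C \<and> Dom C q = Cod C f \<and>
     q \<cdot>\<^bsub>C\<^esub> f = Zer C (Dom C f) (Cod C q) \<and>
     (\<forall>T. \<forall>h\<in>Hom C (Cod C f) T. h \<cdot>\<^bsub>C\<^esub> f = Zer C (Dom C f) T \<longrightarrow>
        (\<exists>!h'. h' \<in> Hom C (Cod C q) T \<and> h' \<cdot>\<^bsub>C\<^esub> q = h))"

text \<open>\<open>short_exact C i p\<close>: the sequence \<open>0 \<rightarrow> X \<rightarrow> Y \<rightarrow> Z \<rightarrow> 0\<close> with arrows \<open>i\<close> and \<open>p\<close> is exact.\<close>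

definition short_exact :: "('o, 'm, 'z) preadd_cat_scheme \<Rightarrow> 'm \<Rightarrow> 'm \<Rightarrow> bool" where
  "short_exact C i p \<longleftrightarrow> is_kernel C i p \<and> is_cokernel C p i"

locale abelian_category = preadditive_category C
  for C :: "('o, 'm, 'z) preadd_cat_scheme" (structure) +
  assumes has_zero: "\<exists>Z. is_zero C Z"
    and has_dsum: "\<lbrakk>X \<in> Ob C; Y \<in> Ob C\<rbrakk> \<Longrightarrow> \<exists>P. is_dsum C X Y P"
    and has_kernel: "f \<in> Arr C \<Longrightarrow> \<exists>k. is_kernel C k f"
    and has_cokernel: "f \<in> Arr C \<Longrightarrow> \<exists>q. is_cokernel C q f"
    and mono_is_kernel: "is_mono C m \<Longrightarrow> \<exists>f. is_kernel C m f"
    and epi_is_cokernel: "is_epi C e \<Longrightarrow> \<exists>f. is_cokernel C e f"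

definition is_simple :: "('o, 'm, 'z) cat_scheme \<Rightarrow> 'o \<Rightarrow> bool" where
  "is_simple C S \<longleftrightarrow> S \<in> Ob C \<and> \<not> is_zero C S \<and>
     (\<forall>i. is_mono C i \<and> Cod C i = S \<longrightarrow> is_zero C (Dom C i) \<or> is_iso C i)"

text \<open>Finite length: there is a composition series \<open>0 = X 0 \<subseteq> \<dots> \<subseteq> X n = Y\<close>.\<close>

definition finite_length :: "('o, 'm, 'z) preadd_cat_scheme \<Rightarrow> 'o \<Rightarrow> bool" where
  "finite_length C Y \<longleftrightarrow>
     (\<exists>(n::nat) X i p. is_zero C (X 0) \<and> X n = Y \<and>
        (\<forall>k<n. i k \<in> Hom C (X k) (X (Suc k)) \<and> short_exact C (i k) (p k) \<and>
               is_simple C (Cod C (p k))))"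

record ('o, 'm, 'k) lin_cat = "('o, 'm) preadd_cat" +
  Scl :: "'k \<Rightarrow> 'm \<Rightarrow> 'm" (infixr "\<odot>\<index>" 75)

locale linear_category = preadditive_category C
  for C :: "('o, 'm, 'k::field, 'z) lin_cat_scheme" (structure) +
  assumes Scl_Hom: "f \<in> Hom C X Y \<Longrightarrow> a \<odot> f \<in> Hom C X Y"
    and Scl_Add: "\<lbrakk>f \<in> Hom C X Y; g \<in> Hom C X Y\<rbrakk> \<Longrightarrow> a \<odot> (f \<oplus> g) = (a \<odot> f) \<oplus> (a \<odot> g)"
    and plus_Scl: "f \<in> Hom C X Y \<Longrightarrow> (a + b) \<odot> f = (a \<odot> f) \<oplus> (b \<odot> f)"
    and Scl_Scl: "f \<in> Hom C X Y \<Longrightarrow> a \<odot> (b \<odot> f) = (a * b) \<odot> f"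
    and one_Scl: "f \<in> Hom C X Y \<Longrightarrow> 1 \<odot> f = f"
    and Comp_Scl: "\<lbrakk>f \<in> Hom C X Y; g \<in> Hom C Y Z\<rbrakk> \<Longrightarrow> g \<cdot> (a \<odot> f) = a \<odot> (g \<cdot> f)"
    and Scl_Comp: "\<lbrakk>f \<in> Hom C X Y; g \<in> Hom C Y Z\<rbrakk> \<Longrightarrow> (a \<odot> g) \<cdot> f = a \<odot> (g \<cdot> f)"

inductive_set lin_span ::
    "('o, 'm, 'k, 'z) lin_cat_scheme \<Rightarrow> 'o \<Rightarrow> 'o \<Rightarrow> 'm set \<Rightarrow> 'm set"
  for C :: "('o, 'm, 'k, 'z) lin_cat_scheme" and X Y :: 'o and B :: "'m set" where
  span_zero: "Zer C X Y \<in> lin_span C X Y B"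
| span_base: "f \<in> B \<Longrightarrow> f \<in> lin_span C X Y B"
| span_Add: "\<lbrakk>f \<in> lin_span C X Y B; g \<in> lin_span C X Y B\<rbrakk> \<Longrightarrow> f \<oplus>\<^bsub>C\<^esub> g \<in> lin_span C X Y B"
| span_Scl: "f \<in> lin_span C X Y B \<Longrightarrow> a \<odot>\<^bsub>C\<^esub> f \<in> lin_span C X Y B"

definition hom_finite_dim :: "('o, 'm, 'k, 'z) lin_cat_scheme \<Rightarrow> 'o \<Rightarrow> 'o \<Rightarrow> bool" where
  "hom_finite_dim C X Y \<longleftrightarrow> (\<exists>B. finite B \<and> B \<subseteq> Hom C X Y \<and> lin_span C X Y B = Hom C X Y)"


section \<open>Monoidal, rigid and tensor categories\<close>

text \<open>
  \<open>X \<otimes> Y\<close> is the monoidal product of objects and \<open>f \<boxtimes> g\<close> that of arrows.  The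
  constraints are \<open>Asc C X Y Z : (X \<otimes> Y) \<otimes> Z \<rightarrow> X \<otimes> (Y \<otimes> Z)\<close>, \<open>LUn C X : \<one> \<otimes> X \<rightarrow> X\<close> and
  \<open>RUn C X : X \<otimes> \<one> \<rightarrow> X\<close>; monoidal categories are not assumed to be strict.
\<close>

record ('o, 'm, 'k) mon_cat = "('o, 'm, 'k) lin_cat" +
  TOb :: "'o \<Rightarrow> 'o \<Rightarrow> 'o" (infixr "\<otimes>\<index>" 80)
  TAr :: "'m \<Rightarrow> 'm \<Rightarrow> 'm" (infixr "\<boxtimes>\<index>" 80)
  Unt :: "'o" ("\<one>\<index>")
  Asc :: "'o \<Rightarrow> 'o \<Rightarrow> 'o \<Rightarrow> 'm"
  LUn :: "'o \<Rightarrow> 'm"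
  RUn :: "'o \<Rightarrow> 'm"

locale monoidal_category = category C
  for C :: "('o, 'm, 'k, 'z) mon_cat_scheme" (structure) +
  assumes Unt_Ob: "\<one> \<in> Ob C"
    and TOb_Ob: "\<lbrakk>X \<in> Ob C; Y \<in> Ob C\<rbrakk> \<Longrightarrow> X \<otimes> Y \<in> Ob C"
    and TAr_Hom: "\<lbrakk>f \<in> Hom C X X'; g \<in> Hom C Y Y'\<rbrakk> \<Longrightarrow> f \<boxtimes> g \<in> Hom C (X \<otimes> Y) (X' \<otimes> Y')"
    and TAr_Idn: "\<lbrakk>X \<in> Ob C; Y \<in> Ob C\<rbrakk> \<Longrightarrow> Idn C X \<boxtimes> Idn C Y = Idn C (X \<otimes> Y)"
    and TAr_Comp: "\<lbrakk>f \<in> Hom C X X'; f' \<in> Hom C X' X''; g \<in> Hom C Y Y'; g' \<in> Hom C Y' Y''\<rbrakk>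
      \<Longrightarrow> (f' \<cdot> f) \<boxtimes> (g' \<cdot> g) = (f' \<boxtimes> g') \<cdot> (f \<boxtimes> g)"
    and Asc_Hom: "\<lbrakk>X \<in> Ob C; Y \<in> Ob C; Z \<in> Ob C\<rbrakk>
      \<Longrightarrow> Asc C X Y Z \<in> Hom C ((X \<otimes> Y) \<otimes> Z) (X \<otimes> (Y \<otimes> Z))"
    and Asc_iso: "\<lbrakk>X \<in> Ob C; Y \<in> Ob C; Z \<in> Ob C\<rbrakk> \<Longrightarrow> is_iso C (Asc C X Y Z)"
    and Asc_natural: "\<lbrakk>f \<in> Hom C X X'; g \<in> Hom C Y Y'; h \<in> Hom C Z Z'\<rbrakk>
      \<Longrightarrow> Asc C X' Y' Z' \<cdot> ((f \<boxtimes> g) \<boxtimes> h) = (f \<boxtimes> (g \<boxtimes> h)) \<cdot> Asc C X Y Z"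
    and LUn_Hom: "X \<in> Ob C \<Longrightarrow> LUn C X \<in> Hom C (\<one> \<otimes> X) X"
    and LUn_iso: "X \<in> Ob C \<Longrightarrow> is_iso C (LUn C X)"
    and LUn_natural: "f \<in> Hom C X Y \<Longrightarrow> LUn C Y \<cdot> (Idn C \<one> \<boxtimes> f) = f \<cdot> LUn C X"
    and RUn_Hom: "X \<in> Ob C \<Longrightarrow> RUn C X \<in> Hom C (X \<otimes> \<one>) X"
    and RUn_iso: "X \<in> Ob C \<Longrightarrow> is_iso C (RUn C X)"
    and RUn_natural: "f \<in> Hom C X Y \<Longrightarrow> RUn C Y \<cdot> (f \<boxtimes> Idn C \<one>) = f \<cdot> RUn C X"
    and pentagon: "\<lbrakk>W \<in> Ob C; X \<in> Ob C; Y \<in> Ob C; Z \<in> Ob C\<rbrakk>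
      \<Longrightarrow> (Idn C W \<boxtimes> Asc C X Y Z) \<cdot> Asc C W (X \<otimes> Y) Z \<cdot> (Asc C W X Y \<boxtimes> Idn C Z)
        = Asc C W X (Y \<otimes> Z) \<cdot> Asc C (W \<otimes> X) Y Z"
    and triangle: "\<lbrakk>X \<in> Ob C; Y \<in> Ob C\<rbrakk>
      \<Longrightarrow> (Idn C X \<boxtimes> LUn C Y) \<cdot> Asc C X \<one> Y = RUn C X \<boxtimes> Idn C Y"

text \<open>
  \<open>dual_pair C L X ev coev\<close>: \<open>L\<close> is a left dual of \<open>X\<close> (and \<open>X\<close> a right dual of \<open>L\<close>) with
  evaluation \<open>ev : L \<otimes> X \<rightarrow> \<one>\<close> and coevaluation \<open>coev : \<one> \<rightarrow> X \<otimes> L\<close>.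
\<close>

definition dual_pair ::
    "('o, 'm, 'k, 'z) mon_cat_scheme \<Rightarrow> 'o \<Rightarrow> 'o \<Rightarrow> 'm \<Rightarrow> 'm \<Rightarrow> bool" where
  "dual_pair C L X ev coev \<longleftrightarrow> L \<in> Ob C \<and> X \<in> Ob C \<and>
     ev \<in> Hom C (L \<otimes>\<^bsub>C\<^esub> X) \<one>\<^bsub>C\<^esub> \<and> coev \<in> Hom C \<one>\<^bsub>C\<^esub> (X \<otimes>\<^bsub>C\<^esub> L) \<and>
     RUn C X \<cdot>\<^bsub>C\<^esub> (Idn C X \<boxtimes>\<^bsub>C\<^esub> ev) \<cdot>\<^bsub>C\<^esub> Asc C X L X \<cdot>\<^bsub>C\<^esub> (coev \<boxtimes>\<^bsub>C\<^esub> Idn C X) = LUn C X \<and>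
     LUn C L \<cdot>\<^bsub>C\<^esub> (ev \<boxtimes>\<^bsub>C\<^esub> Idn C L) \<cdot>\<^bsub>C\<^esub> inv_arr C (Asc C L X L) \<cdot>\<^bsub>C\<^esub> (Idn C L \<boxtimes>\<^bsub>C\<^esub> coev) = RUn C L"

locale tensor_category =
  abelian_category C + linear_category C + monoidal_category C
  for C :: "('o, 'm, 'k::field, 'z) mon_cat_scheme" (structure) +
  assumes left_dual: "X \<in> Ob C \<Longrightarrow> \<exists>L ev coev. dual_pair C L X ev coev"
    and right_dual: "X \<in> Ob C \<Longrightarrow> \<exists>R ev coev. dual_pair C X R ev coev"
    and finite_dim_Hom: "\<lbrakk>X \<in> Ob C; Y \<in> Ob C\<rbrakk> \<Longrightarrow> hom_finite_dim C X Y"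
    and finite_length_Ob: "X \<in> Ob C \<Longrightarrow> finite_length C X"
    and TAr_Add: "\<lbrakk>f \<in> Hom C X X'; g \<in> Hom C Y Y'; h \<in> Hom C Y Y'\<rbrakk>
      \<Longrightarrow> f \<boxtimes> (g \<oplus> h) = (f \<boxtimes> g) \<oplus> (f \<boxtimes> h)"
    and Add_TAr: "\<lbrakk>f \<in> Hom C X X'; g \<in> Hom C X X'; h \<in> Hom C Y Y'\<rbrakk>
      \<Longrightarrow> (f \<oplus> g) \<boxtimes> h = (f \<boxtimes> h) \<oplus> (g \<boxtimes> h)"
    and TAr_Scl: "\<lbrakk>f \<in> Hom C X X'; g \<in> Hom C Y Y'\<rbrakk> \<Longrightarrow> f \<boxtimes> (a \<odot> g) = a \<odot> (f \<boxtimes> g)"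
    and Scl_TAr: "\<lbrakk>f \<in> Hom C X X'; g \<in> Hom C Y Y'\<rbrakk> \<Longrightarrow> (a \<odot> f) \<boxtimes> g = a \<odot> (f \<boxtimes> g)"
    and End_Unt: "bij_betw (\<lambda>a. a \<odot> Idn C \<one>) UNIV (Hom C \<one> \<one>)"

definition is_trivial :: "('o, 'm, 'k, 'z) mon_cat_scheme \<Rightarrow> 'o \<Rightarrow> bool" where
  "is_trivial C X \<longleftrightarrow> (\<exists>n P. is_power C \<one>\<^bsub>C\<^esub> n P \<and> isomorphic C X P)"


section \<open>Functors\<close>

record ('o, 'm, 'p, 'n) fctr =
  FOb :: "'o \<Rightarrow> 'p"
  FAr :: "'m \<Rightarrow> 'n"

text \<open>A monoidal functor carries \<open>F2 F X Y : F X \<otimes> F Y \<rightarrow> F (X \<otimes> Y)\<close> and \<open>F0 F : \<one> \<rightarrow> F \<one>\<close>.\<close>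

record ('o, 'm, 'p, 'n) mfctr = "('o, 'm, 'p, 'n) fctr" +
  F2 :: "'o \<Rightarrow> 'o \<Rightarrow> 'n"
  F0 :: "'n"

locale is_functor = C: category C + D: category D
  for C :: "('o, 'm, 'y) cat_scheme" and D :: "('p, 'n, 'z) cat_scheme" +
  fixes F :: "('o, 'm, 'p, 'n, 'w) fctr_scheme"
  assumes FOb_Ob: "X \<in> Ob C \<Longrightarrow> FOb F X \<in> Ob D"
    and FAr_Hom: "f \<in> Hom C X Y \<Longrightarrow> FAr F f \<in> Hom D (FOb F X) (FOb F Y)"
    and FAr_Idn: "X \<in> Ob C \<Longrightarrow> FAr F (Idn C X) = Idn D (FOb F X)"
    and FAr_Comp: "\<lbrakk>f \<in> Hom C X Y; g \<in> Hom C Y Z\<rbrakk>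
      \<Longrightarrow> FAr F (g \<cdot>\<^bsub>C\<^esub> f) = FAr F g \<cdot>\<^bsub>D\<^esub> FAr F f"

locale exact_functor = is_functor C D F + C: abelian_category C + D: abelian_category D
  for C :: "('o, 'm, 'y) preadd_cat_scheme" and D :: "('p, 'n, 'z) preadd_cat_scheme"
    and F :: "('o, 'm, 'p, 'n, 'w) fctr_scheme" +
  assumes FAr_Add: "\<lbrakk>f \<in> Hom C X Y; g \<in> Hom C X Y\<rbrakk>
      \<Longrightarrow> FAr F (f \<oplus>\<^bsub>C\<^esub> g) = FAr F f \<oplus>\<^bsub>D\<^esub> FAr F g"
    and FAr_exact: "short_exact C i p \<Longrightarrow> short_exact D (FAr F i) (FAr F p)"

locale strong_monoidal_functor =
  is_functor C D F + C: monoidal_category C + D: monoidal_category D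
  for C :: "('o, 'm, 'k, 'y) mon_cat_scheme" and D :: "('p, 'n, 'k, 'z) mon_cat_scheme"
    and F :: "('o, 'm, 'p, 'n, 'w) mfctr_scheme" +
  assumes F2_Hom: "\<lbrakk>X \<in> Ob C; Y \<in> Ob C\<rbrakk>
      \<Longrightarrow> F2 F X Y \<in> Hom D (FOb F X \<otimes>\<^bsub>D\<^esub> FOb F Y) (FOb F (X \<otimes>\<^bsub>C\<^esub> Y))"
    and F2_iso: "\<lbrakk>X \<in> Ob C; Y \<in> Ob C\<rbrakk> \<Longrightarrow> is_iso D (F2 F X Y)"
    and F2_natural: "\<lbrakk>f \<in> Hom C X X'; g \<in> Hom C Y Y'\<rbrakk>
      \<Longrightarrow> F2 F X' Y' \<cdot>\<^bsub>D\<^esub> (FAr F f \<boxtimes>\<^bsub>D\<^esub> FAr F g) = FAr F (f \<boxtimes>\<^bsub>C\<^esub> g) \<cdot>\<^bsub>D\<^esub> F2 F X Y"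
    and F0_Hom: "F0 F \<in> Hom D \<one>\<^bsub>D\<^esub> (FOb F \<one>\<^bsub>C\<^esub>)"
    and F0_iso: "is_iso D (F0 F)"
    and F2_assoc: "\<lbrakk>X \<in> Ob C; Y \<in> Ob C; Z \<in> Ob C\<rbrakk>
      \<Longrightarrow> FAr F (Asc C X Y Z) \<cdot>\<^bsub>D\<^esub> F2 F (X \<otimes>\<^bsub>C\<^esub> Y) Z \<cdot>\<^bsub>D\<^esub> (F2 F X Y \<boxtimes>\<^bsub>D\<^esub> Idn D (FOb F Z))
        = F2 F X (Y \<otimes>\<^bsub>C\<^esub> Z) \<cdot>\<^bsub>D\<^esub> (Idn D (FOb F X) \<boxtimes>\<^bsub>D\<^esub> F2 F Y Z)
            \<cdot>\<^bsub>D\<^esub> Asc D (FOb F X) (FOb F Y) (FOb F Z)"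
    and F2_LUn: "X \<in> Ob C
      \<Longrightarrow> FAr F (LUn C X) \<cdot>\<^bsub>D\<^esub> F2 F \<one>\<^bsub>C\<^esub> X \<cdot>\<^bsub>D\<^esub> (F0 F \<boxtimes>\<^bsub>D\<^esub> Idn D (FOb F X)) = LUn D (FOb F X)"
    and F2_RUn: "X \<in> Ob C
      \<Longrightarrow> FAr F (RUn C X) \<cdot>\<^bsub>D\<^esub> F2 F X \<one>\<^bsub>C\<^esub> \<cdot>\<^bsub>D\<^esub> (Idn D (FOb F X) \<boxtimes>\<^bsub>D\<^esub> F0 F) = RUn D (FOb F X)"

locale tensor_functor =
  C: tensor_category C + D: tensor_category D +
  exact_functor C D F + strong_monoidal_functor C D F
  for C :: "('o, 'm, 'k::field, 'y) mon_cat_scheme" and D :: "('p, 'n, 'k, 'z) mon_cat_scheme"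
    and F :: "('o, 'm, 'p, 'n, 'w) mfctr_scheme" +
  assumes FAr_Scl: "f \<in> Hom C X Y \<Longrightarrow> FAr F (a \<odot>\<^bsub>C\<^esub> f) = a \<odot>\<^bsub>D\<^esub> FAr F f"

definition fully_faithful ::
    "('o, 'm, 'y) cat_scheme \<Rightarrow> ('p, 'n, 'z) cat_scheme \<Rightarrow> ('o, 'm, 'p, 'n, 'w) fctr_scheme \<Rightarrow> bool" where
  "fully_faithful C D F \<longleftrightarrow>
     (\<forall>X\<in>Ob C. \<forall>Y\<in>Ob C. bij_betw (FAr F) (Hom C X Y) (Hom D (FOb F X) (FOb F Y)))"

definition ess_image ::
    "('o, 'm, 'y) cat_scheme \<Rightarrow> ('p, 'n, 'z) cat_scheme \<Rightarrow> ('o, 'm, 'p, 'n, 'w) fctr_scheme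
      \<Rightarrow> ('p, 'n, 'z) cat_scheme" where
  "ess_image C D F = full_sub D {Y \<in> Ob D. \<exists>X\<in>Ob C. isomorphic D (FOb F X) Y}"

definition inclusion ::
    "('o, 'm, 'k, 'z) mon_cat_scheme \<Rightarrow> ('o, 'm, 'o, 'm) mfctr" where
  "inclusion C = \<lparr>FOb = (\<lambda>X. X), FAr = (\<lambda>f. f),
     F2 = (\<lambda>X Y. Idn C (X \<otimes>\<^bsub>C\<^esub> Y)), F0 = Idn C \<one>\<^bsub>C\<^esub>\<rparr>"

locale adjunction = F: is_functor C D F + R: is_functor D C R
  for C :: "('o, 'm, 'y) cat_scheme" and D :: "('p, 'n, 'z) cat_scheme"
    and F :: "('o, 'm, 'p, 'n, 'w) fctr_scheme" and R :: "('p, 'n, 'o, 'm, 'v) fctr_scheme" +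
  fixes \<eta> :: "'o \<Rightarrow> 'm" and \<epsilon> :: "'p \<Rightarrow> 'n"
  assumes unit_Hom: "X \<in> Ob C \<Longrightarrow> \<eta> X \<in> Hom C X (FOb R (FOb F X))"
    and unit_natural: "f \<in> Hom C X X' \<Longrightarrow> FAr R (FAr F f) \<cdot>\<^bsub>C\<^esub> \<eta> X = \<eta> X' \<cdot>\<^bsub>C\<^esub> f"
    and counit_Hom: "Y \<in> Ob D \<Longrightarrow> \<epsilon> Y \<in> Hom D (FOb F (FOb R Y)) Y"
    and counit_natural: "g \<in> Hom D Y Y' \<Longrightarrow> g \<cdot>\<^bsub>D\<^esub> \<epsilon> Y = \<epsilon> Y' \<cdot>\<^bsub>D\<^esub> FAr F (FAr R g)"
    and triangle_F: "X \<in> Ob C \<Longrightarrow> \<epsilon> (FOb F X) \<cdot>\<^bsub>D\<^esub> FAr F (\<eta> X) = Idn D (FOb F X)"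
    and triangle_R: "Y \<in> Ob D \<Longrightarrow> FAr R (\<epsilon> Y) \<cdot>\<^bsub>C\<^esub> \<eta> (FOb R Y) = Idn C (FOb R Y)"


section \<open>Dominant and normal functors, exact sequences\<close>

definition dominant ::
    "('o, 'm, 'y) cat_scheme \<Rightarrow> ('p, 'n, 'z) cat_scheme \<Rightarrow> ('o, 'm, 'p, 'n, 'w) fctr_scheme \<Rightarrow> bool" where
  "dominant C D F \<longleftrightarrow>
     (\<forall>Y\<in>Ob D. \<exists>X\<in>Ob C. \<exists>j\<in>Hom D Y (FOb F X). is_mono D j)"

text \<open>The subobject \<open>j\<close> of \<open>Y\<close> is the largest trivial subobject of \<open>Y\<close>.\<close>

definition largest_trivial_sub ::
    "('o, 'm, 'k, 'z) mon_cat_scheme \<Rightarrow> 'm \<Rightarrow> 'o \<Rightarrow> bool" where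
  "largest_trivial_sub D j Y \<longleftrightarrow> is_mono D j \<and> Cod D j = Y \<and> is_trivial D (Dom D j) \<and>
     (\<forall>t. is_mono D t \<and> Cod D t = Y \<and> is_trivial D (Dom D t) \<longrightarrow>
        (\<exists>h\<in>Hom D (Dom D t) (Dom D j). j \<cdot>\<^bsub>D\<^esub> h = t))"

definition normal ::
    "('o, 'm, 'k, 'y) mon_cat_scheme \<Rightarrow> ('p, 'n, 'k, 'z) mon_cat_scheme
      \<Rightarrow> ('o, 'm, 'p, 'n, 'w) fctr_scheme \<Rightarrow> bool" where
  "normal C D F \<longleftrightarrow>
     (\<forall>X\<in>Ob C. \<exists>i. is_mono C i \<and> Cod C i = X \<and> largest_trivial_sub D (FAr F i) (FOb F X))"

definition Ker ::
    "('o, 'm, 'k, 'y) mon_cat_scheme \<Rightarrow> ('p, 'n, 'k, 'z) mon_cat_scheme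
      \<Rightarrow> ('o, 'm, 'p, 'n, 'w) fctr_scheme \<Rightarrow> ('o, 'm, 'k, 'y) mon_cat_scheme" where
  "Ker C D F = full_sub C {X \<in> Ob C. is_trivial D (FOb F X)}"

definition exact_sequence ::
    "('o1, 'm1, 'k::field, 'z1) mon_cat_scheme \<Rightarrow> ('o1, 'm1, 'o, 'm, 'w1) mfctr_scheme
      \<Rightarrow> ('o, 'm, 'k, 'z) mon_cat_scheme \<Rightarrow> ('o, 'm, 'o2, 'm2, 'w2) mfctr_scheme
      \<Rightarrow> ('o2, 'm2, 'k, 'z2) mon_cat_scheme \<Rightarrow> bool" where
  "exact_sequence C' f C F C'' \<longleftrightarrow>
     tensor_functor C' C f \<and> tensor_functor C C'' F \<and>
     dominant C C'' F \<and> normal C C'' F \<and>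
     fully_faithful C' C f \<and> ess_image C' C f = Ker C C'' F"


section \<open>The subcategory generated by an object\<close>

definition abelian_subcategory :: "('o, 'm, 'k, 'z) mon_cat_scheme \<Rightarrow> 'o set \<Rightarrow> bool" where
  "abelian_subcategory C S \<longleftrightarrow> S \<subseteq> Ob C \<and> exact_functor (full_sub C S) C (inclusion C)"

definition stable :: "('o, 'm, 'z) preadd_cat_scheme \<Rightarrow> 'o set \<Rightarrow> bool" where
  "stable C S \<longleftrightarrow>
     (\<forall>X\<in>S. \<forall>Y\<in>S. \<forall>P. is_dsum C X Y P \<longrightarrow> P \<in> S) \<and>
     (\<forall>i. is_mono C i \<and> Cod C i \<in> S \<longrightarrow> Dom C i \<in> S) \<and>
     (\<forall>q. is_epi C q \<and> Dom C q \<in> S \<longrightarrow> Cod C q \<in> S)"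

text \<open>
  Subcategories are taken to be full, so they are given by their objects.  The monoidal
  structure of \<open>C\<close> is carried along; that it restricts to \<open>gen_sub C X\<close> is not part of the
  definition.
\<close>

definition gen_sub :: "('o, 'm, 'k, 'z) mon_cat_scheme \<Rightarrow> 'o \<Rightarrow> ('o, 'm, 'k, 'z) mon_cat_scheme" where
  "gen_sub C X = full_sub C (\<Inter>{S. abelian_subcategory C S \<and> stable C S \<and> X \<in> S})"


section \<open>Algebras and modules\<close>

record ('o, 'm) alg =
  aob :: "'o"
  amul :: "'m"
  aunit :: "'m"

definition is_right_module ::
    "('o, 'm, 'k, 'z) mon_cat_scheme \<Rightarrow> ('o, 'm, 'w) alg_scheme \<Rightarrow> 'o \<times> 'm \<Rightarrow> bool" where
  "is_right_module C A M \<longleftrightarrow> (case M of (X, r) \<Rightarrow>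
     X \<in> Ob C \<and> r \<in> Hom C (X \<otimes>\<^bsub>C\<^esub> aob A) X \<and>
     r \<cdot>\<^bsub>C\<^esub> (r \<boxtimes>\<^bsub>C\<^esub> Idn C (aob A))
       = r \<cdot>\<^bsub>C\<^esub> (Idn C X \<boxtimes>\<^bsub>C\<^esub> amul A) \<cdot>\<^bsub>C\<^esub> Asc C X (aob A) (aob A) \<and>
     r \<cdot>\<^bsub>C\<^esub> (Idn C X \<boxtimes>\<^bsub>C\<^esub> aunit A) = RUn C X)"

text \<open>
  The category of right \<open>A\<close>-modules in \<open>C\<close>.  An arrow is a triple (source module,
  underlying arrow of \<open>C\<close>, target module).
\<close>

definition mod_cat ::
    "('o, 'm, 'k, 'z) mon_cat_scheme \<Rightarrow> ('o, 'm, 'w) alg_scheme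
      \<Rightarrow> ('o \<times> 'm, ('o \<times> 'm) \<times> 'm \<times> ('o \<times> 'm), 'k) lin_cat" where
  "mod_cat C A =
     \<lparr>Ob = {M. is_right_module C A M},
      Arr = {(M, f, N). is_right_module C A M \<and> is_right_module C A N \<and>
               f \<in> Hom C (fst M) (fst N) \<and>
               f \<cdot>\<^bsub>C\<^esub> snd M = snd N \<cdot>\<^bsub>C\<^esub> (f \<boxtimes>\<^bsub>C\<^esub> Idn C (aob A))},
      Dom = (\<lambda>(M, f, N). M),
      Cod = (\<lambda>(M, f, N). N),
      Idn = (\<lambda>M. (M, Idn C (fst M), M)),
      Comp = (\<lambda>(M', g, N') (M, f, N). (M, g \<cdot>\<^bsub>C\<^esub> f, N')),
      Zer = (\<lambda>M N. (M, Zer C (fst M) (fst N), N)),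
      Add = (\<lambda>(M, f, N) (M', g, N'). (M, f \<oplus>\<^bsub>C\<^esub> g, N)),
      Scl = (\<lambda>a (M, f, N). (M, a \<odot>\<^bsub>C\<^esub> f, N))\<rparr>"

definition free_module ::
    "('o, 'm, 'k, 'z) mon_cat_scheme \<Rightarrow> ('o, 'm, 'w) alg_scheme \<Rightarrow> 'o \<Rightarrow> 'o \<times> 'm" where
  "free_module C A X =
     (X \<otimes>\<^bsub>C\<^esub> aob A, (Idn C X \<boxtimes>\<^bsub>C\<^esub> amul A) \<cdot>\<^bsub>C\<^esub> Asc C X (aob A) (aob A))"

definition free_functor ::
    "('o, 'm, 'k, 'z) mon_cat_scheme \<Rightarrow> ('o, 'm, 'w) alg_scheme
      \<Rightarrow> ('o, 'm, 'o \<times> 'm, ('o \<times> 'm) \<times> 'm \<times> ('o \<times> 'm)) fctr" where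
  "free_functor C A =
     \<lparr>FOb = free_module C A,
      FAr = (\<lambda>f. (free_module C A (Dom C f), f \<boxtimes>\<^bsub>C\<^esub> Idn C (aob A), free_module C A (Cod C f)))\<rparr>"

definition trivializes ::
    "('o, 'm, 'k, 'z) mon_cat_scheme \<Rightarrow> ('o, 'm, 'w) alg_scheme \<Rightarrow> 'o \<Rightarrow> bool" where
  "trivializes C A X \<longleftrightarrow>
     (\<exists>n P. is_power (mod_cat C A) (FOb (free_functor C A) \<one>\<^bsub>C\<^esub>) n P \<and>
            isomorphic (mod_cat C A) (FOb (free_functor C A) X) P)"

definition self_trivializing ::
    "('o, 'm, 'k, 'z) mon_cat_scheme \<Rightarrow> ('o, 'm, 'w) alg_scheme \<Rightarrow> bool" where
  "self_trivializing C A \<longleftrightarrow> trivializes C A (aob A)"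


section \<open>The induced central algebra\<close>

text \<open>
  The canonical monoidal structure of the right adjoint \<open>R\<close> of a strong monoidal functor
  \<open>F\<close> is the mate of the inverse constraints \<open>F (U \<otimes> V) \<rightarrow> F U \<otimes> F V\<close> and \<open>F \<one> \<rightarrow> \<one>\<close>.
\<close>

definition adj_R2 ::
    "('o, 'm, 'k, 'y) mon_cat_scheme \<Rightarrow> ('p, 'n, 'k, 'z) mon_cat_scheme
      \<Rightarrow> ('o, 'm, 'p, 'n, 'w) mfctr_scheme \<Rightarrow> ('p, 'n, 'o, 'm, 'v) fctr_scheme
      \<Rightarrow> ('o \<Rightarrow> 'm) \<Rightarrow> ('p \<Rightarrow> 'n) \<Rightarrow> 'p \<Rightarrow> 'p \<Rightarrow> 'm" where
  "adj_R2 C D F R \<eta> \<epsilon> X Y =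
     FAr R (\<epsilon> X \<boxtimes>\<^bsub>D\<^esub> \<epsilon> Y) \<cdot>\<^bsub>C\<^esub> FAr R (inv_arr D (F2 F (FOb R X) (FOb R Y)))
       \<cdot>\<^bsub>C\<^esub> \<eta> (FOb R X \<otimes>\<^bsub>C\<^esub> FOb R Y)"

definition adj_R0 ::
    "('o, 'm, 'k, 'y) mon_cat_scheme \<Rightarrow> ('p, 'n, 'k, 'z) mon_cat_scheme
      \<Rightarrow> ('o, 'm, 'p, 'n, 'w) mfctr_scheme \<Rightarrow> ('p, 'n, 'o, 'm, 'v) fctr_scheme
      \<Rightarrow> ('o \<Rightarrow> 'm) \<Rightarrow> 'm" where
  "adj_R0 C D F R \<eta> = FAr R (inv_arr D (F0 F)) \<cdot>\<^bsub>C\<^esub> \<eta> \<one>\<^bsub>C\<^esub>"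

text \<open>
  The identifications \<open>\<one> \<otimes> Y = Y = Y \<otimes> \<one>\<close> that are suppressed in the strict notation
  appear below as \<open>R\<close> applied to the unit constraints of \<open>D\<close>.
\<close>

definition induced_algebra ::
    "('o, 'm, 'k, 'y) mon_cat_scheme \<Rightarrow> ('p, 'n, 'k, 'z) mon_cat_scheme
      \<Rightarrow> ('o, 'm, 'p, 'n, 'w) mfctr_scheme \<Rightarrow> ('p, 'n, 'o, 'm, 'v) fctr_scheme
      \<Rightarrow> ('o \<Rightarrow> 'm) \<Rightarrow> ('p \<Rightarrow> 'n) \<Rightarrow> ('o, 'm) alg" where
  "induced_algebra C D F R \<eta> \<epsilon> =
     \<lparr>aob = FOb R \<one>\<^bsub>D\<^esub>,
      amul = FAr R (LUn D \<one>\<^bsub>D\<^esub>) \<cdot>\<^bsub>C\<^esub> adj_R2 C D F R \<eta> \<epsilon> \<one>\<^bsub>D\<^esub> \<one>\<^bsub>D\<^esub>,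
      aunit = adj_R0 C D F R \<eta>\<rparr>"

definition induced_half_braiding ::
    "('o, 'm, 'k, 'y) mon_cat_scheme \<Rightarrow> ('p, 'n, 'k, 'z) mon_cat_scheme
      \<Rightarrow> ('o, 'm, 'p, 'n, 'w) mfctr_scheme \<Rightarrow> ('p, 'n, 'o, 'm, 'v) fctr_scheme
      \<Rightarrow> ('o \<Rightarrow> 'm) \<Rightarrow> ('p \<Rightarrow> 'n) \<Rightarrow> 'o \<Rightarrow> 'm" where
  "induced_half_braiding C D F R \<eta> \<epsilon> X = (let A = FOb R \<one>\<^bsub>D\<^esub> in
     THE s. s \<in> Hom C (A \<otimes>\<^bsub>C\<^esub> X) (X \<otimes>\<^bsub>C\<^esub> A) \<and>
       FAr R (RUn D (FOb F X)) \<cdot>\<^bsub>C\<^esub> adj_R2 C D F R \<eta> \<epsilon> (FOb F X) \<one>\<^bsub>D\<^esub>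
           \<cdot>\<^bsub>C\<^esub> (\<eta> X \<boxtimes>\<^bsub>C\<^esub> Idn C A) \<cdot>\<^bsub>C\<^esub> s
         = FAr R (LUn D (FOb F X)) \<cdot>\<^bsub>C\<^esub> adj_R2 C D F R \<eta> \<epsilon> \<one>\<^bsub>D\<^esub> (FOb F X)
           \<cdot>\<^bsub>C\<^esub> (Idn C A \<boxtimes>\<^bsub>C\<^esub> \<eta> X))"

definition induced_central_algebra ::
    "('o, 'm, 'k, 'y) mon_cat_scheme \<Rightarrow> ('p, 'n, 'k, 'z) mon_cat_scheme
      \<Rightarrow> ('o, 'm, 'p, 'n, 'w) mfctr_scheme \<Rightarrow> ('p, 'n, 'o, 'm, 'v) fctr_scheme
      \<Rightarrow> ('o \<Rightarrow> 'm) \<Rightarrow> ('p \<Rightarrow> 'n) \<Rightarrow> ('o, 'm) alg \<times> ('o \<Rightarrow> 'm)" where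
  "induced_central_algebra C D F R \<eta> \<epsilon> =
     (induced_algebra C D F R \<eta> \<epsilon>, induced_half_braiding C D F R \<eta> \<epsilon>)"

end

theory Submission
  imports Defs
begin

text \<open>
  The proof compares arrows between free modules with arrows in \<open>D\<close>, and trivial objects with objects
  generated or cogenerated by the unit object.

  Write \<open>e : F A \<rightarrow> \<one>\<close> for the counit of the adjunction at the unit object, and \<open>q\<^sub>Y : F (Y \<otimes> A) \<rightarrow> F Y\<close> for the
  arrow that forgets \<open>A\<close> by means of \<open>e\<close>. As \<open>Y\<close> has a dual, the pair of \<open>Y \<otimes> A\<close> and \<open>q\<^sub>Y\<close> is a universal
  arrow from \<open>F\<close> to \<open>F Y\<close> (lemmas \<open>q_inj\<close> and \<open>q_surj\<close>); in other words \<open>Y \<otimes> A\<close> represents \<open>R (F Y)\<close>.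
  Consequently arrows into \<open>Y \<otimes> A\<close> can be compared in \<open>D\<close>, and module arrows from \<open>X \<otimes> A\<close> to \<open>Y \<otimes> A\<close> are
  the same as arrows from \<open>F X\<close> to \<open>F Y\<close> (\<open>free_isomorphic_iff\<close>). It follows that \<open>A\<close> trivializes
  \<open>X\<close> if and only if \<open>F X\<close> is trivial (\<open>trivializes_iff\<close>). In particular \<open>A\<close> is self-trivializing if and only
  if \<open>F A\<close> is trivial.

  The unit object of a tensor category is simple (\<open>sub_unit\<close>). Therefore an object is trivial if and only if it is
  cogenerated by the unit object, and if and only if it is generated by the unit object (\<open>trivial_iff_cogen\<close>,
  \<open>trivial_iff_gen\<close>), and trivial objects are closed under subobjects, quotients, sums, tensor
  products and duals. Since \<open>F\<close> is exact and monoidal, the kernel of \<open>F\<close> has the same closure properties.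

  Now let \<open>B\<close> be a right dual of \<open>A\<close>. Composing \<open>q\<^sub>B\<close> with the image of the coevaluation \<open>\<one> \<rightarrow> B \<otimes> A\<close> gives an arrow
  \<open>\<nu> : F \<one> \<rightarrow> F B\<close>, and every arrow \<open>F \<one> \<rightarrow> F X\<close> is \<open>F g\<close> after \<open>\<nu>\<close> for a unique \<open>g : B \<rightarrow> X\<close>
  (\<open>universal_from_unit\<close>). If \<open>F\<close> is normal, then \<open>\<nu>\<close> factors through the largest trivial subobject \<open>F S\<close> of
  \<open>F B\<close>, with \<open>S\<close> a subobject of \<open>B\<close>; by universality \<open>S\<close> equals \<open>B\<close>, so \<open>F B\<close> is trivial, and so is
  \<open>F A\<close>. Conversely, if \<open>F A\<close> is trivial then so is \<open>F B\<close>, and the sum of the images of all arrows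
  \<open>B \<rightarrow> X\<close> is a subobject of \<open>X\<close> whose image under \<open>F\<close> is trivial and contains the images of all arrows
  from the unit object; this image is the largest trivial subobject.

  Finally suppose that \<open>F A\<close> is trivial. The kernel of \<open>F\<close> contains \<open>A\<close> and is a stable abelian subcategory, so it
  contains the subcategory generated by \<open>A\<close>. Conversely, if \<open>F X\<close> is trivial then \<open>X \<otimes> A\<close> is isomorphic to a
  power of \<open>A\<close>, and \<open>X\<close> embeds in it because \<open>F\<close> is faithful (\<open>K_subset\<close>).
\<close>

section \<open>Categories\<close>

lemma HomD:
  assumes "f \<in> Hom C X Y"
  shows "f \<in> Arr C" "Dom C f = X" "Cod C f = Y"
  using assms by (auto simp: Hom_def)

lemma Hom_iff: "f \<in> Hom C X Y \<longleftrightarrow> f \<in> Arr C \<and> Dom C f = X \<and> Cod C f = Y"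
  by (simp add: Hom_def)

context category
begin

declare Dom_Ob [simp] Cod_Ob [simp]

lemma Hom_Ob:
  assumes "f \<in> Hom C X Y"
  shows "X \<in> Ob C" "Y \<in> Ob C"
  using assms by (auto simp: Hom_def)

lemma Idn_simps [simp]:
  assumes "X \<in> Ob C"
  shows "Idn C X \<in> Arr C" "Dom C (Idn C X) = X" "Cod C (Idn C X) = X"
  using Idn_Hom [OF assms] by (auto simp: Hom_def)

lemma Comp_simps [simp]:
  assumes "f \<in> Arr C" "g \<in> Arr C" "Dom C g = Cod C f"
  shows "g \<cdot> f \<in> Arr C" "Dom C (g \<cdot> f) = Dom C f" "Cod C (g \<cdot> f) = Cod C g"
  using Comp_Hom [of f "Dom C f" "Cod C f" g "Cod C g"] assms by (auto simp: Hom_def)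

lemma Comp_assoc' [simp]:
  assumes "f \<in> Arr C" "g \<in> Arr C" "h \<in> Arr C" "Dom C g = Cod C f" "Dom C h = Cod C g"
  shows "(h \<cdot> g) \<cdot> f = h \<cdot> (g \<cdot> f)"
  using Comp_assoc [of f "Dom C f" "Cod C f" g "Cod C g" h "Cod C h"] assms
  by (auto simp: Hom_def)

lemma Comp_Idn' [simp]: "f \<in> Arr C \<Longrightarrow> Dom C f = X \<Longrightarrow> f \<cdot> Idn C X = f"
  using Comp_Idn [of f "Dom C f" "Cod C f"] by (auto simp: Hom_def)

lemma Idn_Comp' [simp]: "f \<in> Arr C \<Longrightarrow> Cod C f = X \<Longrightarrow> Idn C X \<cdot> f = f"
  using Idn_Comp [of f "Dom C f" "Cod C f"] by (auto simp: Hom_def)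

text \<open>An equation between two composites persists after precomposition; this turns equations
  into rewrite rules for composites associated to the right.\<close>

lemma Comp_pre:
  assumes "g \<cdot> f = k" "f \<in> Arr C" "g \<in> Arr C" "Dom C g = Cod C f" "x \<in> Arr C" "Cod C x = Dom C f"
  shows "g \<cdot> (f \<cdot> x) = k \<cdot> x"
  using Comp_assoc' [of x f g] assms by simp

lemma inverse_arrows_unique:
  assumes "inverse_arrows C f g" "inverse_arrows C f h"
  shows "g = h"
proof -
  have fg: "f \<in> Arr C" "g \<in> Arr C" "h \<in> Arr C" "Dom C g = Cod C f" "Cod C g = Dom C f"
    "Dom C h = Cod C f" "Cod C h = Dom C f"
    using assms by (auto simp: inverse_arrows_def Hom_def)
  have "g = g \<cdot> (f \<cdot> h)"
    using assms fg by (simp add: inverse_arrows_def)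
  also have "\<dots> = (g \<cdot> f) \<cdot> h"
    using fg by simp
  also have "\<dots> = h"
    using assms fg by (simp only: inverse_arrows_def) simp
  finally show ?thesis .
qed

lemma inv_arr_eq: "inverse_arrows C f g \<Longrightarrow> inv_arr C f = g"
  unfolding inv_arr_def by (blast intro: the_equality inverse_arrows_unique)

lemma inv_arr_inverse: "is_iso C f \<Longrightarrow> inverse_arrows C f (inv_arr C f)"
  using inv_arr_eq by (auto simp: is_iso_def)

lemma iso_Arr: "is_iso C f \<Longrightarrow> f \<in> Arr C"
  by (auto simp: is_iso_def inverse_arrows_def)

lemma inv_arr_simps [simp]:
  assumes "is_iso C f"
  shows "inv_arr C f \<in> Arr C" "Dom C (inv_arr C f) = Cod C f" "Cod C (inv_arr C f) = Dom C f"
    "inv_arr C f \<cdot> f = Idn C (Dom C f)" "f \<cdot> inv_arr C f = Idn C (Cod C f)"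
  using inv_arr_inverse [OF assms] by (auto simp: inverse_arrows_def Hom_def)

lemma inv_arr_Comp [simp]:
  assumes "is_iso C f" "x \<in> Arr C"
  shows "Cod C x = Dom C f \<Longrightarrow> inv_arr C f \<cdot> (f \<cdot> x) = x"
    "Cod C x = Cod C f \<Longrightarrow> f \<cdot> (inv_arr C f \<cdot> x) = x"
  using Comp_pre [OF inv_arr_simps(4), of f x] Comp_pre [OF inv_arr_simps(5), of f x]
    assms iso_Arr by auto

lemma inverse_arrows_sym: "inverse_arrows C f g \<Longrightarrow> inverse_arrows C g f"
  by (auto simp: inverse_arrows_def Hom_def)

lemma inv_arr_iso [simp]: "is_iso C f \<Longrightarrow> is_iso C (inv_arr C f)"
  using inv_arr_inverse inverse_arrows_sym by (auto simp: is_iso_def)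

lemma inv_arr_inv_arr [simp]: "is_iso C f \<Longrightarrow> inv_arr C (inv_arr C f) = f"
  using inv_arr_inverse inverse_arrows_sym inv_arr_eq by blast

lemma isoI:
  assumes "f \<in> Hom C X Y" "g \<in> Hom C Y X" "g \<cdot> f = Idn C X" "f \<cdot> g = Idn C Y"
  shows "is_iso C f" "inv_arr C f = g"
proof -
  have "inverse_arrows C f g"
    using assms by (auto simp: inverse_arrows_def Hom_def)
  then show "is_iso C f" "inv_arr C f = g"
    by (auto simp: is_iso_def inv_arr_eq)
qed

lemma iso_Idn [simp]: "X \<in> Ob C \<Longrightarrow> is_iso C (Idn C X)"
  and inv_Idn [simp]: "X \<in> Ob C \<Longrightarrow> inv_arr C (Idn C X) = Idn C X"
  using isoI [OF Idn_Hom Idn_Hom] by simp_all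

lemma iso_Comp:
  assumes "is_iso C f" "is_iso C g" "Dom C g = Cod C f"
  shows "is_iso C (g \<cdot> f)" "inv_arr C (g \<cdot> f) = inv_arr C f \<cdot> inv_arr C g"
proof -
  note [simp] = assms iso_Arr [OF assms(1)] iso_Arr [OF assms(2)]
  have "g \<cdot> f \<in> Hom C (Dom C f) (Cod C g)"
    "inv_arr C f \<cdot> inv_arr C g \<in> Hom C (Cod C g) (Dom C f)"
    by (simp_all add: Hom_def)
  then show "is_iso C (g \<cdot> f)" "inv_arr C (g \<cdot> f) = inv_arr C f \<cdot> inv_arr C g"
    by (auto intro!: isoI)
qed

lemma iso_cancel_left:
  assumes "is_iso C h" "f \<in> Arr C" "g \<in> Arr C" "Cod C f = Dom C h" "Cod C g = Dom C h" "h \<cdot> f = h \<cdot> g"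
  shows "f = g"
proof -
  have "f = inv_arr C h \<cdot> (h \<cdot> f)"
    using assms(1-5) by simp
  also have "\<dots> = inv_arr C h \<cdot> (h \<cdot> g)"
    unfolding assms(6) ..
  also have "\<dots> = g"
    using assms(1-5) by simp
  finally show ?thesis .
qed

lemma iso_cancel_right:
  assumes "is_iso C h" "f \<in> Arr C" "g \<in> Arr C" "Dom C f = Cod C h" "Dom C g = Cod C h" "f \<cdot> h = g \<cdot> h"
  shows "f = g"
proof -
  note [simp] = assms(1-5) iso_Arr [OF assms(1)]
  have "f = (f \<cdot> h) \<cdot> inv_arr C h"
    by simp
  also have "\<dots> = (g \<cdot> h) \<cdot> inv_arr C h"
    unfolding assms(6) ..
  also have "\<dots> = g"
    by simp
  finally show ?thesis .
qed

lemma iso_move_left: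
  assumes "is_iso C h" "f \<in> Arr C" "Cod C f = Dom C h" "h \<cdot> f = g"
  shows "f = inv_arr C h \<cdot> g"
  unfolding assms(4) [symmetric] using assms(1-3) by simp

lemma iso_move_right:
  assumes "is_iso C h" "f \<in> Arr C" "Dom C f = Cod C h" "f \<cdot> h = g"
  shows "f = g \<cdot> inv_arr C h"
  unfolding assms(4) [symmetric] using assms(1-3) iso_Arr [OF assms(1)] by simp

lemma inv_square:
  assumes "is_iso C a" "is_iso C b" "f \<in> Arr C" "g \<in> Arr C"
    "Dom C f = Cod C a" "Dom C b = Cod C g" "Dom C g = Dom C a" "Cod C f = Cod C b"
    "f \<cdot> a = b \<cdot> g"
  shows "inv_arr C b \<cdot> f = g \<cdot> inv_arr C a"
proof -
  note [simp] = assms(1-8) iso_Arr [OF assms(1)] iso_Arr [OF assms(2)]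
  have "inv_arr C b \<cdot> f = inv_arr C b \<cdot> ((f \<cdot> a) \<cdot> inv_arr C a)"
    by simp
  also have "\<dots> = g \<cdot> inv_arr C a"
    unfolding assms(9) by simp
  finally show ?thesis .
qed

lemma mono_cancel:
  assumes "is_mono C m" "m \<cdot> f = m \<cdot> g" "f \<in> Hom C T (Dom C m)" "g \<in> Hom C T (Dom C m)"
  shows "f = g"
  using assms by (auto simp: is_mono_def)

lemma epi_cancel:
  assumes "is_epi C e" "f \<cdot> e = g \<cdot> e" "f \<in> Hom C (Cod C e) T" "g \<in> Hom C (Cod C e) T"
  shows "f = g"
  using assms by (auto simp: is_epi_def)

lemma iso_mono: "is_iso C f \<Longrightarrow> is_mono C f"
  unfolding is_mono_def using iso_Arr
  by (blast intro: iso_cancel_left dest: HomD)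

lemma iso_epi: "is_iso C f \<Longrightarrow> is_epi C f"
  unfolding is_epi_def using iso_Arr
  by (blast intro: iso_cancel_right dest: HomD)

lemma mono_Comp:
  assumes "is_mono C m" "is_mono C n" "Dom C n = Cod C m"
  shows "is_mono C (n \<cdot> m)"
proof -
  have [simp]: "m \<in> Arr C" "n \<in> Arr C"
    using assms by (auto simp: is_mono_def)
  show ?thesis
    unfolding is_mono_def
  proof (intro conjI allI ballI impI)
    fix T f g
    assume f: "f \<in> Hom C T (Dom C (n \<cdot> m))" and g: "g \<in> Hom C T (Dom C (n \<cdot> m))"
      and eq: "(n \<cdot> m) \<cdot> f = (n \<cdot> m) \<cdot> g"
    have [simp]: "f \<in> Arr C" "g \<in> Arr C" "Cod C f = Dom C m" "Cod C g = Dom C m" "Dom C f = T" "Dom C g = T"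
      using f g assms(3) by (auto simp: Hom_def)
    have "n \<cdot> (m \<cdot> f) = n \<cdot> (m \<cdot> g)"
      using eq assms(3) by simp
    then have "m \<cdot> f = m \<cdot> g"
      by (rule mono_cancel [OF assms(2), where T = T]) (auto simp: Hom_def assms(3))
    then show "f = g"
      by (rule mono_cancel [OF assms(1), where T = T]) (auto simp: Hom_def)
  qed (use assms in simp)
qed

lemma mono_split_epi_iso:
  assumes "is_mono C m" "s \<in> Hom C (Cod C m) (Dom C m)" "m \<cdot> s = Idn C (Cod C m)"
  shows "is_iso C m" "inv_arr C m = s"
proof -
  have m: "m \<in> Hom C (Dom C m) (Cod C m)"
    using assms by (simp add: is_mono_def Hom_def)
  have "s \<cdot> m = Idn C (Dom C m)"
  proof (rule mono_cancel [OF assms(1)])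
    have "m \<cdot> (s \<cdot> m) = (m \<cdot> s) \<cdot> m"
      using assms(2) m by (intro Comp_assoc' [symmetric]) (simp_all add: Hom_def)
    then show "m \<cdot> (s \<cdot> m) = m \<cdot> Idn C (Dom C m)"
      using assms m by (simp add: Hom_def)
  qed (use assms m in \<open>auto simp: Hom_def\<close>)
  then show "is_iso C m" "inv_arr C m = s"
    using isoI [OF m assms(2)] assms(3) by simp_all
qed

lemma isomorphic_refl: "X \<in> Ob C \<Longrightarrow> isomorphic C X X"
  unfolding isomorphic_def using Idn_Hom iso_Idn by blast

lemma isomorphic_sym: "isomorphic C X Y \<Longrightarrow> isomorphic C Y X"
  unfolding isomorphic_def
proof (elim bexE)
  fix f assume f: "f \<in> Hom C X Y" "is_iso C f"
  show "\<exists>f\<in>Hom C Y X. is_iso C f"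
    by (rule bexI [of _ "inv_arr C f"]) (use f in \<open>simp_all add: Hom_def\<close>)
qed

lemma isomorphic_trans: "isomorphic C X Y \<Longrightarrow> isomorphic C Y Z \<Longrightarrow> isomorphic C X Z"
  unfolding isomorphic_def
proof (elim bexE)
  fix f g assume f: "f \<in> Hom C X Y" "is_iso C f" and g: "g \<in> Hom C Y Z" "is_iso C g"
  show "\<exists>f\<in>Hom C X Z. is_iso C f"
    by (rule bexI [of _ "g \<cdot> f"]) (use f g in \<open>simp_all add: Hom_def iso_Comp\<close>)
qed

end

section \<open>Monoidal categories\<close>

context monoidal_category
begin

declare Unt_Ob [simp] TOb_Ob [simp] Asc_iso [simp] LUn_iso [simp] RUn_iso [simp]

lemma TAr_simps [simp]:
  assumes "f \<in> Arr C" "g \<in> Arr C"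
  shows "f \<boxtimes> g \<in> Arr C" "Dom C (f \<boxtimes> g) = Dom C f \<otimes> Dom C g" "Cod C (f \<boxtimes> g) = Cod C f \<otimes> Cod C g"
  using TAr_Hom [of f "Dom C f" "Cod C f" g "Dom C g" "Cod C g"] assms by (auto simp: Hom_def)

lemma constraint_simps [simp]:
  assumes "X \<in> Ob C"
  shows "LUn C X \<in> Arr C" "Dom C (LUn C X) = \<one> \<otimes> X" "Cod C (LUn C X) = X"
    "RUn C X \<in> Arr C" "Dom C (RUn C X) = X \<otimes> \<one>" "Cod C (RUn C X) = X"
  using LUn_Hom [OF assms] RUn_Hom [OF assms] by (auto simp: Hom_def)

lemma Asc_simps [simp]:
  assumes "X \<in> Ob C" "Y \<in> Ob C" "Z \<in> Ob C"
  shows "Asc C X Y Z \<in> Arr C" "Dom C (Asc C X Y Z) = (X \<otimes> Y) \<otimes> Z" "Cod C (Asc C X Y Z) = X \<otimes> (Y \<otimes> Z)"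
  using Asc_Hom [OF assms] by (auto simp: Hom_def)

declare TAr_Idn [simp]

lemma interchange:
  assumes "f \<in> Arr C" "g \<in> Arr C" "f' \<in> Arr C" "g' \<in> Arr C" "Dom C f' = Cod C f" "Dom C g' = Cod C g"
  shows "(f' \<boxtimes> g') \<cdot> (f \<boxtimes> g) = (f' \<cdot> f) \<boxtimes> (g' \<cdot> g)"
  using TAr_Comp [of f "Dom C f" "Cod C f" f' "Cod C f'" g "Dom C g" "Cod C g" g' "Cod C g'"] assms
  by (auto simp: Hom_def)

lemma interchange_Comp:
  assumes "f \<in> Arr C" "g \<in> Arr C" "f' \<in> Arr C" "g' \<in> Arr C" "Dom C f' = Cod C f" "Dom C g' = Cod C g"
    "x \<in> Arr C" "Cod C x = Dom C f \<otimes> Dom C g"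
  shows "(f' \<boxtimes> g') \<cdot> ((f \<boxtimes> g) \<cdot> x) = ((f' \<cdot> f) \<boxtimes> (g' \<cdot> g)) \<cdot> x"
  by (rule Comp_pre [OF interchange]) (use assms in simp_all)

lemmas merge = interchange interchange_Comp

lemma iso_TAr [simp]:
  assumes "is_iso C f" "is_iso C g"
  shows "is_iso C (f \<boxtimes> g)" "inv_arr C (f \<boxtimes> g) = inv_arr C f \<boxtimes> inv_arr C g"
proof -
  note [simp] = assms iso_Arr [OF assms(1)] iso_Arr [OF assms(2)]
  have "f \<boxtimes> g \<in> Hom C (Dom C f \<otimes> Dom C g) (Cod C f \<otimes> Cod C g)"
    "inv_arr C f \<boxtimes> inv_arr C g \<in> Hom C (Cod C f \<otimes> Cod C g) (Dom C f \<otimes> Dom C g)"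
    by (simp_all add: Hom_def)
  then show "is_iso C (f \<boxtimes> g)" "inv_arr C (f \<boxtimes> g) = inv_arr C f \<boxtimes> inv_arr C g"
    by (auto intro!: isoI simp: merge)
qed

lemma Asc_nat:
  assumes "f \<in> Arr C" "g \<in> Arr C" "h \<in> Arr C" "Cod C f = X" "Cod C g = Y" "Cod C h = Z"
  shows "Asc C X Y Z \<cdot> ((f \<boxtimes> g) \<boxtimes> h) = (f \<boxtimes> (g \<boxtimes> h)) \<cdot> Asc C (Dom C f) (Dom C g) (Dom C h)"
  using Asc_natural [of f "Dom C f" X g "Dom C g" Y h "Dom C h" Z] assms by (simp add: Hom_def)

lemma LUn_nat:
  assumes "f \<in> Arr C" "Cod C f = X"
  shows "LUn C X \<cdot> (Idn C \<one> \<boxtimes> f) = f \<cdot> LUn C (Dom C f)"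
  using LUn_natural [of f "Dom C f" X] assms by (simp add: Hom_def)

lemma RUn_nat:
  assumes "f \<in> Arr C" "Cod C f = X"
  shows "RUn C X \<cdot> (f \<boxtimes> Idn C \<one>) = f \<cdot> RUn C (Dom C f)"
  using RUn_natural [of f "Dom C f" X] assms by (simp add: Hom_def)

lemma inv_Asc_nat:
  assumes "f \<in> Arr C" "g \<in> Arr C" "h \<in> Arr C" "Cod C f = X" "Cod C g = Y" "Cod C h = Z"
  shows "inv_arr C (Asc C X Y Z) \<cdot> (f \<boxtimes> (g \<boxtimes> h))
    = ((f \<boxtimes> g) \<boxtimes> h) \<cdot> inv_arr C (Asc C (Dom C f) (Dom C g) (Dom C h))"
proof -
  have "X \<in> Ob C" "Y \<in> Ob C" "Z \<in> Ob C"
    using assms Cod_Ob by blast+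
  then show ?thesis
    by (intro inv_square) (use assms in \<open>simp_all add: Asc_nat [symmetric]\<close>)
qed

lemma Idn_Unt_TAr_inj:
  assumes "f \<in> Hom C X Y" "g \<in> Hom C X Y" "Idn C \<one> \<boxtimes> f = Idn C \<one> \<boxtimes> g"
  shows "f = g"
proof -
  note [simp] = Hom_Ob[OF assms(1)] HomD[OF assms(1)] HomD[OF assms(2)]
  have "f \<cdot> LUn C X = g \<cdot> LUn C X"
    using LUn_nat [of f Y] LUn_nat [of g Y] assms(3) by simp
  then show ?thesis
    by (rule iso_cancel_right [rotated -1]) simp_all
qed

text \<open>
  Kelly's redundancy. Since \<open>\<one> \<otimes> -\<close> is faithful, the equation may be checked after tensoring with
  \<open>\<one>\<close> on the left, and there it is what the pentagon gives when both of its sides are followed by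
  triangles.
\<close>

lemma LUn_TOb:
  assumes [simp]: "X \<in> Ob C" "Y \<in> Ob C"
  shows "LUn C (X \<otimes> Y) \<cdot> Asc C \<one> X Y = LUn C X \<boxtimes> Idn C Y"
proof (rule Idn_Unt_TAr_inj)
  show "LUn C (X \<otimes> Y) \<cdot> Asc C \<one> X Y \<in> Hom C ((\<one> \<otimes> X) \<otimes> Y) (X \<otimes> Y)"
    "LUn C X \<boxtimes> Idn C Y \<in> Hom C ((\<one> \<otimes> X) \<otimes> Y) (X \<otimes> Y)"
    by (simp_all add: Hom_def)
  let ?I = "Idn C \<one>"
  have P: "(?I \<boxtimes> Asc C \<one> X Y) \<cdot> Asc C \<one> (\<one> \<otimes> X) Y \<cdot> (Asc C \<one> \<one> X \<boxtimes> Idn C Y)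
      = Asc C \<one> \<one> (X \<otimes> Y) \<cdot> Asc C (\<one> \<otimes> \<one>) X Y"
    by (rule pentagon) simp_all
  have T: "(?I \<boxtimes> LUn C (X \<otimes> Y)) \<cdot> Asc C \<one> \<one> (X \<otimes> Y) = RUn C \<one> \<boxtimes> Idn C (X \<otimes> Y)"
    by (rule triangle) simp_all
  have T': "(?I \<boxtimes> LUn C X) \<cdot> Asc C \<one> \<one> X = RUn C \<one> \<boxtimes> Idn C X"
    by (rule triangle) simp_all
  let ?w = "Asc C \<one> (\<one> \<otimes> X) Y \<cdot> (Asc C \<one> \<one> X \<boxtimes> Idn C Y)"
  have w: "is_iso C ?w"
    by (intro iso_Comp) simp_all
  show "?I \<boxtimes> (LUn C (X \<otimes> Y) \<cdot> Asc C \<one> X Y) = ?I \<boxtimes> (LUn C X \<boxtimes> Idn C Y)"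
  proof (rule iso_cancel_right [OF w])
    have "(?I \<boxtimes> (LUn C (X \<otimes> Y) \<cdot> Asc C \<one> X Y)) \<cdot> ?w
        = (?I \<boxtimes> LUn C (X \<otimes> Y)) \<cdot> ((?I \<boxtimes> Asc C \<one> X Y) \<cdot> ?w)"
      by (simp add: merge)
    also have "\<dots> = ((?I \<boxtimes> LUn C (X \<otimes> Y)) \<cdot> Asc C \<one> \<one> (X \<otimes> Y)) \<cdot> Asc C (\<one> \<otimes> \<one>) X Y"
      unfolding P by simp
    also have "\<dots> = Asc C \<one> X Y \<cdot> ((RUn C \<one> \<boxtimes> Idn C X) \<boxtimes> Idn C Y)"
      unfolding T by (simp add: Asc_nat)
    also have "\<dots> = (Asc C \<one> X Y \<cdot> ((?I \<boxtimes> LUn C X) \<boxtimes> Idn C Y)) \<cdot> (Asc C \<one> \<one> X \<boxtimes> Idn C Y)"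
      by (simp add: T' merge)
    also have "\<dots> = (?I \<boxtimes> (LUn C X \<boxtimes> Idn C Y)) \<cdot> ?w"
      by (simp add: Asc_nat)
    finally show "(?I \<boxtimes> (LUn C (X \<otimes> Y) \<cdot> Asc C \<one> X Y)) \<cdot> ?w = (?I \<boxtimes> (LUn C X \<boxtimes> Idn C Y)) \<cdot> ?w" .
  qed simp_all
qed

text \<open>
  Another redundancy of Kelly: by the triangle for \<open>\<one>, \<one>\<close> and the previous lemma, both unit
  constraints of \<open>\<one>\<close> agree after tensoring with \<open>\<one>\<close> on the right, which is a faithful operation.
\<close>

lemma RUn_Unt: "RUn C \<one> = LUn C \<one>"
proof -
  have L: "LUn C (\<one> \<otimes> \<one>) = Idn C \<one> \<boxtimes> LUn C \<one>"
  proof (rule iso_cancel_left [of "LUn C \<one>"])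
    show "LUn C \<one> \<cdot> LUn C (\<one> \<otimes> \<one>) = LUn C \<one> \<cdot> (Idn C \<one> \<boxtimes> LUn C \<one>)"
      using LUn_nat [of "LUn C \<one>" \<one>] by simp
  qed simp_all
  have "LUn C \<one> \<boxtimes> Idn C \<one> = RUn C \<one> \<boxtimes> Idn C \<one>"
    using LUn_TOb [of \<one> \<one>] triangle [of \<one> \<one>] L by simp
  then have "RUn C \<one> \<cdot> (LUn C \<one> \<boxtimes> Idn C \<one>) = RUn C \<one> \<cdot> (RUn C \<one> \<boxtimes> Idn C \<one>)"
    by simp
  then have "LUn C \<one> \<cdot> RUn C (\<one> \<otimes> \<one>) = RUn C \<one> \<cdot> RUn C (\<one> \<otimes> \<one>)"
    by (simp add: RUn_nat)
  then show ?thesis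
    by (rule iso_cancel_right [rotated -1, symmetric]) simp_all
qed

end

section \<open>The reversed monoidal category\<close>

text \<open>
  The category with the order of the tensor factors exchanged. Left duals become right duals, so a
  statement about \<open>X \<otimes> -\<close>, read in the reversed category, becomes its mirror image about \<open>- \<otimes> X\<close>.
\<close>

definition rev_mon :: "('o, 'm, 'k, 'z) mon_cat_scheme \<Rightarrow> ('o, 'm, 'k, 'z) mon_cat_scheme" where
  "rev_mon C = C\<lparr>TOb := (\<lambda>X Y. TOb C Y X), TAr := (\<lambda>f g. TAr C g f),
     Asc := (\<lambda>X Y Z. inv_arr C (Asc C Z Y X)), LUn := RUn C, RUn := LUn C\<rparr>"

lemma rev_mon_simps [simp]:
  "Ob (rev_mon C) = Ob C" "Arr (rev_mon C) = Arr C" "Dom (rev_mon C) = Dom C"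
  "Cod (rev_mon C) = Cod C" "Idn (rev_mon C) = Idn C" "Comp (rev_mon C) = Comp C"
  "Unt (rev_mon C) = Unt C" "TOb (rev_mon C) X Y = TOb C Y X" "TAr (rev_mon C) f g = TAr C g f"
  "Asc (rev_mon C) X Y Z = inv_arr C (Asc C Z Y X)" "LUn (rev_mon C) = RUn C" "RUn (rev_mon C) = LUn C"
  by (simp_all add: rev_mon_def)

lemma rev_mon_derived [simp]:
  "Hom (rev_mon C) = Hom C" "is_mono (rev_mon C) = is_mono C" "is_epi (rev_mon C) = is_epi C"
  "inverse_arrows (rev_mon C) = inverse_arrows C" "is_iso (rev_mon C) = is_iso C"
  "inv_arr (rev_mon C) = inv_arr C" "isomorphic (rev_mon C) = isomorphic C"
proof -
  show h: "Hom (rev_mon C) = Hom C"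
    by (intro ext) (simp add: Hom_def)
  show "is_mono (rev_mon C) = is_mono C" "is_epi (rev_mon C) = is_epi C"
    by (intro ext; simp add: is_mono_def is_epi_def h)+
  show i: "inverse_arrows (rev_mon C) = inverse_arrows C"
    by (intro ext) (simp add: inverse_arrows_def h)
  show j: "is_iso (rev_mon C) = is_iso C"
    by (intro ext) (simp add: is_iso_def i)
  show "inv_arr (rev_mon C) = inv_arr C"
    by (intro ext) (simp add: inv_arr_def i)
  show "isomorphic (rev_mon C) = isomorphic C"
    by (intro ext) (simp add: isomorphic_def h j)
qed

lemma category_rev_mon: "category D \<Longrightarrow> category (rev_mon D)"
  unfolding category_def rev_mon_simps rev_mon_derived .

context monoidal_category
begin

lemma inv_pentagon:
  assumes [simp]: "W \<in> Ob C" "X \<in> Ob C" "Y \<in> Ob C" "Z \<in> Ob C"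
  shows "(inv_arr C (Asc C W X Y) \<boxtimes> Idn C Z) \<cdot> inv_arr C (Asc C W (X \<otimes> Y) Z) \<cdot> (Idn C W \<boxtimes> inv_arr C (Asc C X Y Z))
    = inv_arr C (Asc C (W \<otimes> X) Y Z) \<cdot> inv_arr C (Asc C W X (Y \<otimes> Z))"
proof -
  have "inv_arr C ((Idn C W \<boxtimes> Asc C X Y Z) \<cdot> Asc C W (X \<otimes> Y) Z \<cdot> (Asc C W X Y \<boxtimes> Idn C Z))
      = inv_arr C (Asc C W X (Y \<otimes> Z) \<cdot> Asc C (W \<otimes> X) Y Z)"
    by (subst pentagon) simp_all
  then show ?thesis
    by (simp add: iso_Comp)
qed

lemma inv_triangle:
  assumes [simp]: "X \<in> Ob C" "Y \<in> Ob C"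
  shows "(RUn C X \<boxtimes> Idn C Y) \<cdot> inv_arr C (Asc C X \<one> Y) = Idn C X \<boxtimes> LUn C Y"
  by (rule iso_move_right [symmetric]) (simp_all add: triangle)

lemma monoidal_rev_mon: "monoidal_category (rev_mon C)"
proof (intro monoidal_category.intro category_rev_mon category_axioms monoidal_category_axioms.intro;
    unfold rev_mon_simps rev_mon_derived)
  fix f g h X Y Z X' Y' Z'
  assume "f \<in> Hom C X X'" "g \<in> Hom C Y Y'" "h \<in> Hom C Z Z'"
  then show "inv_arr C (Asc C Z' Y' X') \<cdot> (h \<boxtimes> g \<boxtimes> f) = ((h \<boxtimes> g) \<boxtimes> f) \<cdot> inv_arr C (Asc C Z Y X)"
    by (simp add: Hom_def inv_Asc_nat)
next
  fix W X Y Z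
  assume [simp]: "W \<in> Ob C" "X \<in> Ob C" "Y \<in> Ob C" "Z \<in> Ob C"
  show "(inv_arr C (Asc C Z Y X) \<boxtimes> Idn C W) \<cdot> inv_arr C (Asc C Z (Y \<otimes> X) W) \<cdot> (Idn C Z \<boxtimes> inv_arr C (Asc C Y X W))
    = inv_arr C (Asc C (Z \<otimes> Y) X W) \<cdot> inv_arr C (Asc C Z Y (X \<otimes> W))"
    by (rule inv_pentagon) simp_all
qed (simp_all add: Hom_def LUn_nat RUn_nat inv_triangle interchange)

end

section \<open>Duality\<close>

lemma dual_pairD:
  assumes "dual_pair C L U ev coev"
  shows "L \<in> Ob C" "U \<in> Ob C"
    "ev \<in> Arr C" "Dom C ev = L \<otimes>\<^bsub>C\<^esub> U" "Cod C ev = \<one>\<^bsub>C\<^esub>"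
    "coev \<in> Arr C" "Dom C coev = \<one>\<^bsub>C\<^esub>" "Cod C coev = U \<otimes>\<^bsub>C\<^esub> L"
    "RUn C U \<cdot>\<^bsub>C\<^esub> (Idn C U \<boxtimes>\<^bsub>C\<^esub> ev) \<cdot>\<^bsub>C\<^esub> Asc C U L U \<cdot>\<^bsub>C\<^esub> (coev \<boxtimes>\<^bsub>C\<^esub> Idn C U) = LUn C U"
    "LUn C L \<cdot>\<^bsub>C\<^esub> (ev \<boxtimes>\<^bsub>C\<^esub> Idn C L) \<cdot>\<^bsub>C\<^esub> inv_arr C (Asc C L U L) \<cdot>\<^bsub>C\<^esub> (Idn C L \<boxtimes>\<^bsub>C\<^esub> coev) = RUn C L"
  using assms by (auto simp: dual_pair_def Hom_def)

text \<open>
  The two transpositions of the adjunction \<open>L \<otimes> - \<stileturn> U \<otimes> -\<close> that a dual pair defines: \<open>lower\<close> sends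
  arrows \<open>X \<rightarrow> U \<otimes> Z\<close> to arrows \<open>L \<otimes> X \<rightarrow> Z\<close>, and \<open>upper\<close> goes back.
\<close>

definition lower :: "('o, 'm, 'k, 'z) mon_cat_scheme \<Rightarrow> 'm \<Rightarrow> 'o \<Rightarrow> 'o \<Rightarrow> 'o \<Rightarrow> 'm \<Rightarrow> 'm" where
  "lower C ev L U Z g =
     LUn C Z \<cdot>\<^bsub>C\<^esub> (ev \<boxtimes>\<^bsub>C\<^esub> Idn C Z) \<cdot>\<^bsub>C\<^esub> inv_arr C (Asc C L U Z) \<cdot>\<^bsub>C\<^esub> (Idn C L \<boxtimes>\<^bsub>C\<^esub> g)"

definition upper :: "('o, 'm, 'k, 'z) mon_cat_scheme \<Rightarrow> 'm \<Rightarrow> 'o \<Rightarrow> 'o \<Rightarrow> 'o \<Rightarrow> 'm \<Rightarrow> 'm" where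
  "upper C coev L U X k =
     (Idn C U \<boxtimes>\<^bsub>C\<^esub> k) \<cdot>\<^bsub>C\<^esub> Asc C U L X \<cdot>\<^bsub>C\<^esub> (coev \<boxtimes>\<^bsub>C\<^esub> Idn C X) \<cdot>\<^bsub>C\<^esub> inv_arr C (LUn C X)"

context monoidal_category
begin

lemma dual_pair_rev:
  assumes "dual_pair C L U ev coev"
  shows "dual_pair (rev_mon C) U L ev coev"
  using dual_pairD [OF assms] by (simp add: dual_pair_def Hom_def)

lemma lower_Hom:
  assumes "dual_pair C L U ev coev" "g \<in> Hom C X (U \<otimes> Z)" "Z \<in> Ob C"
  shows "lower C ev L U Z g \<in> Hom C (L \<otimes> X) Z"
  using dual_pairD [OF assms(1)] assms(2,3) by (simp add: lower_def Hom_def)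

lemma upper_Hom:
  assumes "dual_pair C L U ev coev" "k \<in> Hom C (L \<otimes> X) Z" "X \<in> Ob C"
  shows "upper C coev L U X k \<in> Hom C X (U \<otimes> Z)"
  using dual_pairD [OF assms(1)] assms(2,3) by (simp add: upper_def Hom_def)

lemma lower_post:
  assumes "dual_pair C L U ev coev" "g \<in> Hom C X (U \<otimes> Z)" "h \<in> Hom C Z Z'"
  shows "lower C ev L U Z' ((Idn C U \<boxtimes> h) \<cdot> g) = h \<cdot> lower C ev L U Z g"
proof -
  note [simp] = dual_pairD(1-8) [OF assms(1)] HomD [OF assms(2)] HomD [OF assms(3)]
    Hom_Ob [OF assms(3)] Hom_Ob [OF assms(2)]
  have 1: "inv_arr C (Asc C L U Z') \<cdot> (Idn C L \<boxtimes> (Idn C U \<boxtimes> h)) = (Idn C (L \<otimes> U) \<boxtimes> h) \<cdot> inv_arr C (Asc C L U Z)"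
    using inv_Asc_nat [of "Idn C L" "Idn C U" h L U Z'] by simp
  have "lower C ev L U Z' ((Idn C U \<boxtimes> h) \<cdot> g)
    = LUn C Z' \<cdot> (ev \<boxtimes> Idn C Z') \<cdot> (inv_arr C (Asc C L U Z') \<cdot> (Idn C L \<boxtimes> (Idn C U \<boxtimes> h))) \<cdot> (Idn C L \<boxtimes> g)"
    by (simp add: lower_def merge)
  also have "\<dots> = (LUn C Z' \<cdot> (Idn C \<one> \<boxtimes> h)) \<cdot> (ev \<boxtimes> Idn C Z) \<cdot> inv_arr C (Asc C L U Z) \<cdot> (Idn C L \<boxtimes> g)"
    unfolding 1 by (simp add: merge)
  also have "\<dots> = h \<cdot> lower C ev L U Z g"
    by (simp add: LUn_nat lower_def)
  finally show ?thesis .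
qed

lemma upper_Comp:
  assumes "dual_pair C L U ev coev" "k \<in> Hom C (L \<otimes> X) Z" "f \<in> Hom C W X"
  shows "upper C coev L U W (k \<cdot> (Idn C L \<boxtimes> f)) = upper C coev L U X k \<cdot> f"
proof -
  note [simp] = dual_pairD(1-8) [OF assms(1)] HomD [OF assms(2)] HomD [OF assms(3)]
    Hom_Ob [OF assms(3)] Hom_Ob [OF assms(2)]
  have 1: "(Idn C U \<boxtimes> (Idn C L \<boxtimes> f)) \<cdot> Asc C U L W = Asc C U L X \<cdot> (Idn C (U \<otimes> L) \<boxtimes> f)"
    using Asc_nat [of "Idn C U" "Idn C L" f U L X] by simp
  have 2: "(Idn C \<one> \<boxtimes> f) \<cdot> inv_arr C (LUn C W) = inv_arr C (LUn C X) \<cdot> f"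
    by (rule inv_square [symmetric]) (simp_all add: LUn_nat)
  have "upper C coev L U W (k \<cdot> (Idn C L \<boxtimes> f))
    = (Idn C U \<boxtimes> k) \<cdot> ((Idn C U \<boxtimes> (Idn C L \<boxtimes> f)) \<cdot> Asc C U L W) \<cdot> (coev \<boxtimes> Idn C W) \<cdot> inv_arr C (LUn C W)"
    by (simp add: upper_def merge)
  also have "\<dots> = (Idn C U \<boxtimes> k) \<cdot> Asc C U L X \<cdot> (coev \<boxtimes> Idn C X) \<cdot> ((Idn C \<one> \<boxtimes> f) \<cdot> inv_arr C (LUn C W))"
    unfolding 1 by (simp add: merge)
  also have "\<dots> = upper C coev L U X k \<cdot> f"
    unfolding 2 by (simp add: upper_def)
  finally show ?thesis .
qed

text \<open>
  Pentagon and triangle carry the composite of unit and counit at \<open>U \<otimes> Z\<close> to the first zigzag of the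
  dual pair, tensored with \<open>Z\<close>.
\<close>

lemma upper_lower:
  assumes "dual_pair C L U ev coev" "g \<in> Hom C X (U \<otimes> Z)" "Z \<in> Ob C"
  shows "upper C coev L U X (lower C ev L U Z g) = g"
proof -
  note [simp] = dual_pairD(1-8) [OF assms(1)] HomD [OF assms(2)] Hom_Ob [OF assms(2)] assms(3)
  let ?i = "inv_arr C (Asc C L U Z)"
  define e where "e = LUn C Z \<cdot> (ev \<boxtimes> Idn C Z) \<cdot> ?i"
  have e [simp]: "e \<in> Hom C (L \<otimes> (U \<otimes> Z)) Z"
    by (simp add: e_def Hom_def)
  note [simp] = HomD [OF e]
  \<comment> \<open>By naturality in \<open>X\<close> only the identity of \<open>U \<otimes> Z\<close> has to be checked.\<close>
  have "upper C coev L U X (lower C ev L U Z g) = upper C coev L U X (e \<cdot> (Idn C L \<boxtimes> g))"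
    by (simp add: lower_def e_def)
  also have "\<dots> = upper C coev L U (U \<otimes> Z) e \<cdot> g"
    by (rule upper_Comp [OF assms(1) e assms(2)])
  also have "upper C coev L U (U \<otimes> Z) e = Idn C (U \<otimes> Z)"
  proof -
    have l: "inv_arr C (LUn C (U \<otimes> Z)) = Asc C \<one> U Z \<cdot> (inv_arr C (LUn C U) \<boxtimes> Idn C Z)"
    proof -
      have "inv_arr C (LUn C (U \<otimes> Z) \<cdot> Asc C \<one> U Z) = inv_arr C (LUn C U) \<boxtimes> Idn C Z"
        by (simp add: LUn_TOb)
      then have "Asc C \<one> U Z \<cdot> (inv_arr C (Asc C \<one> U Z) \<cdot> inv_arr C (LUn C (U \<otimes> Z))) = Asc C \<one> U Z \<cdot> (inv_arr C (LUn C U) \<boxtimes> Idn C Z)"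
        by (simp add: iso_Comp)
      then show ?thesis by simp
    qed
    have a: "(coev \<boxtimes> Idn C (U \<otimes> Z)) \<cdot> Asc C \<one> U Z = Asc C (U \<otimes> L) U Z \<cdot> ((coev \<boxtimes> Idn C U) \<boxtimes> Idn C Z)"
      using Asc_nat [of coev "Idn C U" "Idn C Z" "U \<otimes> L" U Z] by simp
    have p: "Asc C U L (U \<otimes> Z) \<cdot> Asc C (U \<otimes> L) U Z
        = (Idn C U \<boxtimes> Asc C L U Z) \<cdot> Asc C U (L \<otimes> U) Z \<cdot> (Asc C U L U \<boxtimes> Idn C Z)"
      by (rule pentagon [symmetric]) simp_all
    have b: "(Idn C U \<boxtimes> (ev \<boxtimes> Idn C Z)) \<cdot> Asc C U (L \<otimes> U) Z = Asc C U \<one> Z \<cdot> ((Idn C U \<boxtimes> ev) \<boxtimes> Idn C Z)"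
      using Asc_nat [of "Idn C U" ev "Idn C Z" U \<one> Z] by simp
    have "upper C coev L U (U \<otimes> Z) e
      = (Idn C U \<boxtimes> e) \<cdot> Asc C U L (U \<otimes> Z) \<cdot> ((coev \<boxtimes> Idn C (U \<otimes> Z)) \<cdot> Asc C \<one> U Z) \<cdot> (inv_arr C (LUn C U) \<boxtimes> Idn C Z)"
      by (simp add: upper_def l)
    also have "\<dots> = (Idn C U \<boxtimes> e) \<cdot> (Asc C U L (U \<otimes> Z) \<cdot> Asc C (U \<otimes> L) U Z) \<cdot> ((coev \<boxtimes> Idn C U) \<boxtimes> Idn C Z) \<cdot> (inv_arr C (LUn C U) \<boxtimes> Idn C Z)"
      unfolding a by simp
    also have "\<dots> = (Idn C U \<boxtimes> LUn C Z) \<cdot> ((Idn C U \<boxtimes> (ev \<boxtimes> Idn C Z)) \<cdot> Asc C U (L \<otimes> U) Z)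
        \<cdot> (Asc C U L U \<boxtimes> Idn C Z) \<cdot> ((coev \<boxtimes> Idn C U) \<boxtimes> Idn C Z) \<cdot> (inv_arr C (LUn C U) \<boxtimes> Idn C Z)"
      unfolding p by (simp add: merge e_def)
    also have "\<dots> = ((Idn C U \<boxtimes> LUn C Z) \<cdot> Asc C U \<one> Z) \<cdot> ((Idn C U \<boxtimes> ev) \<boxtimes> Idn C Z)
        \<cdot> (Asc C U L U \<boxtimes> Idn C Z) \<cdot> ((coev \<boxtimes> Idn C U) \<boxtimes> Idn C Z) \<cdot> (inv_arr C (LUn C U) \<boxtimes> Idn C Z)"
      unfolding b by simp
    also have "\<dots> = ((RUn C U \<cdot> (Idn C U \<boxtimes> ev) \<cdot> Asc C U L U \<cdot> (coev \<boxtimes> Idn C U)) \<cdot> inv_arr C (LUn C U)) \<boxtimes> Idn C Z"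
      by (subst triangle) (simp_all add: merge)
    also have "\<dots> = Idn C (U \<otimes> Z)"
      unfolding dual_pairD(9) [OF assms(1)] by simp
    finally show ?thesis .
  qed
  finally show ?thesis by simp
qed

text \<open>
  The mirror computation: by naturality in \<open>Z\<close> only the identity of \<open>L \<otimes> X\<close> has to be checked, and
  there the composite is the second zigzag, tensored with \<open>X\<close>.
\<close>

lemma lower_upper:
  assumes "dual_pair C L U ev coev" "k \<in> Hom C (L \<otimes> X) Z" "X \<in> Ob C"
  shows "lower C ev L U Z (upper C coev L U X k) = k"
proof -
  note [simp] = dual_pairD(1-8) [OF assms(1)] HomD [OF assms(2)] Hom_Ob [OF assms(2)] assms(3)
  define c where "c = Asc C U L X \<cdot> (coev \<boxtimes> Idn C X) \<cdot> inv_arr C (LUn C X)"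
  have c [simp]: "c \<in> Hom C X (U \<otimes> (L \<otimes> X))"
    by (simp add: c_def Hom_def)
  note [simp] = HomD [OF c]
  have "lower C ev L U Z (upper C coev L U X k) = lower C ev L U Z ((Idn C U \<boxtimes> k) \<cdot> c)"
    by (simp add: upper_def c_def)
  also have "\<dots> = k \<cdot> lower C ev L U (L \<otimes> X) c"
    by (rule lower_post [OF assms(1) c assms(2)])
  also have "lower C ev L U (L \<otimes> X) c = Idn C (L \<otimes> X)"
  proof -
    have t: "inv_arr C (Asc C L \<one> X) \<cdot> (Idn C L \<boxtimes> inv_arr C (LUn C X)) = inv_arr C (RUn C L) \<boxtimes> Idn C X"
    proof -
      have "inv_arr C ((Idn C L \<boxtimes> LUn C X) \<cdot> Asc C L \<one> X) = inv_arr C (RUn C L \<boxtimes> Idn C X)"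
        by (simp add: triangle)
      then show ?thesis
        by (simp add: iso_Comp)
    qed
    have p: "inv_arr C (Asc C L U (L \<otimes> X)) \<cdot> (Idn C L \<boxtimes> Asc C U L X)
      = Asc C (L \<otimes> U) L X \<cdot> (inv_arr C (Asc C L U L) \<boxtimes> Idn C X) \<cdot> inv_arr C (Asc C L (U \<otimes> L) X)"
    proof -
      have "Asc C L U (L \<otimes> X) \<cdot> (Asc C (L \<otimes> U) L X \<cdot> (inv_arr C (Asc C L U L) \<boxtimes> Idn C X) \<cdot> inv_arr C (Asc C L (U \<otimes> L) X))
        = (Asc C L U (L \<otimes> X) \<cdot> Asc C (L \<otimes> U) L X) \<cdot> (inv_arr C (Asc C L U L) \<boxtimes> Idn C X) \<cdot> inv_arr C (Asc C L (U \<otimes> L) X)"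
        by simp
      also have "\<dots> = Idn C L \<boxtimes> Asc C U L X"
        by (subst pentagon [symmetric]) (simp_all add: merge)
      finally show ?thesis
        using iso_move_left [of "Asc C L U (L \<otimes> X)"
          "Asc C (L \<otimes> U) L X \<cdot> (inv_arr C (Asc C L U L) \<boxtimes> Idn C X) \<cdot> inv_arr C (Asc C L (U \<otimes> L) X)"]
        by simp
    qed
    have a: "inv_arr C (Asc C L (U \<otimes> L) X) \<cdot> (Idn C L \<boxtimes> (coev \<boxtimes> Idn C X))
      = ((Idn C L \<boxtimes> coev) \<boxtimes> Idn C X) \<cdot> inv_arr C (Asc C L \<one> X)"
      using inv_Asc_nat [of "Idn C L" coev "Idn C X" L "U \<otimes> L" X] by simp
    have b: "(ev \<boxtimes> Idn C (L \<otimes> X)) \<cdot> Asc C (L \<otimes> U) L X = Asc C \<one> L X \<cdot> ((ev \<boxtimes> Idn C L) \<boxtimes> Idn C X)"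
      using Asc_nat [of ev "Idn C L" "Idn C X" \<one> L X] by simp
    have "lower C ev L U (L \<otimes> X) c
      = LUn C (L \<otimes> X) \<cdot> (ev \<boxtimes> Idn C (L \<otimes> X)) \<cdot> (inv_arr C (Asc C L U (L \<otimes> X)) \<cdot> (Idn C L \<boxtimes> Asc C U L X))
         \<cdot> (Idn C L \<boxtimes> (coev \<boxtimes> Idn C X)) \<cdot> (Idn C L \<boxtimes> inv_arr C (LUn C X))"
      by (simp add: lower_def c_def merge)
    also have "\<dots> = LUn C (L \<otimes> X) \<cdot> ((ev \<boxtimes> Idn C (L \<otimes> X)) \<cdot> Asc C (L \<otimes> U) L X) \<cdot> (inv_arr C (Asc C L U L) \<boxtimes> Idn C X)
        \<cdot> (inv_arr C (Asc C L (U \<otimes> L) X) \<cdot> (Idn C L \<boxtimes> (coev \<boxtimes> Idn C X))) \<cdot> (Idn C L \<boxtimes> inv_arr C (LUn C X))"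
      unfolding p by simp
    also have "\<dots> = (LUn C (L \<otimes> X) \<cdot> Asc C \<one> L X) \<cdot> ((ev \<boxtimes> Idn C L) \<boxtimes> Idn C X) \<cdot> (inv_arr C (Asc C L U L) \<boxtimes> Idn C X)
        \<cdot> ((Idn C L \<boxtimes> coev) \<boxtimes> Idn C X) \<cdot> (inv_arr C (Asc C L \<one> X) \<cdot> (Idn C L \<boxtimes> inv_arr C (LUn C X)))"
      unfolding a b by simp
    also have "\<dots> = ((LUn C L \<cdot> (ev \<boxtimes> Idn C L) \<cdot> inv_arr C (Asc C L U L) \<cdot> (Idn C L \<boxtimes> coev)) \<cdot> inv_arr C (RUn C L)) \<boxtimes> Idn C X"
      unfolding t by (subst LUn_TOb) (simp_all add: merge)
    also have "\<dots> = Idn C (L \<otimes> X)"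
      unfolding dual_pairD(10) [OF assms(1)] by simp
    finally show ?thesis .
  qed
  finally show ?thesis by simp
qed

lemma lower_inj:
  assumes "dual_pair C L U ev coev" "f \<in> Hom C X (U \<otimes> Z)" "g \<in> Hom C X (U \<otimes> Z)" "Z \<in> Ob C"
    "lower C ev L U Z f = lower C ev L U Z g"
  shows "f = g"
  using upper_lower [OF assms(1,2,4)] upper_lower [OF assms(1,3,4)] assms(5) by metis

lemma upper_inj:
  assumes "dual_pair C L U ev coev" "f \<in> Hom C (L \<otimes> X) Z" "g \<in> Hom C (L \<otimes> X) Z" "X \<in> Ob C"
    "upper C coev L U X f = upper C coev L U X g"
  shows "f = g"
  using lower_upper [OF assms(1,2,4)] lower_upper [OF assms(1,3,4)] assms(5) by metis

end

context monoidal_category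
begin

lemma is_monoI:
  assumes "m \<in> Hom C X Y"
    and "\<And>T f g. f \<in> Hom C T X \<Longrightarrow> g \<in> Hom C T X \<Longrightarrow> m \<cdot> f = m \<cdot> g \<Longrightarrow> f = g"
  shows "is_mono C m"
  using assms by (auto simp: is_mono_def Hom_iff)

lemma is_epiI:
  assumes "e \<in> Hom C X Y"
    and "\<And>T f g. f \<in> Hom C Y T \<Longrightarrow> g \<in> Hom C Y T \<Longrightarrow> f \<cdot> e = g \<cdot> e \<Longrightarrow> f = g"
  shows "is_epi C e"
  using assms by (auto simp: is_epi_def Hom_iff)

text \<open>
  A functor of the form \<open>X \<otimes> -\<close> is a right adjoint as soon as \<open>X\<close> has a left dual, and it is a left
  adjoint as soon as \<open>X\<close> has a right dual; this and the next two lemmas draw the consequences for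
  monomorphisms and epimorphisms, the last one for \<open>- \<otimes> X\<close>.
\<close>

lemma mono_TAr_left:
  assumes d: "dual_pair C L X ev coev" and m: "is_mono C m"
  shows "is_mono C (Idn C X \<boxtimes> m)"
proof -
  have mA: "m \<in> Hom C (Dom C m) (Cod C m)"
    using m by (simp add: is_mono_def Hom_def)
  note [simp] = dual_pairD(1-2) [OF d] HomD(1) [OF mA]
  show ?thesis
  proof (rule is_monoI)
    show "Idn C X \<boxtimes> m \<in> Hom C (X \<otimes> Dom C m) (X \<otimes> Cod C m)"
      by (simp add: Hom_def)
    fix T f g
    assume f: "f \<in> Hom C T (X \<otimes> Dom C m)" and g: "g \<in> Hom C T (X \<otimes> Dom C m)"
      and eq: "(Idn C X \<boxtimes> m) \<cdot> f = (Idn C X \<boxtimes> m) \<cdot> g"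
    have "m \<cdot> lower C ev L X (Dom C m) f = m \<cdot> lower C ev L X (Dom C m) g"
      using lower_post [OF d f mA] lower_post [OF d g mA] eq by metis
    then have "lower C ev L X (Dom C m) f = lower C ev L X (Dom C m) g"
      by (rule mono_cancel [OF m]) (use d f g in \<open>auto intro!: lower_Hom\<close>)
    then show "f = g"
      by (rule lower_inj [OF d f g, rotated]) simp
  qed
qed

lemma epi_TAr_left:
  assumes d: "dual_pair C X U ev coev" and e: "is_epi C e"
  shows "is_epi C (Idn C X \<boxtimes> e)"
proof -
  have eA: "e \<in> Hom C (Dom C e) (Cod C e)"
    using e by (simp add: is_epi_def Hom_def)
  note [simp] = dual_pairD(1-2) [OF d] HomD(1) [OF eA]
  show ?thesis
  proof (rule is_epiI)
    show "Idn C X \<boxtimes> e \<in> Hom C (X \<otimes> Dom C e) (X \<otimes> Cod C e)"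
      by (simp add: Hom_def)
    fix T f g
    assume f: "f \<in> Hom C (X \<otimes> Cod C e) T" and g: "g \<in> Hom C (X \<otimes> Cod C e) T"
      and eq: "f \<cdot> (Idn C X \<boxtimes> e) = g \<cdot> (Idn C X \<boxtimes> e)"
    have "upper C coev X U (Cod C e) f \<cdot> e = upper C coev X U (Cod C e) g \<cdot> e"
      using upper_Comp [OF d f eA] upper_Comp [OF d g eA] eq by metis
    then have "upper C coev X U (Cod C e) f = upper C coev X U (Cod C e) g"
      by (rule epi_cancel [OF e]) (use d f g in \<open>auto intro!: upper_Hom\<close>)
    then show "f = g"
      by (rule upper_inj [OF d f g, rotated]) simp
  qed
qed

end

lemma (in monoidal_category) mono_TAr_right:
  assumes d: "dual_pair C X U ev coev" and m: "is_mono C m"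
  shows "is_mono C (m \<boxtimes> Idn C X)"
proof -
  interpret R: monoidal_category "rev_mon C" by (rule monoidal_rev_mon)
  show ?thesis
    using R.mono_TAr_left [OF dual_pair_rev [OF d]] m by simp
qed

section \<open>Objects generated or cogenerated by the unit object\<close>

text \<open>
  The arrows to the unit object are jointly monic, respectively the arrows from the unit object are
  jointly epic. In a tensor category both properties turn out to characterize the trivial objects. They
  mention no multiplicities and no chosen decomposition, which makes the closure properties of
  trivial objects easy to prove.
\<close>

definition unit_cogen :: "('o, 'm, 'k, 'z) mon_cat_scheme \<Rightarrow> 'o \<Rightarrow> bool" where
  "unit_cogen C X \<longleftrightarrow> X \<in> Ob C \<and>
     (\<forall>T. \<forall>f\<in>Hom C T X. \<forall>g\<in>Hom C T X. (\<forall>\<phi>\<in>Hom C X \<one>\<^bsub>C\<^esub>. \<phi> \<cdot>\<^bsub>C\<^esub> f = \<phi> \<cdot>\<^bsub>C\<^esub> g) \<longrightarrow> f = g)"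

definition unit_gen :: "('o, 'm, 'k, 'z) mon_cat_scheme \<Rightarrow> 'o \<Rightarrow> bool" where
  "unit_gen C X \<longleftrightarrow> X \<in> Ob C \<and>
     (\<forall>T. \<forall>f\<in>Hom C X T. \<forall>g\<in>Hom C X T. (\<forall>s\<in>Hom C \<one>\<^bsub>C\<^esub> X. f \<cdot>\<^bsub>C\<^esub> s = g \<cdot>\<^bsub>C\<^esub> s) \<longrightarrow> f = g)"

lemma unit_cogenD:
  assumes "unit_cogen C X" "f \<in> Hom C T X" "g \<in> Hom C T X"
    "\<And>\<phi>. \<phi> \<in> Hom C X \<one>\<^bsub>C\<^esub> \<Longrightarrow> \<phi> \<cdot>\<^bsub>C\<^esub> f = \<phi> \<cdot>\<^bsub>C\<^esub> g"
  shows "f = g"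
  using assms unfolding unit_cogen_def by blast

lemma unit_genD:
  assumes "unit_gen C X" "f \<in> Hom C X T" "g \<in> Hom C X T"
    "\<And>s. s \<in> Hom C \<one>\<^bsub>C\<^esub> X \<Longrightarrow> f \<cdot>\<^bsub>C\<^esub> s = g \<cdot>\<^bsub>C\<^esub> s"
  shows "f = g"
  using assms unfolding unit_gen_def by blast

lemma unit_cogenI:
  assumes "X \<in> Ob C" "\<And>T f g. \<lbrakk>f \<in> Hom C T X; g \<in> Hom C T X;
    \<And>\<phi>. \<phi> \<in> Hom C X \<one>\<^bsub>C\<^esub> \<Longrightarrow> \<phi> \<cdot>\<^bsub>C\<^esub> f = \<phi> \<cdot>\<^bsub>C\<^esub> g\<rbrakk> \<Longrightarrow> f = g"
  shows "unit_cogen C X"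
  using assms unfolding unit_cogen_def by blast

lemma unit_genI:
  assumes "X \<in> Ob C" "\<And>T f g. \<lbrakk>f \<in> Hom C X T; g \<in> Hom C X T;
    \<And>s. s \<in> Hom C \<one>\<^bsub>C\<^esub> X \<Longrightarrow> f \<cdot>\<^bsub>C\<^esub> s = g \<cdot>\<^bsub>C\<^esub> s\<rbrakk> \<Longrightarrow> f = g"
  shows "unit_gen C X"
  using assms unfolding unit_gen_def by blast

lemma unit_cogen_rev [simp]: "unit_cogen (rev_mon C) = unit_cogen C"
  by (intro ext) (simp add: unit_cogen_def)

lemma unit_gen_rev [simp]: "unit_gen (rev_mon C) = unit_gen C"
  by (intro ext) (simp add: unit_gen_def)

lemma unit_cogen_mono:
  fixes D :: "('p, 'n, 'k, 'w) mon_cat_scheme"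
  assumes "category D" "unit_cogen D X" "is_mono D m" "Cod D m = X"
  shows "unit_cogen D (Dom D m)"
proof -
  interpret D: category D by fact
  have m: "m \<in> Hom D (Dom D m) X"
    using assms by (simp add: is_mono_def Hom_def)
  show ?thesis
  proof (rule unit_cogenI)
    show "Dom D m \<in> Ob D"
      using D.Hom_Ob [OF m] by simp
    fix T f g
    assume f: "f \<in> Hom D T (Dom D m)" and g: "g \<in> Hom D T (Dom D m)"
      and eq: "\<And>\<phi>. \<phi> \<in> Hom D (Dom D m) \<one>\<^bsub>D\<^esub> \<Longrightarrow> \<phi> \<cdot>\<^bsub>D\<^esub> f = \<phi> \<cdot>\<^bsub>D\<^esub> g"
    have "m \<cdot>\<^bsub>D\<^esub> f = m \<cdot>\<^bsub>D\<^esub> g"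
    proof (rule unit_cogenD [OF assms(2)])
      fix \<phi> assume p: "\<phi> \<in> Hom D X \<one>\<^bsub>D\<^esub>"
      have "(\<phi> \<cdot>\<^bsub>D\<^esub> m) \<cdot>\<^bsub>D\<^esub> f = (\<phi> \<cdot>\<^bsub>D\<^esub> m) \<cdot>\<^bsub>D\<^esub> g"
        by (rule eq) (rule D.Comp_Hom [OF m p])
      then show "\<phi> \<cdot>\<^bsub>D\<^esub> m \<cdot>\<^bsub>D\<^esub> f = \<phi> \<cdot>\<^bsub>D\<^esub> m \<cdot>\<^bsub>D\<^esub> g"
        using D.Comp_assoc [OF f m p] D.Comp_assoc [OF g m p] by metis
    qed (use D.Comp_Hom m f g in blast)+
    then show "f = g"
      by (rule D.mono_cancel [OF assms(3)]) (use f g in blast)+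
  qed
qed

lemma unit_gen_epi:
  fixes D :: "('p, 'n, 'k, 'w) mon_cat_scheme"
  assumes "category D" "unit_gen D X" "is_epi D e" "Dom D e = X"
  shows "unit_gen D (Cod D e)"
proof -
  interpret D: category D by fact
  have e: "e \<in> Hom D X (Cod D e)"
    using assms by (simp add: is_epi_def Hom_def)
  show ?thesis
  proof (rule unit_genI)
    show "Cod D e \<in> Ob D"
      using D.Hom_Ob [OF e] by simp
    fix T f g
    assume f: "f \<in> Hom D (Cod D e) T" and g: "g \<in> Hom D (Cod D e) T"
      and eq: "\<And>s. s \<in> Hom D \<one>\<^bsub>D\<^esub> (Cod D e) \<Longrightarrow> f \<cdot>\<^bsub>D\<^esub> s = g \<cdot>\<^bsub>D\<^esub> s"
    have "f \<cdot>\<^bsub>D\<^esub> e = g \<cdot>\<^bsub>D\<^esub> e"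
    proof (rule unit_genD [OF assms(2)])
      fix s assume p: "s \<in> Hom D \<one>\<^bsub>D\<^esub> X"
      have "f \<cdot>\<^bsub>D\<^esub> (e \<cdot>\<^bsub>D\<^esub> s) = g \<cdot>\<^bsub>D\<^esub> (e \<cdot>\<^bsub>D\<^esub> s)"
        by (rule eq) (rule D.Comp_Hom [OF p e])
      then show "(f \<cdot>\<^bsub>D\<^esub> e) \<cdot>\<^bsub>D\<^esub> s = (g \<cdot>\<^bsub>D\<^esub> e) \<cdot>\<^bsub>D\<^esub> s"
        using D.Comp_assoc [OF p e f] D.Comp_assoc [OF p e g] by metis
    qed (use D.Comp_Hom e f g in blast)+
    then show "f = g"
      by (rule D.epi_cancel [OF assms(3)]) (use f g in blast)+
  qed
qed

context monoidal_category
begin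

text \<open>
  An arrow \<open>f : T \<rightarrow> L\<close> corresponds to an arrow \<open>T \<otimes> X \<rightarrow> \<one>\<close>, and this in turn to an arrow from \<open>X\<close> to
  a dual of \<open>T\<close>, which is determined by its composites with the arrows \<open>s : \<one> \<rightarrow> X\<close>. The composite
  with \<open>s\<close> depends only on \<open>\<phi> \<cdot> f\<close>, where \<open>\<phi> : L \<rightarrow> \<one>\<close> is the transpose of \<open>s\<close>.
\<close>

lemma unit_cogen_dual:
  assumes d: "dual_pair C L X ev coev" and gen: "unit_gen C X"
    and rigid: "\<And>T. T \<in> Ob C \<Longrightarrow> \<exists>U ev coev. dual_pair C T U ev coev"
  shows "unit_cogen C L"
proof (rule unit_cogenI)
  note [simp] = dual_pairD(1-8) [OF d]
  show "L \<in> Ob C" by simp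
  fix T f g
  assume f: "f \<in> Hom C T L" and g: "g \<in> Hom C T L"
    and eq: "\<And>\<phi>. \<phi> \<in> Hom C L \<one> \<Longrightarrow> \<phi> \<cdot> f = \<phi> \<cdot> g"
  note [simp] = HomD [OF f] HomD [OF g] Hom_Ob [OF f]
  obtain U ev' coev' where d': "dual_pair C T U ev' coev'"
    using rigid by fastforce
  interpret R: monoidal_category "rev_mon C" by (rule monoidal_rev_mon)
  define lo where "lo = (\<lambda>a. lower (rev_mon C) ev X L \<one> (inv_arr C (LUn C L) \<cdot> a))"
  have lo_def': "lo a = RUn C \<one> \<cdot> (Idn C \<one> \<boxtimes> ev) \<cdot> Asc C \<one> L X \<cdot> ((inv_arr C (LUn C L) \<cdot> a) \<boxtimes> Idn C X)" for a
    by (simp add: lo_def lower_def)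
  have lo_Hom: "lo a \<in> Hom C (T \<otimes> X) \<one>" if "a \<in> Hom C T L" for a
    using HomD [OF that] by (simp add: lo_def' Hom_def)
  have lo_pt: "lo a \<cdot> (Idn C T \<boxtimes> s)
      = (RUn C \<one> \<cdot> (Idn C \<one> \<boxtimes> ev) \<cdot> Asc C \<one> L X \<cdot> (inv_arr C (LUn C L) \<boxtimes> s) \<cdot> inv_arr C (RUn C L) \<cdot> a) \<cdot> RUn C T"
    if "a \<in> Hom C T L" "s \<in> Hom C \<one> X" for a s
  proof -
    note [simp] = HomD [OF that(1)] HomD [OF that(2)]
    have "(inv_arr C (LUn C L) \<cdot> a) \<boxtimes> s = (inv_arr C (LUn C L) \<boxtimes> s) \<cdot> inv_arr C (RUn C L) \<cdot> (RUn C L \<cdot> (a \<boxtimes> Idn C \<one>))"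
      by (simp add: merge)
    also have "\<dots> = (inv_arr C (LUn C L) \<boxtimes> s) \<cdot> inv_arr C (RUn C L) \<cdot> a \<cdot> RUn C T"
      by (subst RUn_nat) simp_all
    finally have 1: "(inv_arr C (LUn C L) \<cdot> a) \<boxtimes> s = (inv_arr C (LUn C L) \<boxtimes> s) \<cdot> inv_arr C (RUn C L) \<cdot> a \<cdot> RUn C T" .
    have "lo a \<cdot> (Idn C T \<boxtimes> s) = RUn C \<one> \<cdot> (Idn C \<one> \<boxtimes> ev) \<cdot> Asc C \<one> L X \<cdot> ((inv_arr C (LUn C L) \<cdot> a) \<boxtimes> s)"
      by (simp add: lo_def' merge)
    also have "\<dots> = (RUn C \<one> \<cdot> (Idn C \<one> \<boxtimes> ev) \<cdot> Asc C \<one> L X \<cdot> (inv_arr C (LUn C L) \<boxtimes> s) \<cdot> inv_arr C (RUn C L) \<cdot> a) \<cdot> RUn C T"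
      unfolding 1 by simp
    finally show ?thesis .
  qed
  have X: "X \<in> Ob C" by simp
  have "upper C coev' T U X (lo f) = upper C coev' T U X (lo g)"
  proof (rule unit_genD [OF gen])
    fix s assume s: "s \<in> Hom C \<one> X"
    note [simp] = HomD [OF s]
    let ?\<phi> = "RUn C \<one> \<cdot> (Idn C \<one> \<boxtimes> ev) \<cdot> Asc C \<one> L X \<cdot> (inv_arr C (LUn C L) \<boxtimes> s) \<cdot> inv_arr C (RUn C L)"
    have p: "?\<phi> \<in> Hom C L \<one>" by (simp add: Hom_def)
    from eq [OF p] have "lo f \<cdot> (Idn C T \<boxtimes> s) = lo g \<cdot> (Idn C T \<boxtimes> s)"
      unfolding lo_pt [OF f s] lo_pt [OF g s] by simp
    then show "upper C coev' T U X (lo f) \<cdot> s = upper C coev' T U X (lo g) \<cdot> s"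
      using upper_Comp [OF d' lo_Hom [OF f] s] upper_Comp [OF d' lo_Hom [OF g] s] by metis
  qed (use upper_Hom [OF d' lo_Hom] f g X in blast)+
  then have "lo f = lo g"
    by (rule upper_inj [OF d' lo_Hom lo_Hom, OF f g X])
  then have "inv_arr C (LUn C L) \<cdot> f = inv_arr C (LUn C L) \<cdot> g"
    unfolding lo_def
    by (rule R.lower_inj [OF dual_pair_rev [OF d], rotated -1]) (simp_all add: Hom_def)
  then show "f = g"
    by (rule iso_cancel_left [rotated -1]) simp_all
qed

lemma unit_cogen_dual':
  assumes d: "dual_pair C L X ev coev" and gen: "unit_gen C L"
    and rigid: "\<And>T. T \<in> Ob C \<Longrightarrow> \<exists>U ev coev. dual_pair C U T ev coev"
  shows "unit_cogen C X"
proof -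
  interpret R: monoidal_category "rev_mon C" by (rule monoidal_rev_mon)
  have "\<exists>U ev coev. dual_pair (rev_mon C) T U ev coev" if "T \<in> Ob C" for T
    using rigid [OF that] dual_pair_rev by blast
  then show ?thesis
    using R.unit_cogen_dual [OF dual_pair_rev [OF d]] gen by simp
qed

text \<open>
  Arrows \<open>T \<rightarrow> X \<otimes> Y\<close> transpose to arrows into \<open>X\<close>, and these are separated by the arrows \<open>X \<rightarrow> \<one>\<close>;
  what remains after composing with such an arrow is an arrow into \<open>\<one> \<otimes> Y\<close>, where \<open>Y\<close> is
  cogenerated by the unit object.
\<close>

lemma unit_cogen_TOb:
  assumes X: "unit_cogen C X" and Y: "unit_cogen C Y" and d: "dual_pair C Y U ev coev"
  shows "unit_cogen C (X \<otimes> Y)"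
proof (rule unit_cogenI)
  have XY [simp]: "X \<in> Ob C" "Y \<in> Ob C"
    using X Y by (auto simp: unit_cogen_def)
  show "X \<otimes> Y \<in> Ob C" by simp
  fix T f g
  assume f: "f \<in> Hom C T (X \<otimes> Y)" and g: "g \<in> Hom C T (X \<otimes> Y)"
    and eq: "\<And>\<phi>. \<phi> \<in> Hom C (X \<otimes> Y) \<one> \<Longrightarrow> \<phi> \<cdot> f = \<phi> \<cdot> g"
  note [simp] = HomD [OF f] HomD [OF g]
  interpret R: monoidal_category "rev_mon C" by (rule monoidal_rev_mon)
  note d' = dual_pair_rev [OF d]
  have h: "a \<in> Hom (rev_mon C) T (Y \<otimes>\<^bsub>rev_mon C\<^esub> X)" if "a \<in> Hom C T (X \<otimes> Y)" for a
    using that by simp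
  let ?lo = "lower (rev_mon C) ev U Y X"
  have "?lo f = ?lo g"
  proof (rule unit_cogenD [OF X])
    fix \<phi> assume p: "\<phi> \<in> Hom C X \<one>"
    note [simp] = HomD [OF p]
    have "LUn C Y \<cdot> (\<phi> \<boxtimes> Idn C Y) \<cdot> f = LUn C Y \<cdot> (\<phi> \<boxtimes> Idn C Y) \<cdot> g"
    proof (rule unit_cogenD [OF Y])
      fix \<psi> assume q: "\<psi> \<in> Hom C Y \<one>"
      note [simp] = HomD [OF q]
      have "(\<psi> \<cdot> LUn C Y \<cdot> (\<phi> \<boxtimes> Idn C Y)) \<cdot> f = (\<psi> \<cdot> LUn C Y \<cdot> (\<phi> \<boxtimes> Idn C Y)) \<cdot> g"
        by (rule eq) (simp add: Hom_def)
      then show "\<psi> \<cdot> LUn C Y \<cdot> (\<phi> \<boxtimes> Idn C Y) \<cdot> f = \<psi> \<cdot> LUn C Y \<cdot> (\<phi> \<boxtimes> Idn C Y) \<cdot> g"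
        by simp
    qed (simp_all add: Hom_def)
    then have "(\<phi> \<boxtimes> Idn C Y) \<cdot> f = (\<phi> \<boxtimes> Idn C Y) \<cdot> g"
      by (rule iso_cancel_left [rotated -1]) simp_all
    then show "\<phi> \<cdot> ?lo f = \<phi> \<cdot> ?lo g"
      using R.lower_post [OF d' h [OF f], of \<phi>] R.lower_post [OF d' h [OF g], of \<phi>] p by simp
  qed (use R.lower_Hom [OF d' h] f g in auto)
  then show "f = g"
    by (rule R.lower_inj [OF d' h h, OF f g, rotated]) simp
qed

end

section \<open>Strong monoidal functors\<close>

context is_functor
begin

lemma FOb_simps [simp]: "X \<in> Ob C \<Longrightarrow> FOb F X \<in> Ob D"
  by (rule FOb_Ob)

lemma FAr_simps [simp]:
  assumes "f \<in> Arr C"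
  shows "FAr F f \<in> Arr D" "Dom D (FAr F f) = FOb F (Dom C f)" "Cod D (FAr F f) = FOb F (Cod C f)"
  using FAr_Hom [of f "Dom C f" "Cod C f"] assms by (auto simp: Hom_def)

declare FAr_Idn [simp]

lemma FAr_Comp_simp [simp]:
  assumes "f \<in> Arr C" "g \<in> Arr C" "Dom C g = Cod C f"
  shows "FAr F (g \<cdot>\<^bsub>C\<^esub> f) = FAr F g \<cdot>\<^bsub>D\<^esub> FAr F f"
  using FAr_Comp [of f "Dom C f" "Cod C f" g "Cod C g"] assms by (simp add: Hom_def)

lemma FAr_iso [simp]:
  assumes "is_iso C f"
  shows "is_iso D (FAr F f)" "inv_arr D (FAr F f) = FAr F (inv_arr C f)"
proof -
  note [simp] = assms C.iso_Arr [OF assms]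
  have 1: "FAr F (inv_arr C f) \<cdot>\<^bsub>D\<^esub> FAr F f = Idn D (FOb F (Dom C f))"
    using FAr_Comp_simp [of f "inv_arr C f"] by simp
  have 2: "FAr F f \<cdot>\<^bsub>D\<^esub> FAr F (inv_arr C f) = Idn D (FOb F (Cod C f))"
    using FAr_Comp_simp [of "inv_arr C f" f] by simp
  have "FAr F f \<in> Hom D (FOb F (Dom C f)) (FOb F (Cod C f))"
    "FAr F (inv_arr C f) \<in> Hom D (FOb F (Cod C f)) (FOb F (Dom C f))"
    by (simp_all add: Hom_def)
  from D.isoI [OF this 1 2] show "is_iso D (FAr F f)" "inv_arr D (FAr F f) = FAr F (inv_arr C f)"
    by auto
qed

end

text \<open>
  The same functor between the reversed categories, used to deduce the second zigzag equation for
  the image of a dual pair from the first.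
\<close>

definition rev_fun :: "('o, 'm, 'p, 'n, 'w) mfctr_scheme \<Rightarrow> ('o, 'm, 'p, 'n, 'w) mfctr_scheme" where
  "rev_fun F = F\<lparr>F2 := (\<lambda>X Y. F2 F Y X)\<rparr>"

lemma rev_fun_simps [simp]:
  "FOb (rev_fun F) = FOb F" "FAr (rev_fun F) = FAr F" "F2 (rev_fun F) X Y = F2 F Y X" "F0 (rev_fun F) = F0 F"
  by (simp_all add: rev_fun_def)

context strong_monoidal_functor
begin

text \<open>An infix without index, since most computations below take place in the target category.\<close>

abbreviation Comp_target :: "'n \<Rightarrow> 'n \<Rightarrow> 'n" (infixr "\<bullet>" 70) where
  "g \<bullet> f \<equiv> g \<cdot>\<^bsub>D\<^esub> f"

declare F2_iso [simp] F0_iso [simp]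

lemma F2_simps [simp]:
  assumes "X \<in> Ob C" "Y \<in> Ob C"
  shows "F2 F X Y \<in> Arr D" "Dom D (F2 F X Y) = FOb F X \<otimes>\<^bsub>D\<^esub> FOb F Y"
    "Cod D (F2 F X Y) = FOb F (X \<otimes>\<^bsub>C\<^esub> Y)"
  using F2_Hom [OF assms] by (auto simp: Hom_def)

lemma F0_simps [simp]: "F0 F \<in> Arr D" "Dom D (F0 F) = \<one>\<^bsub>D\<^esub>" "Cod D (F0 F) = FOb F \<one>\<^bsub>C\<^esub>"
  using F0_Hom by (auto simp: Hom_def)

lemma F2_nat:
  assumes "f \<in> Arr C" "g \<in> Arr C" "Cod C f = X" "Cod C g = Y"
  shows "F2 F X Y \<bullet> (FAr F f \<boxtimes>\<^bsub>D\<^esub> FAr F g) = FAr F (f \<boxtimes>\<^bsub>C\<^esub> g) \<bullet> F2 F (Dom C f) (Dom C g)"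
  using F2_natural [of f "Dom C f" X g "Dom C g" Y] assms by (simp add: Hom_def)

lemma inv_F2_nat:
  assumes "f \<in> Arr C" "g \<in> Arr C" "Cod C f = X" "Cod C g = Y"
  shows "inv_arr D (F2 F X Y) \<bullet> FAr F (f \<boxtimes>\<^bsub>C\<^esub> g)
    = (FAr F f \<boxtimes>\<^bsub>D\<^esub> FAr F g) \<bullet> inv_arr D (F2 F (Dom C f) (Dom C g))"
proof -
  have "X \<in> Ob C" "Y \<in> Ob C"
    using assms C.Cod_Ob by blast+
  then show ?thesis
    by (intro D.inv_square) (use assms in \<open>simp_all add: F2_nat [symmetric]\<close>)
qed

text \<open>The hexagon, solved for the composite that occurs when \<open>F2\<close> is pulled through an associator.\<close>

lemma inv_F2_Asc:
  assumes [simp]: "X \<in> Ob C" "Y \<in> Ob C" "Z \<in> Ob C"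
  shows "(Idn D (FOb F X) \<boxtimes>\<^bsub>D\<^esub> inv_arr D (F2 F Y Z)) \<bullet> inv_arr D (F2 F X (Y \<otimes>\<^bsub>C\<^esub> Z)) \<bullet> FAr F (Asc C X Y Z)
    = Asc D (FOb F X) (FOb F Y) (FOb F Z) \<bullet> (inv_arr D (F2 F X Y) \<boxtimes>\<^bsub>D\<^esub> Idn D (FOb F Z)) \<bullet> inv_arr D (F2 F (X \<otimes>\<^bsub>C\<^esub> Y) Z)"
proof -
  let ?m = "F2 F (X \<otimes>\<^bsub>C\<^esub> Y) Z \<bullet> (F2 F X Y \<boxtimes>\<^bsub>D\<^esub> Idn D (FOb F Z))"
  let ?n = "F2 F X (Y \<otimes>\<^bsub>C\<^esub> Z) \<bullet> (Idn D (FOb F X) \<boxtimes>\<^bsub>D\<^esub> F2 F Y Z)"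
  have "inv_arr D ?n \<bullet> FAr F (Asc C X Y Z) = Asc D (FOb F X) (FOb F Y) (FOb F Z) \<bullet> inv_arr D ?m"
    by (rule D.inv_square) (simp_all add: D.iso_Comp F2_assoc)
  then show ?thesis
    by (simp add: D.iso_Comp)
qed

lemma RUn_inv_F2:
  assumes [simp]: "X \<in> Ob C"
  shows "RUn D (FOb F X) \<bullet> (Idn D (FOb F X) \<boxtimes>\<^bsub>D\<^esub> inv_arr D (F0 F)) \<bullet> inv_arr D (F2 F X \<one>\<^bsub>C\<^esub>) = FAr F (RUn C X)"
  by (simp add: F2_RUn [symmetric] D.merge)

lemma strong_monoidal_rev: "strong_monoidal_functor (rev_mon C) (rev_mon D) (rev_fun F)"
proof (intro strong_monoidal_functor.intro is_functor.intro category_rev_mon C.category_axioms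
    D.category_axioms C.monoidal_rev_mon D.monoidal_rev_mon strong_monoidal_functor_axioms.intro
    is_functor_axioms.intro; unfold rev_mon_simps rev_mon_derived rev_fun_simps)
  fix X Y Z assume [simp]: "X \<in> Ob C" "Y \<in> Ob C" "Z \<in> Ob C"
  let ?m = "F2 F Z (Y \<otimes>\<^bsub>C\<^esub> X) \<bullet> (Idn D (FOb F Z) \<boxtimes>\<^bsub>D\<^esub> F2 F Y X)"
  let ?n = "F2 F (Z \<otimes>\<^bsub>C\<^esub> Y) X \<bullet> (F2 F Z Y \<boxtimes>\<^bsub>D\<^esub> Idn D (FOb F X))"
  have "inv_arr D (FAr F (Asc C Z Y X)) \<bullet> ?m = ?n \<bullet> inv_arr D (Asc D (FOb F Z) (FOb F Y) (FOb F X))"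
    by (rule D.inv_square) (simp_all add: F2_assoc)
  then show "FAr F (inv_arr C (Asc C Z Y X)) \<bullet> F2 F Z (Y \<otimes>\<^bsub>C\<^esub> X) \<bullet> (Idn D (FOb F Z) \<boxtimes>\<^bsub>D\<^esub> F2 F Y X)
    = F2 F (Z \<otimes>\<^bsub>C\<^esub> Y) X \<bullet> (F2 F Z Y \<boxtimes>\<^bsub>D\<^esub> Idn D (FOb F X)) \<bullet> inv_arr D (Asc D (FOb F Z) (FOb F Y) (FOb F X))"
    by simp
qed (simp_all add: Hom_def F2_LUn F2_RUn F2_nat)

text \<open>Strong monoidal functors preserve duals; the second zigzag is the first one read in the
  reversed categories.\<close>

lemma functor_zigzag:
  assumes d: "dual_pair C L U ev coev"
  defines "ev' \<equiv> inv_arr D (F0 F) \<bullet> FAr F ev \<bullet> F2 F L U"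
    and "coev' \<equiv> inv_arr D (F2 F U L) \<bullet> FAr F coev \<bullet> F0 F"
  shows "RUn D (FOb F U) \<bullet> (Idn D (FOb F U) \<boxtimes>\<^bsub>D\<^esub> ev') \<bullet> Asc D (FOb F U) (FOb F L) (FOb F U)
    \<bullet> (coev' \<boxtimes>\<^bsub>D\<^esub> Idn D (FOb F U)) = LUn D (FOb F U)"
proof -
  note [simp] = dual_pairD(1-8) [OF d]
  let ?U = "FOb F U" and ?L = "FOb F L"
  let ?I = "Idn D (FOb F U)"
  have a: "(?I \<boxtimes>\<^bsub>D\<^esub> F2 F L U) \<bullet> Asc D ?U ?L ?U \<bullet> (inv_arr D (F2 F U L) \<boxtimes>\<^bsub>D\<^esub> ?I)
      = inv_arr D (F2 F U (L \<otimes>\<^bsub>C\<^esub> U)) \<bullet> FAr F (Asc C U L U) \<bullet> F2 F (U \<otimes>\<^bsub>C\<^esub> L) U"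
  proof -
    have "(?I \<boxtimes>\<^bsub>D\<^esub> F2 F L U) \<bullet> Asc D ?U ?L ?U \<bullet> (inv_arr D (F2 F U L) \<boxtimes>\<^bsub>D\<^esub> ?I)
       = (?I \<boxtimes>\<^bsub>D\<^esub> F2 F L U) \<bullet> (Asc D ?U ?L ?U \<bullet> (inv_arr D (F2 F U L) \<boxtimes>\<^bsub>D\<^esub> ?I) \<bullet> inv_arr D (F2 F (U \<otimes>\<^bsub>C\<^esub> L) U)) \<bullet> F2 F (U \<otimes>\<^bsub>C\<^esub> L) U"
      by simp
    also have "\<dots> = inv_arr D (F2 F U (L \<otimes>\<^bsub>C\<^esub> U)) \<bullet> FAr F (Asc C U L U) \<bullet> F2 F (U \<otimes>\<^bsub>C\<^esub> L) U"
      by (subst inv_F2_Asc [symmetric]) (simp_all add: D.merge)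
    finally show ?thesis .
  qed
  have b: "(?I \<boxtimes>\<^bsub>D\<^esub> FAr F ev) \<bullet> inv_arr D (F2 F U (L \<otimes>\<^bsub>C\<^esub> U)) = inv_arr D (F2 F U \<one>\<^bsub>C\<^esub>) \<bullet> FAr F (Idn C U \<boxtimes>\<^bsub>C\<^esub> ev)"
    using inv_F2_nat [of "Idn C U" ev U "\<one>\<^bsub>C\<^esub>"] by simp
  have c: "F2 F (U \<otimes>\<^bsub>C\<^esub> L) U \<bullet> (FAr F coev \<boxtimes>\<^bsub>D\<^esub> ?I) = FAr F (coev \<boxtimes>\<^bsub>C\<^esub> Idn C U) \<bullet> F2 F \<one>\<^bsub>C\<^esub> U"
    using F2_nat [of coev "Idn C U" "U \<otimes>\<^bsub>C\<^esub> L" U] by simp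
  have "RUn D ?U \<bullet> (?I \<boxtimes>\<^bsub>D\<^esub> ev') \<bullet> Asc D ?U ?L ?U \<bullet> (coev' \<boxtimes>\<^bsub>D\<^esub> ?I)
    = RUn D ?U \<bullet> (?I \<boxtimes>\<^bsub>D\<^esub> inv_arr D (F0 F)) \<bullet> (?I \<boxtimes>\<^bsub>D\<^esub> FAr F ev)
      \<bullet> ((?I \<boxtimes>\<^bsub>D\<^esub> F2 F L U) \<bullet> Asc D ?U ?L ?U \<bullet> (inv_arr D (F2 F U L) \<boxtimes>\<^bsub>D\<^esub> ?I))
      \<bullet> (FAr F coev \<boxtimes>\<^bsub>D\<^esub> ?I) \<bullet> (F0 F \<boxtimes>\<^bsub>D\<^esub> ?I)"
    by (simp add: ev'_def coev'_def D.merge)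
  also have "\<dots> = RUn D ?U \<bullet> (?I \<boxtimes>\<^bsub>D\<^esub> inv_arr D (F0 F)) \<bullet> ((?I \<boxtimes>\<^bsub>D\<^esub> FAr F ev) \<bullet> inv_arr D (F2 F U (L \<otimes>\<^bsub>C\<^esub> U)))
      \<bullet> FAr F (Asc C U L U) \<bullet> (F2 F (U \<otimes>\<^bsub>C\<^esub> L) U \<bullet> (FAr F coev \<boxtimes>\<^bsub>D\<^esub> ?I)) \<bullet> (F0 F \<boxtimes>\<^bsub>D\<^esub> ?I)"
    unfolding a by simp
  also have "\<dots> = (RUn D ?U \<bullet> (?I \<boxtimes>\<^bsub>D\<^esub> inv_arr D (F0 F)) \<bullet> inv_arr D (F2 F U \<one>\<^bsub>C\<^esub>)) \<bullet> FAr F (Idn C U \<boxtimes>\<^bsub>C\<^esub> ev)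
      \<bullet> FAr F (Asc C U L U) \<bullet> FAr F (coev \<boxtimes>\<^bsub>C\<^esub> Idn C U) \<bullet> F2 F \<one>\<^bsub>C\<^esub> U \<bullet> (F0 F \<boxtimes>\<^bsub>D\<^esub> ?I)"
    unfolding b c by simp
  also have "\<dots> = FAr F (RUn C U \<cdot>\<^bsub>C\<^esub> (Idn C U \<boxtimes>\<^bsub>C\<^esub> ev) \<cdot>\<^bsub>C\<^esub> Asc C U L U \<cdot>\<^bsub>C\<^esub> (coev \<boxtimes>\<^bsub>C\<^esub> Idn C U))
     \<bullet> F2 F \<one>\<^bsub>C\<^esub> U \<bullet> (F0 F \<boxtimes>\<^bsub>D\<^esub> ?I)"
    by (subst RUn_inv_F2) simp_all
  also have "\<dots> = LUn D ?U"
    unfolding dual_pairD(9) [OF d] by (rule F2_LUn) simp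
  finally show ?thesis .
qed

lemma functor_dual_pair:
  assumes d: "dual_pair C L U ev coev"
  shows "dual_pair D (FOb F L) (FOb F U) (inv_arr D (F0 F) \<bullet> FAr F ev \<bullet> F2 F L U)
    (inv_arr D (F2 F U L) \<bullet> FAr F coev \<bullet> F0 F)"
proof -
  note [simp] = dual_pairD(1-8) [OF d]
  interpret R: strong_monoidal_functor "rev_mon C" "rev_mon D" "rev_fun F"
    by (rule strong_monoidal_rev)
  show ?thesis
    unfolding dual_pair_def
    using functor_zigzag [OF d] R.functor_zigzag [OF C.dual_pair_rev [OF d]]
    by (simp add: Hom_def)
qed

end

section \<open>Abelian categories\<close>

context preadditive_category
begin

lemma Zer_simps [simp]:
  assumes "X \<in> Ob C" "Y \<in> Ob C"
  shows "Zer C X Y \<in> Arr C" "Dom C (Zer C X Y) = X" "Cod C (Zer C X Y) = Y"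
  using Zer_Hom [OF assms] by (auto simp: Hom_def)

lemma Add_simps [simp]:
  assumes "f \<in> Arr C" "g \<in> Arr C" "Dom C g = Dom C f" "Cod C g = Cod C f"
  shows "f \<oplus> g \<in> Arr C" "Dom C (f \<oplus> g) = Dom C f" "Cod C (f \<oplus> g) = Cod C f"
  using Add_Hom [of f "Dom C f" "Cod C f" g] assms by (auto simp: Hom_def)

lemma Add_Zer: "f \<in> Hom C X Y \<Longrightarrow> f \<oplus> Zer C X Y = f"
  using Add_commute [of f X Y "Zer C X Y"] Zer_Add [of f X Y] Zer_Hom [of X Y] Hom_Ob [of f X Y]
  by metis

lemma Add_left_cancel:
  assumes f: "f \<in> Hom C X Y" and g: "g \<in> Hom C X Y" and h: "h \<in> Hom C X Y"
    and eq: "f \<oplus> g = f \<oplus> h"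
  shows "g = h"
proof -
  obtain n where n: "n \<in> Hom C X Y" "f \<oplus> n = Zer C X Y"
    using Add_inverse [OF f] by blast
  have *: "n \<oplus> (f \<oplus> k) = k" if "k \<in> Hom C X Y" for k
    using Add_assoc [OF n(1) f that] Add_commute [OF n(1) f] n(2) Zer_Add [OF that] by metis
  show ?thesis
    using * [OF g] * [OF h] eq by metis
qed

lemma Add_self_eq_Zer:
  assumes f: "f \<in> Hom C X Y" and eq: "f \<oplus> f = f"
  shows "f = Zer C X Y"
  by (rule Add_left_cancel [OF f f])
    (use Zer_Hom Hom_Ob [OF f] Add_Zer [OF f] eq in auto)

lemma Comp_Zer:
  assumes "h \<in> Hom C Y Z" "X \<in> Ob C"
  shows "h \<cdot> Zer C X Y = Zer C X Z"
proof (rule Add_self_eq_Zer)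
  have z: "Zer C X Y \<in> Hom C X Y"
    using assms Hom_Ob Zer_Hom by blast
  then show "h \<cdot> Zer C X Y \<in> Hom C X Z"
    using assms Comp_Hom by blast
  show "h \<cdot> Zer C X Y \<oplus> h \<cdot> Zer C X Y = h \<cdot> Zer C X Y"
    using Comp_Add [OF z z assms(1)] Zer_Add [OF z] by simp
qed

lemma Zer_Comp:
  assumes "h \<in> Hom C X Y" "Z \<in> Ob C"
  shows "Zer C Y Z \<cdot> h = Zer C X Z"
proof (rule Add_self_eq_Zer)
  have z: "Zer C Y Z \<in> Hom C Y Z"
    using assms Hom_Ob Zer_Hom by blast
  then show "Zer C Y Z \<cdot> h \<in> Hom C X Z"
    using assms Comp_Hom by blast
  show "Zer C Y Z \<cdot> h \<oplus> Zer C Y Z \<cdot> h = Zer C Y Z \<cdot> h"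
    using Add_Comp [OF assms(1) z z] Zer_Add [OF z] by simp
qed

lemma Zer_absorb [simp]:
  assumes "h \<in> Arr C"
  shows "X \<in> Ob C \<Longrightarrow> Y = Dom C h \<Longrightarrow> h \<cdot> Zer C X Y = Zer C X (Cod C h)"
    "Z \<in> Ob C \<Longrightarrow> Y = Cod C h \<Longrightarrow> Zer C Y Z \<cdot> h = Zer C (Dom C h) Z"
  using Comp_Zer [of h "Dom C h" "Cod C h"] Zer_Comp [of h "Dom C h" "Cod C h"] assms
  by (auto simp: Hom_def)

text \<open>Subtraction reduces cancellation statements to vanishing statements.\<close>

lemma difference:
  assumes f: "f \<in> Hom C X Y" and g: "g \<in> Hom C X Y"
  obtains d where "d \<in> Hom C X Y" "f = g \<oplus> d" "d = Zer C X Y \<longleftrightarrow> f = g"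
    "\<And>h Z. h \<in> Hom C Y Z \<Longrightarrow> h \<cdot> d = Zer C X Z \<longleftrightarrow> h \<cdot> f = h \<cdot> g"
    "\<And>h W. h \<in> Hom C W X \<Longrightarrow> d \<cdot> h = Zer C W Y \<longleftrightarrow> f \<cdot> h = g \<cdot> h"
proof -
  obtain n where n: "n \<in> Hom C X Y" "g \<oplus> n = Zer C X Y"
    using Add_inverse [OF g] by blast
  define d where "d = n \<oplus> f"
  have d: "d \<in> Hom C X Y"
    unfolding d_def by (rule Add_Hom [OF n(1) f])
  have fd: "f = g \<oplus> d"
    unfolding d_def using Add_assoc [OF g n(1) f] n(2) Zer_Add [OF f] by simp
  have z: "u \<oplus> v = u \<longleftrightarrow> v = Zer C W Z" if "u \<in> Hom C W Z" "v \<in> Hom C W Z" for u v W Z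
    using Add_left_cancel [OF that(1,2), of "Zer C W Z"] Add_Zer [OF that(1)] Zer_Hom Hom_Ob [OF that(1)] by metis
  show ?thesis
  proof (rule that [OF d fd])
    show "d = Zer C X Y \<longleftrightarrow> f = g"
      using z [OF g d] fd by metis
    show "h \<cdot> d = Zer C X Z \<longleftrightarrow> h \<cdot> f = h \<cdot> g" if h: "h \<in> Hom C Y Z" for h Z
      using z [OF Comp_Hom [OF g h] Comp_Hom [OF d h]] Comp_Add [OF g d h] fd by metis
    show "d \<cdot> h = Zer C W Y \<longleftrightarrow> f \<cdot> h = g \<cdot> h" if h: "h \<in> Hom C W X" for h W
      using z [OF Comp_Hom [OF h g] Comp_Hom [OF h d]] Add_Comp [OF h g d] fd by metis
  qed
qed

lemma mono_if_zero:
  assumes m: "m \<in> Hom C X Y"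
    and z: "\<And>T a. a \<in> Hom C T X \<Longrightarrow> m \<cdot> a = Zer C T Y \<Longrightarrow> a = Zer C T X"
  shows "is_mono C m"
  unfolding is_mono_def
proof (intro conjI allI ballI impI)
  show "m \<in> Arr C" using m by (simp add: Hom_def)
  fix T f g
  assume "f \<in> Hom C T (Dom C m)" "g \<in> Hom C T (Dom C m)" and eq: "m \<cdot> f = m \<cdot> g"
  then have f: "f \<in> Hom C T X" and g: "g \<in> Hom C T X"
    using m by (simp_all add: Hom_def)
  obtain d where d: "d \<in> Hom C T X" "d = Zer C T X \<longleftrightarrow> f = g"
    "\<And>h Z. h \<in> Hom C X Z \<Longrightarrow> h \<cdot> d = Zer C T Z \<longleftrightarrow> h \<cdot> f = h \<cdot> g"
    using difference [OF f g] by metis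
  then show "f = g"
    using z m eq by blast
qed

lemma mono_zero:
  assumes "is_mono C m" "m \<in> Hom C X Y" "a \<in> Hom C T X" "m \<cdot> a = Zer C T Y"
  shows "a = Zer C T X"
  by (rule mono_cancel [OF assms(1), where T = T])
    (use assms Hom_Ob [OF assms(2)] Hom_Ob [OF assms(3)] in \<open>auto simp: Hom_def\<close>)

lemma epi_zero:
  assumes "is_epi C e" "e \<in> Hom C X Y" "a \<in> Hom C Y T" "a \<cdot> e = Zer C X T"
  shows "a = Zer C Y T"
  by (rule epi_cancel [OF assms(1), where T = T])
    (use assms Hom_Ob [OF assms(2)] Hom_Ob [OF assms(3)] in \<open>auto simp: Hom_def\<close>)

lemma epi_if_zero:
  assumes e: "e \<in> Hom C X Y"
    and z: "\<And>T a. a \<in> Hom C Y T \<Longrightarrow> a \<cdot> e = Zer C X T \<Longrightarrow> a = Zer C Y T"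
  shows "is_epi C e"
  unfolding is_epi_def
proof (intro conjI allI ballI impI)
  show "e \<in> Arr C" using e by (simp add: Hom_def)
  fix T f g
  assume "f \<in> Hom C (Cod C e) T" "g \<in> Hom C (Cod C e) T" and eq: "f \<cdot> e = g \<cdot> e"
  then have f: "f \<in> Hom C Y T" and g: "g \<in> Hom C Y T"
    using e by (simp_all add: Hom_def)
  obtain d where d: "d \<in> Hom C Y T" "d = Zer C Y T \<longleftrightarrow> f = g"
    "\<And>h Z. h \<in> Hom C Z Y \<Longrightarrow> d \<cdot> h = Zer C Z T \<longleftrightarrow> f \<cdot> h = g \<cdot> h"
    using difference [OF f g] by metis
  then show "f = g"
    using z e eq by blast
qed

lemma is_zero_iff: "is_zero C Z \<longleftrightarrow> Z \<in> Ob C \<and> Idn C Z = Zer C Z Z"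
proof
  assume "is_zero C Z"
  then show "Z \<in> Ob C \<and> Idn C Z = Zer C Z Z"
    unfolding is_zero_def using Idn_Hom Zer_Hom by blast
next
  assume Z: "Z \<in> Ob C \<and> Idn C Z = Zer C Z Z"
  show "is_zero C Z"
    unfolding is_zero_def
  proof (intro conjI ballI)
    show "Z \<in> Ob C" using Z by simp
    fix X assume X: "X \<in> Ob C"
    show "\<exists>!f. f \<in> Hom C Z X"
    proof (rule ex1I)
      show "Zer C Z X \<in> Hom C Z X" using Z X Zer_Hom by simp
      fix f assume f: "f \<in> Hom C Z X"
      then have "f \<cdot> Idn C Z = Zer C Z X"
        using Z Comp_Zer [OF f, of Z] by simp
      then show "f = Zer C Z X" using Comp_Idn [OF f] by simp
    qed
    show "\<exists>!f. f \<in> Hom C X Z"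
    proof (rule ex1I)
      show "Zer C X Z \<in> Hom C X Z" using Z X Zer_Hom by simp
      fix f assume f: "f \<in> Hom C X Z"
      then have "Idn C Z \<cdot> f = Zer C X Z"
        using Z Zer_Comp [OF f, of Z] by simp
      then show "f = Zer C X Z" using Idn_Comp [OF f] by simp
    qed
  qed
qed

lemma zero_Dom: "is_zero C Z \<Longrightarrow> f \<in> Hom C Z X \<Longrightarrow> f = Zer C Z X"
  by (metis is_zero_iff Comp_Idn Comp_Zer)

lemma zero_Cod: "is_zero C Z \<Longrightarrow> f \<in> Hom C X Z \<Longrightarrow> f = Zer C X Z"
  by (metis is_zero_iff Idn_Comp Zer_Comp)

lemma kernelD:
  assumes "is_kernel C k f"
  shows "f \<in> Arr C" "k \<in> Arr C" "Cod C k = Dom C f" "f \<cdot> k = Zer C (Dom C k) (Cod C f)"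
    "is_mono C k"
proof -
  show *: "f \<in> Arr C" "k \<in> Arr C" "Cod C k = Dom C f" "f \<cdot> k = Zer C (Dom C k) (Cod C f)"
    using assms by (auto simp: is_kernel_def)
  show "is_mono C k"
    unfolding is_mono_def
  proof (intro conjI allI ballI impI *)
    fix T a b
    assume a: "a \<in> Hom C T (Dom C k)" and b: "b \<in> Hom C T (Dom C k)" and eq: "k \<cdot> a = k \<cdot> b"
    have "k \<cdot> b \<in> Hom C T (Dom C f)"
      using b * by (simp add: Hom_def)
    moreover have "f \<cdot> (k \<cdot> b) = Zer C T (Cod C f)"
    proof -
      have "f \<cdot> (k \<cdot> b) = (f \<cdot> k) \<cdot> b"
        using b * by (intro Comp_assoc' [symmetric]) (auto simp: Hom_def)
      then show ?thesis using b * by (auto simp: Hom_def)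
    qed
    ultimately have "\<exists>!h'. h' \<in> Hom C T (Dom C k) \<and> k \<cdot> h' = k \<cdot> b"
      using assms by (auto simp: is_kernel_def)
    then show "a = b" using a b eq by blast
  qed
qed

lemma kernel_factor:
  assumes "is_kernel C k f" "h \<in> Hom C T (Dom C f)" "f \<cdot> h = Zer C T (Cod C f)"
  obtains h' where "h' \<in> Hom C T (Dom C k)" "k \<cdot> h' = h"
  using assms unfolding is_kernel_def by blast

lemma cokernelD:
  assumes "is_cokernel C q f"
  shows "f \<in> Arr C" "q \<in> Arr C" "Dom C q = Cod C f" "q \<cdot> f = Zer C (Dom C f) (Cod C q)"
    "is_epi C q"
proof -
  show *: "f \<in> Arr C" "q \<in> Arr C" "Dom C q = Cod C f" "q \<cdot> f = Zer C (Dom C f) (Cod C q)"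
    using assms by (auto simp: is_cokernel_def)
  show "is_epi C q"
    unfolding is_epi_def
  proof (intro conjI allI ballI impI *)
    fix T a b
    assume a: "a \<in> Hom C (Cod C q) T" and b: "b \<in> Hom C (Cod C q) T" and eq: "a \<cdot> q = b \<cdot> q"
    have "b \<cdot> q \<in> Hom C (Cod C f) T"
      using b * by (simp add: Hom_def)
    moreover have "(b \<cdot> q) \<cdot> f = Zer C (Dom C f) T"
      using b * by (auto simp: Hom_def)
    ultimately have "\<exists>!h'. h' \<in> Hom C (Cod C q) T \<and> h' \<cdot> q = b \<cdot> q"
      using assms by (auto simp: is_cokernel_def)
    then show "a = b" using a b eq by blast
  qed
qed

lemma cokernel_factor:
  assumes "is_cokernel C q f" "h \<in> Hom C (Cod C f) T" "h \<cdot> f = Zer C (Dom C f) T"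
  obtains h' where "h' \<in> Hom C (Cod C q) T" "h' \<cdot> q = h"
  using assms unfolding is_cokernel_def by blast

end

context abelian_category
begin

text \<open>
  A monomorphism is the kernel of some \<open>f\<close>; if it is also epic then \<open>f\<close> vanishes, so the identity
  factors through the kernel of \<open>f\<close>.
\<close>

lemma mono_epi_iso:
  assumes m: "is_mono C m" and e: "is_epi C m"
  shows "is_iso C m"
proof -
  obtain f where f: "is_kernel C m f"
    using mono_is_kernel [OF m] by blast
  note [simp] = kernelD(1-3) [OF f]
  have "f = Zer C (Cod C m) (Cod C f)"
    by (rule epi_zero [OF e, of "Dom C m"]) (simp_all add: Hom_def kernelD(4) [OF f])
  moreover have "Zer C (Cod C m) (Cod C f) \<cdot> Idn C (Cod C m) = Zer C (Cod C m) (Cod C f)"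
    by simp
  ultimately have "f \<cdot> Idn C (Cod C m) = Zer C (Cod C m) (Cod C f)"
    by metis
  then obtain s where "s \<in> Hom C (Cod C m) (Dom C m)" "m \<cdot> s = Idn C (Cod C m)"
    by (rule kernel_factor [OF f, rotated]) (simp_all add: Hom_def)
  then show ?thesis
    using mono_split_epi_iso [OF m] by blast
qed

lemma simple_nonzero_mono:
  assumes s: "is_simple C U" and f: "f \<in> Hom C U X" "f \<noteq> Zer C U X"
  shows "is_mono C f"
proof -
  note [simp] = HomD [OF f(1)] Hom_Ob [OF f(1)]
  obtain k where k: "is_kernel C k f"
    using has_kernel [of f] by auto
  note [simp] = kernelD(2) [OF k]
  have kH: "k \<in> Hom C (Dom C k) U"
    using kernelD [OF k] by (simp add: Hom_def)
  have "is_zero C (Dom C k) \<or> is_iso C k"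
    using s kernelD(3,5) [OF k] by (simp add: is_simple_def)
  then show ?thesis
  proof
    assume z: "is_zero C (Dom C k)"
    show ?thesis
    proof (rule mono_if_zero [OF f(1)])
      fix T a assume a: "a \<in> Hom C T U" "f \<cdot> a = Zer C T X"
      then obtain a' where a': "a' \<in> Hom C T (Dom C k)" "k \<cdot> a' = a"
        using kernel_factor [OF k, of a T] by auto
      then have "a' = Zer C T (Dom C k)"
        using zero_Cod [OF z] by blast
      then show "a = Zer C T U"
        using a'(2) Comp_Zer [OF kH] Hom_Ob [OF a(1)] by metis
    qed
  next
    assume i: "is_iso C k"
    have [simp]: "Cod C k = U" using HomD [OF kH] by simp
    have "f = (f \<cdot> k) \<cdot> inv_arr C k"
      using i by simp
    also have "f \<cdot> k = Zer C (Dom C k) X"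
      using kernelD(4) [OF k] by simp
    also have "\<dots> \<cdot> inv_arr C k = Zer C U X"
      using i by simp
    finally show ?thesis using f(2) by simp
  qed
qed

text \<open>
  The first factor of a composition series is isomorphic to its first nonzero term, which is a subobject.
\<close>

lemma simple_subobject_exists:
  assumes "finite_length C Y" "\<not> is_zero C Y"
  obtains U i where "is_simple C U" "i \<in> Hom C U Y" "is_mono C i"
proof -
  obtain n :: nat and X i p where *: "is_zero C (X 0) \<and> X n = Y \<and>
      (\<forall>k<n. i k \<in> Hom C (X k) (X (Suc k)) \<and> short_exact C (i k) (p k) \<and> is_simple C (Cod C (p k)))"
    using assms(1) unfolding finite_length_def by (elim exE) (rule that)
  then have X: "is_zero C (X 0)" "X n = Y"
    and ip: "\<And>k. k < n \<Longrightarrow> i k \<in> Hom C (X k) (X (Suc k)) \<and> short_exact C (i k) (p k) \<and> is_simple C (Cod C (p k))"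
    by blast+
  have n: "0 < n"
    using X assms(2) by (cases n) auto
  have i0: "i 0 \<in> Hom C (X 0) (X 1)" and k: "is_kernel C (i 0) (p 0)" and c: "is_cokernel C (p 0) (i 0)"
    and s: "is_simple C (Cod C (p 0))"
    using ip [OF n] by (auto simp: short_exact_def)
  have p0: "p 0 \<in> Hom C (X 1) (Cod C (p 0))"
    using cokernelD [OF c] HomD [OF i0] by (simp add: Hom_def)
  have "is_mono C (p 0)"
  proof (rule mono_if_zero [OF p0])
    fix T a assume a: "a \<in> Hom C T (X 1)" "p 0 \<cdot> a = Zer C T (Cod C (p 0))"
    then obtain a' where "a' \<in> Hom C T (X 0)" "i 0 \<cdot> a' = a"
      using kernel_factor [OF k, of a T] HomD [OF p0] HomD [OF i0] by auto
    then show "a = Zer C T (X 1)"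
      using zero_Cod [OF X(1)] Comp_Zer [OF i0] Hom_Ob [OF a(1)] by metis
  qed
  then have iso: "is_iso C (p 0)"
    using cokernelD(5) [OF c] mono_epi_iso by blast
  have "\<exists>j\<in>Hom C (X 1) (X (Suc k)). is_mono C j" if "Suc k \<le> n" for k
    using that
  proof (induction k)
    case 0
    have "X 1 \<in> Ob C" using Hom_Ob [OF i0] by simp
    then show ?case
      using Idn_Hom [of "X 1"] iso_mono [OF iso_Idn, of "X 1"] by auto
  next
    case (Suc k)
    then obtain j where j: "j \<in> Hom C (X 1) (X (Suc k))" "is_mono C j"
      by auto
    have i: "i (Suc k) \<in> Hom C (X (Suc k)) (X (Suc (Suc k)))" "is_mono C (i (Suc k))"
      using ip [of "Suc k"] Suc.prems kernelD(5) by (auto simp: short_exact_def)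
    show ?case
      using Comp_Hom [OF j(1) i(1)] mono_Comp [OF j(2) i(2)] HomD [OF j(1)] HomD [OF i(1)] by auto
  qed
  from this [of "n - 1"] obtain j where j: "j \<in> Hom C (X 1) Y" "is_mono C j"
    using n X(2) by auto
  have q: "inv_arr C (p 0) \<in> Hom C (Cod C (p 0)) (X 1)"
    using iso HomD [OF p0] by (simp add: Hom_def)
  have "is_mono C (j \<cdot> inv_arr C (p 0))"
    by (rule mono_Comp [OF iso_mono [OF inv_arr_iso [OF iso]] j(2)])
      (use HomD [OF j(1)] HomD [OF p0] iso in simp)
  then show ?thesis
    by (rule that [OF s Comp_Hom [OF q j(1)]])
qed

text \<open>
  The joint kernel of a finite family is built one arrow at a time: restrict the next arrow to the
  joint kernel of the previous ones and take its kernel.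
\<close>

lemma joint_kernel:
  assumes "finite \<Phi>" "\<Phi> \<subseteq> Hom C X Z" "X \<in> Ob C"
  shows "\<exists>K k. k \<in> Hom C K X \<and> is_mono C k \<and> (\<forall>\<phi>\<in>\<Phi>. \<phi> \<cdot> k = Zer C K Z) \<and>
    (\<forall>T. \<forall>a\<in>Hom C T X. (\<forall>\<phi>\<in>\<Phi>. \<phi> \<cdot> a = Zer C T Z) \<longrightarrow> (\<exists>a'\<in>Hom C T K. k \<cdot> a' = a))"
  using assms(1,2)
proof (induction \<Phi> rule: finite_induct)
  case empty
  have "Idn C X \<in> Hom C X X" "is_mono C (Idn C X)"
    using Idn_Hom [OF assms(3)] iso_mono [OF iso_Idn [OF assms(3)]] .
  moreover have "\<exists>a'\<in>Hom C T X. Idn C X \<cdot> a' = a" if "a \<in> Hom C T X" for T a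
    using that Idn_Comp by blast
  ultimately show ?case by blast
next
  case (insert \<phi> \<Phi>)
  then obtain K k where k: "k \<in> Hom C K X" "is_mono C k" "\<And>\<psi>. \<psi> \<in> \<Phi> \<Longrightarrow> \<psi> \<cdot> k = Zer C K Z"
    and u: "\<And>T a. a \<in> Hom C T X \<Longrightarrow> (\<And>\<psi>. \<psi> \<in> \<Phi> \<Longrightarrow> \<psi> \<cdot> a = Zer C T Z) \<Longrightarrow> \<exists>a'\<in>Hom C T K. k \<cdot> a' = a"
    by auto
  have p: "\<phi> \<in> Hom C X Z" and P: "\<And>\<psi>. \<psi> \<in> \<Phi> \<Longrightarrow> \<psi> \<in> Hom C X Z"
    using insert.prems by auto
  note [simp] = HomD [OF k(1)] HomD [OF p] Hom_Ob [OF k(1)] Hom_Ob [OF p]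
  obtain l where l: "is_kernel C l (\<phi> \<cdot> k)"
    using has_kernel [of "\<phi> \<cdot> k"] by auto
  have lH: "l \<in> Hom C (Dom C l) K"
    using kernelD [OF l] by (simp add: Hom_def)
  note [simp] = HomD(1,3) [OF lH]
  let ?L = "Dom C l"
  have kl: "k \<cdot> l \<in> Hom C ?L X"
    using Comp_Hom [OF lH k(1)] .
  have "is_mono C (k \<cdot> l)"
    by (rule mono_Comp [OF kernelD(5) [OF l] k(2)]) simp
  moreover have "\<psi> \<cdot> (k \<cdot> l) = Zer C ?L Z" if "\<psi> \<in> insert \<phi> \<Phi>" for \<psi>
  proof (cases "\<psi> = \<phi>")
    case True
    then show ?thesis using kernelD(4) [OF l] by simp
  next
    case False
    then have q: "\<psi> \<in> \<Phi>" using that by simp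
    have "\<psi> \<cdot> (k \<cdot> l) = (\<psi> \<cdot> k) \<cdot> l"
      using Comp_assoc [OF lH k(1) P [OF q]] by simp
    also have "\<dots> = Zer C ?L Z"
      unfolding k(3) [OF q] by simp
    finally show ?thesis .
  qed
  moreover have "\<exists>a'\<in>Hom C T ?L. (k \<cdot> l) \<cdot> a' = a"
    if a: "a \<in> Hom C T X" "\<And>\<psi>. \<psi> \<in> insert \<phi> \<Phi> \<Longrightarrow> \<psi> \<cdot> a = Zer C T Z" for T a
  proof -
    obtain b where b: "b \<in> Hom C T K" "k \<cdot> b = a"
      using u [OF a(1)] a(2) by blast
    have "(\<phi> \<cdot> k) \<cdot> b = Zer C T Z"
      using Comp_assoc [OF b(1) k(1) p] b(2) a(2) [of \<phi>] by simp
    then obtain c where c: "c \<in> Hom C T ?L" "l \<cdot> c = b"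
      using kernel_factor [OF l, of b T] b(1) by auto
    then show ?thesis
      using Comp_assoc [OF c(1) lH k(1)] b(2) by auto
  qed
  ultimately show ?case
    using kl by (intro exI [of _ ?L] exI [of _ "k \<cdot> l"] conjI ballI allI impI) blast+
qed

end

section \<open>The unit object of a tensor category is simple\<close>

context tensor_category
begin

lemma TAr_Zer:
  assumes "f \<in> Hom C X X'" "Y \<in> Ob C" "Y' \<in> Ob C"
  shows "f \<boxtimes> Zer C Y Y' = Zer C (X \<otimes> Y) (X' \<otimes> Y')"
proof (rule Add_self_eq_Zer)
  have z: "Zer C Y Y' \<in> Hom C Y Y'" using assms Zer_Hom by simp
  show "f \<boxtimes> Zer C Y Y' \<in> Hom C (X \<otimes> Y) (X' \<otimes> Y')"
    using TAr_Hom [OF assms(1) z] .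
  show "f \<boxtimes> Zer C Y Y' \<oplus> f \<boxtimes> Zer C Y Y' = f \<boxtimes> Zer C Y Y'"
    using TAr_Add [OF assms(1) z z] Zer_Add [OF z] by simp
qed

lemma Zer_TAr:
  assumes "f \<in> Hom C X X'" "Y \<in> Ob C" "Y' \<in> Ob C"
  shows "Zer C Y Y' \<boxtimes> f = Zer C (Y \<otimes> X) (Y' \<otimes> X')"
proof (rule Add_self_eq_Zer)
  have z: "Zer C Y Y' \<in> Hom C Y Y'" using assms Zer_Hom by simp
  show "Zer C Y Y' \<boxtimes> f \<in> Hom C (Y \<otimes> X) (Y' \<otimes> X')"
    using TAr_Hom [OF z assms(1)] .
  show "Zer C Y Y' \<boxtimes> f \<oplus> Zer C Y Y' \<boxtimes> f = Zer C Y Y' \<boxtimes> f"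
    using Add_TAr [OF z z assms(1)] Zer_Add [OF z] by simp
qed

lemma unit_nonzero: "\<not> is_zero C \<one>"
proof
  assume "is_zero C \<one>"
  then have "1 \<odot> Idn C \<one> = 0 \<odot> Idn C \<one>"
    using Scl_Hom [OF Idn_Hom [OF Unt_Ob]] zero_Dom by metis
  moreover have "inj (\<lambda>a. a \<odot> Idn C \<one>)"
    using End_Unt by (simp add: bij_betw_def)
  ultimately show False
    using injD zero_neq_one by metis
qed

text \<open>
  If the coevaluation vanished, the first zigzag equation would force the identity of \<open>U\<close> to vanish.
\<close>

lemma coev_nonzero:
  assumes d: "dual_pair C L U ev coev" and U: "\<not> is_zero C U"
  shows "coev \<noteq> Zer C \<one> (U \<otimes> L)"
proof
  note [simp] = dual_pairD(1-8) [OF d]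
  assume 0: "coev = Zer C \<one> (U \<otimes> L)"
  have "coev \<boxtimes> Idn C U = Zer C (\<one> \<otimes> U) ((U \<otimes> L) \<otimes> U)"
    unfolding 0 by (rule Zer_TAr [OF Idn_Hom]) simp_all
  then have "LUn C U = Zer C (\<one> \<otimes> U) U"
    using dual_pairD(9) [OF d] by simp
  from arg_cong [OF this, of "\<lambda>f. f \<cdot> inv_arr C (LUn C U)"]
  have "Idn C U = Zer C (\<one> \<otimes> U) U \<cdot> inv_arr C (LUn C U)"
    by simp
  also have "\<dots> = Zer C U U" by simp
  finally show False using U by (simp add: is_zero_iff)
qed

text \<open>
  The dual of a monomorphism \<open>i : U \<rightarrow> \<one>\<close> is an epimorphism \<open>\<one> \<rightarrow> L\<close>. An arrow \<open>f : L \<rightarrow> T\<close> is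
  determined by its transpose \<open>\<one> \<rightarrow> U \<otimes> T\<close>, hence also by the composite of this transpose with the
  monomorphism \<open>i \<otimes> T\<close>, and that composite is \<open>f\<close> after the dual of \<open>i\<close>.
\<close>

lemma mono_unit_transpose_epi:
  assumes d: "dual_pair C L U ev coev" and i: "is_mono C i" "i \<in> Hom C U \<one>"
  shows "is_epi C (LUn C L \<cdot> (i \<boxtimes> Idn C L) \<cdot> coev)"
proof (rule is_epiI)
  note [simp] = dual_pairD(1-8) [OF d] HomD [OF i(2)]
  let ?i = "LUn C L \<cdot> (i \<boxtimes> Idn C L) \<cdot> coev"
  show "?i \<in> Hom C \<one> L" by (simp add: Hom_def)
  fix T f g
  assume f: "f \<in> Hom C L T" and g: "g \<in> Hom C L T" and eq: "f \<cdot> ?i = g \<cdot> ?i"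
  note [simp] = HomD [OF f] HomD [OF g] Hom_Ob [OF f]
  obtain T' e c where d': "dual_pair C T T' e c"
    using right_dual [of T] by auto
  have *: "(i \<boxtimes> Idn C T) \<cdot> ((Idn C U \<boxtimes> h) \<cdot> coev) = inv_arr C (LUn C T) \<cdot> (h \<cdot> ?i)" if "h \<in> Hom C L T" for h
  proof -
    note [simp] = HomD [OF that]
    have "inv_arr C (LUn C T) \<cdot> (h \<cdot> ?i) = inv_arr C (LUn C T) \<cdot> ((h \<cdot> LUn C L) \<cdot> (i \<boxtimes> Idn C L) \<cdot> coev)"
      by simp
    also have "h \<cdot> LUn C L = LUn C T \<cdot> (Idn C \<one> \<boxtimes> h)"
      by (subst LUn_nat) simp_all
    finally show ?thesis by (simp add: merge)
  qed
  have "(Idn C U \<boxtimes> f) \<cdot> coev = (Idn C U \<boxtimes> g) \<cdot> coev"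
    by (rule mono_cancel [OF mono_TAr_right [OF d' i(1)], where T = \<one>])
      (use * [OF f] * [OF g] eq in \<open>simp_all add: Hom_def\<close>)
  moreover have c: "coev \<in> Hom C \<one> (U \<otimes> L)" by (simp add: Hom_def)
  moreover have "lower C ev L U L coev = RUn C L"
    using dual_pairD(10) [OF d] by (simp add: lower_def)
  ultimately have "f \<cdot> RUn C L = g \<cdot> RUn C L"
    using lower_post [OF d c f] lower_post [OF d c g] by metis
  then show "f = g"
    by (rule iso_cancel_right [rotated -1]) simp_all
qed

text \<open>
  Tensoring the dual \<open>\<one> \<rightarrow> L\<close> of \<open>i\<close> with \<open>U\<close> gives an epimorphism \<open>w : U \<rightarrow> U \<otimes> L\<close> onto a nonzero
  object. As \<open>U\<close> is simple, \<open>w\<close> is invertible, and \<open>i\<close> after \<open>w\<inverse>\<close> after the coevaluation is a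
  nonzero endomorphism of the unit object that factors through \<open>i\<close>. It is a nonzero scalar because
  \<open>End(\<one>)\<close> is the ground field, so \<open>i\<close> has a right inverse.
\<close>

lemma simple_sub_unit_iso:
  assumes U: "is_simple C U" and i: "is_mono C i" "i \<in> Hom C U \<one>"
  shows "is_iso C i"
proof -
  have U0: "U \<in> Ob C" "\<not> is_zero C U" using U by (auto simp: is_simple_def)
  obtain L ev coev where d: "dual_pair C L U ev coev"
    using left_dual [OF U0(1)] by blast
  obtain U' ev' coev' where d': "dual_pair C U U' ev' coev'"
    using right_dual [OF U0(1)] by blast
  note [simp] = dual_pairD(1-8) [OF d] HomD [OF i(2)]
  have c: "coev \<in> Hom C \<one> (U \<otimes> L)" by (simp add: Hom_def)
  let ?i = "LUn C L \<cdot> (i \<boxtimes> Idn C L) \<cdot> coev"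
  define w where "w = (Idn C U \<boxtimes> ?i) \<cdot> inv_arr C (RUn C U)"
  have w: "w \<in> Hom C U (U \<otimes> L)" by (simp add: w_def Hom_def)
  note [simp] = HomD [OF w]
  have "is_epi C (Idn C U \<boxtimes> ?i)"
    by (rule epi_TAr_left [OF d' mono_unit_transpose_epi [OF d i]])
  then have we: "is_epi C w"
  proof -
    assume e: "is_epi C (Idn C U \<boxtimes> ?i)"
    show ?thesis
    proof (rule is_epiI [OF w])
      fix T f g assume f: "f \<in> Hom C (U \<otimes> L) T" and g: "g \<in> Hom C (U \<otimes> L) T" and eq: "f \<cdot> w = g \<cdot> w"
      have "(f \<cdot> w) \<cdot> RUn C U = (g \<cdot> w) \<cdot> RUn C U"
        using eq by simp
      then have "f \<cdot> (Idn C U \<boxtimes> ?i) = g \<cdot> (Idn C U \<boxtimes> ?i)"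
        using HomD [OF f] HomD [OF g] by (simp add: w_def)
      then show "f = g"
        by (rule epi_cancel [OF e]) (use f g in simp_all)
    qed
  qed
  have c0: "coev \<noteq> Zer C \<one> (U \<otimes> L)"
    by (rule coev_nonzero [OF d U0(2)])
  have "w \<noteq> Zer C U (U \<otimes> L)"
  proof
    assume "w = Zer C U (U \<otimes> L)"
    then have "Idn C (U \<otimes> L) = Zer C (U \<otimes> L) (U \<otimes> L)"
      by (intro epi_zero [OF we w]) (simp_all add: Hom_def)
    then have "Idn C (U \<otimes> L) \<cdot> coev = Zer C (U \<otimes> L) (U \<otimes> L) \<cdot> coev" by simp
    then show False using c0 by simp
  qed
  then have wi: "is_iso C w"
    using mono_epi_iso simple_nonzero_mono [OF U w] we by blast
  let ?s = "inv_arr C w \<cdot> coev"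
  have s: "?s \<in> Hom C \<one> U" using wi by (simp add: Hom_def)
  have s0: "?s \<noteq> Zer C \<one> U"
  proof
    assume "?s = Zer C \<one> U"
    then have "w \<cdot> ?s = w \<cdot> Zer C \<one> U" by simp
    then show False using wi c0 by simp
  qed
  have is1: "i \<cdot> ?s \<in> Hom C \<one> \<one>"
    by (rule Comp_Hom [OF s i(2)])
  obtain a where a: "i \<cdot> ?s = a \<odot> Idn C \<one>"
    using End_Unt is1 unfolding bij_betw_def by blast
  have I: "Idn C \<one> \<in> Hom C \<one> \<one>" by (simp add: Hom_def)
  have "a \<noteq> 0"
  proof
    assume "a = 0"
    have z: "0 \<odot> Idn C \<one> = Zer C \<one> \<one>"
      using Add_self_eq_Zer [OF Scl_Hom [OF I, of 0]] plus_Scl [OF I, of 0 0] by simp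
    show False
      using mono_zero [OF i s] s0 a z \<open>a = 0\<close> by simp
  qed
  have "i \<cdot> (inverse a \<odot> ?s) = inverse a \<odot> (a \<odot> Idn C \<one>)"
    using Comp_Scl [OF s i(2)] a by simp
  also have "\<dots> = Idn C \<one>"
    using Scl_Scl [OF I] one_Scl [OF I] \<open>a \<noteq> 0\<close> by simp
  finally show ?thesis
    using Scl_Hom [OF s] by (intro mono_split_epi_iso(1) [OF i(1)]) simp_all
qed

text \<open>
  The unit object has a simple subobject; by the previous lemma this is the unit object itself.
\<close>

lemma sub_unit:
  assumes v: "is_mono C v" "v \<in> Hom C V \<one>"
  shows "is_zero C V \<or> is_iso C v"
proof -
  obtain U i where U: "is_simple C U" and i: "i \<in> Hom C U \<one>" "is_mono C i"
    using simple_subobject_exists [OF finite_length_Ob [OF Unt_Ob] unit_nonzero] by blast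
  have ii: "is_iso C i"
    by (rule simple_sub_unit_iso [OF U i(2,1)])
  note [simp] = HomD [OF v(2)] HomD [OF i(1)] ii
  have "is_mono C (inv_arr C i \<cdot> v)"
    by (rule mono_Comp [OF v(1) iso_mono]) simp_all
  then have "is_zero C V \<or> is_iso C (inv_arr C i \<cdot> v)"
    using U by (auto simp: is_simple_def)
  moreover have "i \<cdot> (inv_arr C i \<cdot> v) = v" by simp
  ultimately show ?thesis
    using iso_Comp(1) [of "inv_arr C i \<cdot> v" i] by auto
qed

lemma from_unit_mono:
  assumes "s \<in> Hom C \<one> X" "s \<noteq> Zer C \<one> X"
  shows "is_mono C s"
  using simple_nonzero_mono [OF _ assms] sub_unit unit_nonzero
  by (auto simp: is_simple_def Hom_def is_mono_def)

lemma to_unit_epi: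
  assumes f: "f \<in> Hom C X \<one>" "f \<noteq> Zer C X \<one>"
  shows "is_epi C f"
proof (rule epi_if_zero [OF f(1)])
  fix T a assume a: "a \<in> Hom C \<one> T" "a \<cdot> f = Zer C X T"
  show "a = Zer C \<one> T"
  proof (rule ccontr)
    assume "a \<noteq> Zer C \<one> T"
    then have "is_mono C a" using from_unit_mono a(1) by blast
    then show False using mono_zero [OF _ a(1) f(1) a(2)] f(2) by blast
  qed
qed

section \<open>Trivial objects\<close>

text \<open>
  Induction on the number of arrows. Let \<open>K\<close> be the joint kernel of all arrows but \<open>\<phi>\<close>. Then \<open>\<phi>\<close> embeds \<open>K\<close>
  into the simple object \<open>\<one>\<close>. If \<open>K\<close> is zero, then \<open>\<phi>\<close> can be dropped. Otherwise \<open>\<phi>\<close> maps \<open>K\<close>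
  isomorphically to \<open>\<one>\<close>, so \<open>K\<close> is a complement of the kernel of \<open>\<phi>\<close>, on which the remaining arrows
  are jointly monic.
\<close>

lemma power_of_joint_mono:
  assumes "card \<Phi> \<le> n" "finite \<Phi>" "\<Phi> \<subseteq> Hom C X \<one>" "X \<in> Ob C"
    "\<And>T a. a \<in> Hom C T X \<Longrightarrow> (\<And>\<phi>. \<phi> \<in> \<Phi> \<Longrightarrow> \<phi> \<cdot> a = Zer C T \<one>) \<Longrightarrow> a = Zer C T X"
  shows "\<exists>m. is_power C \<one> m X"
  using assms
proof (induction n arbitrary: \<Phi> X)
  case 0
  then have "\<Phi> = {}" by simp
  then have "Idn C X = Zer C X X"
    using 0(5) [OF Idn_Hom [OF 0(4)]] by simp
  then have "is_power C \<one> 0 X"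
    using 0(4) by (simp add: is_zero_iff)
  then show ?case by blast
next
  case (Suc n)
  show ?case
  proof (cases "\<Phi> = {}")
    case True
    then show ?thesis using Suc.IH [of \<Phi> X] Suc.prems by auto
  next
    case False
    then obtain \<phi> \<Psi> where P: "\<Phi> = insert \<phi> \<Psi>" "\<phi> \<notin> \<Psi>"
      by (meson Set.set_insert all_not_in_conv)
    have fin: "finite \<Psi>" "card \<Psi> \<le> n"
      using Suc.prems(1,2) P by auto
    have p: "\<phi> \<in> Hom C X \<one>" and sub: "\<Psi> \<subseteq> Hom C X \<one>"
      using Suc.prems(3) P by auto
    note [simp] = HomD [OF p] \<open>X \<in> Ob C\<close>
    obtain K k where k: "k \<in> Hom C K X" "is_mono C k" "\<And>\<psi>. \<psi> \<in> \<Psi> \<Longrightarrow> \<psi> \<cdot> k = Zer C K \<one>"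
      and u: "\<And>T a. a \<in> Hom C T X \<Longrightarrow> (\<And>\<psi>. \<psi> \<in> \<Psi> \<Longrightarrow> \<psi> \<cdot> a = Zer C T \<one>) \<Longrightarrow> \<exists>a'\<in>Hom C T K. k \<cdot> a' = a"
      using joint_kernel [OF fin(1) sub \<open>X \<in> Ob C\<close>] by auto
    note [simp] = HomD [OF k(1)] Hom_Ob [OF k(1)]
    have pk: "\<phi> \<cdot> k \<in> Hom C K \<one>"
      by (rule Comp_Hom [OF k(1) p])
    \<comment> \<open>On the joint kernel of the other arrows, \<open>\<phi>\<close> alone is monic.\<close>
    have "is_mono C (\<phi> \<cdot> k)"
    proof (rule mono_if_zero [OF pk])
      fix T a assume a: "a \<in> Hom C T K" "(\<phi> \<cdot> k) \<cdot> a = Zer C T \<one>"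
      note [simp] = HomD [OF a(1)] Hom_Ob [OF a(1)]
      have "k \<cdot> a = Zer C T X"
      proof (rule Suc.prems(5) [OF Comp_Hom [OF a(1) k(1)]])
        fix \<psi> assume "\<psi> \<in> \<Phi>"
        then consider "\<psi> = \<phi>" | "\<psi> \<in> \<Psi>" using P by auto
        then show "\<psi> \<cdot> (k \<cdot> a) = Zer C T \<one>"
        proof cases
          case 1
          then show ?thesis using a(2) by simp
        next
          case 2
          then have h: "\<psi> \<in> Hom C X \<one>" using sub by blast
          show ?thesis
            using Comp_assoc [OF a(1) k(1) h] k(3) [OF 2] by simp
        qed
      qed
      then show "a = Zer C T K"
        by (rule mono_zero [OF k(2,1) a(1)])
    qed
    then have "is_zero C K \<or> is_iso C (\<phi> \<cdot> k)"
      using sub_unit pk by blast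
    then show ?thesis
    proof
      assume K: "is_zero C K"
      have "a = Zer C T X" if a: "a \<in> Hom C T X" "\<And>\<psi>. \<psi> \<in> \<Psi> \<Longrightarrow> \<psi> \<cdot> a = Zer C T \<one>" for T a
      proof -
        obtain a' where a': "a' \<in> Hom C T K" "k \<cdot> a' = a" using u a by blast
        then show ?thesis
          using zero_Cod [OF K a'(1)] Comp_Zer [OF k(1)] Hom_Ob [OF a(1)] by metis
      qed
      then show ?thesis
        using Suc.IH [OF fin(2,1) sub] by auto
    next
      assume iso: "is_iso C (\<phi> \<cdot> k)"
      define s where "s = k \<cdot> inv_arr C (\<phi> \<cdot> k)"
      have s: "s \<in> Hom C \<one> X"
        using iso by (simp add: s_def Hom_def)
      note [simp] = HomD [OF s]
      have ps: "\<phi> \<cdot> s = Idn C \<one>"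
      proof -
        have "\<phi> \<cdot> s = (\<phi> \<cdot> k) \<cdot> inv_arr C (\<phi> \<cdot> k)"
          unfolding s_def by (rule Comp_assoc' [symmetric]) (use iso in simp_all)
        also have "\<dots> = Idn C \<one>"
          using inv_arr_simps(5) [OF iso] HomD [OF pk] by metis
        finally show ?thesis .
      qed
      obtain y where y: "is_kernel C y \<phi>"
        using has_kernel [of \<phi>] by auto
      define Y where "Y = Dom C y"
      have yH: "y \<in> Hom C Y X"
        using kernelD [OF y] by (simp add: Hom_def Y_def)
      note [simp] = HomD [OF yH] Hom_Ob [OF yH]
      have py: "\<phi> \<cdot> y = Zer C Y \<one>"
        using kernelD(4) [OF y] by simp
      have sp: "s \<cdot> \<phi> \<in> Hom C X X"
        by (rule Comp_Hom [OF p s])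
      have I: "Idn C X \<in> Hom C X X" by (simp add: Hom_def)
      obtain d where d: "d \<in> Hom C X X" "Idn C X = s \<cdot> \<phi> \<oplus> d"
        "\<And>h Z. h \<in> Hom C X Z \<Longrightarrow> h \<cdot> d = Zer C X Z \<longleftrightarrow> h \<cdot> Idn C X = h \<cdot> (s \<cdot> \<phi>)"
        "\<And>h W. h \<in> Hom C W X \<Longrightarrow> d \<cdot> h = Zer C W X \<longleftrightarrow> Idn C X \<cdot> h = (s \<cdot> \<phi>) \<cdot> h"
        by (rule difference [OF I sp]) blast
      note [simp] = HomD [OF d(1)]
      have pd: "\<phi> \<cdot> d = Zer C X (Cod C \<phi>)"
        using d(3) [OF p] Comp_assoc [OF p s p] ps by simp
      have dH: "d \<in> Hom C X (Dom C \<phi>)"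
        using d(1) by simp
      obtain q where q: "q \<in> Hom C X Y" "y \<cdot> q = d"
        by (rule kernel_factor [OF y dH pd, folded Y_def]) (rule that)
      note [simp] = HomD [OF q(1)]
      have "q \<cdot> s = Zer C \<one> Y"
      proof (rule mono_zero [OF kernelD(5) [OF y] yH])
        have "d \<cdot> s = Zer C \<one> X"
          using d(4) [OF s] ps by simp
        then show "y \<cdot> (q \<cdot> s) = Zer C \<one> X"
          using Comp_assoc [OF s q(1) yH] q(2) by simp
      qed (simp add: Hom_def)
      moreover have "q \<cdot> y = Idn C Y"
      proof (rule mono_cancel [OF kernelD(5) [OF y], where T = Y])
        have "y = (s \<cdot> \<phi> \<oplus> d) \<cdot> y"
          using d(2) by (metis Idn_Comp yH)
        also have "\<dots> = Zer C Y X \<oplus> d \<cdot> y"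
          using Add_Comp [OF yH sp d(1)] py by simp
        also have "\<dots> = d \<cdot> y"
          by (rule Zer_Add [of _ Y X]) (simp add: Hom_def)
        finally show "y \<cdot> (q \<cdot> y) = y \<cdot> Idn C Y"
          using Comp_assoc [OF yH q(1) yH] q(2) by simp
      qed (simp_all add: Hom_def)
      moreover have "y \<cdot> q \<oplus> s \<cdot> \<phi> = Idn C X"
        using d(2) q(2) Add_commute [OF sp d(1)] by simp
      ultimately have ds: "is_dsum C Y \<one> X"
        unfolding is_dsum_def using yH s q(1) p ps py by blast
      have "\<exists>m. is_power C \<one> m Y"
      proof (rule Suc.IH)
        show "card ((\<lambda>\<psi>. \<psi> \<cdot> y) ` \<Psi>) \<le> n" "finite ((\<lambda>\<psi>. \<psi> \<cdot> y) ` \<Psi>)"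
          using fin card_image_le [OF fin(1)] le_trans by blast+
        show "(\<lambda>\<psi>. \<psi> \<cdot> y) ` \<Psi> \<subseteq> Hom C Y \<one>"
          using sub Comp_Hom [OF yH] by blast
        fix T a assume a: "a \<in> Hom C T Y"
          "\<And>\<chi>. \<chi> \<in> (\<lambda>\<psi>. \<psi> \<cdot> y) ` \<Psi> \<Longrightarrow> \<chi> \<cdot> a = Zer C T \<one>"
        have "y \<cdot> a = Zer C T X"
        proof (rule Suc.prems(5) [OF Comp_Hom [OF a(1) yH]])
          fix \<psi> assume "\<psi> \<in> \<Phi>"
          then consider "\<psi> = \<phi>" | "\<psi> \<in> \<Psi>" using P by auto
          then show "\<psi> \<cdot> (y \<cdot> a) = Zer C T \<one>"
          proof cases
            case 1
            then show ?thesis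
              using Comp_assoc [OF a(1) yH p] py HomD [OF a(1)] by simp
          next
            case 2
            then have h: "\<psi> \<in> Hom C X \<one>" using sub by blast
            show ?thesis
              using Comp_assoc [OF a(1) yH h] a(2) 2 by simp
          qed
        qed
        then show "a = Zer C T Y"
          by (rule mono_zero [OF kernelD(5) [OF y] yH a(1)])
      qed simp
      then obtain m where "is_power C \<one> m Y" ..
      then have "is_power C \<one> (Suc m) X"
        using ds by auto
      then show ?thesis ..
    qed
  qed
qed

lemma lin_span_annihilated:
  assumes "\<psi> \<in> lin_span C X Y B" "B \<subseteq> Hom C X Y" "a \<in> Hom C T X" "Y \<in> Ob C"
    "\<And>\<phi>. \<phi> \<in> B \<Longrightarrow> \<phi> \<cdot> a = Zer C T Y"
  shows "\<psi> \<in> Hom C X Y \<and> \<psi> \<cdot> a = Zer C T Y"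
  using assms(1)
proof induction
  case span_zero
  then show ?case
    using assms(4) Hom_Ob [OF assms(3)] Zer_Hom Zer_Comp [OF assms(3)] by simp
next
  case (span_base f)
  then show ?case using assms(2,5) by blast
next
  case (span_Add f g)
  then have fg: "f \<in> Hom C X Y" "g \<in> Hom C X Y" by auto
  moreover have "Zer C T Y \<oplus> Zer C T Y = Zer C T Y"
    by (rule Zer_Add [OF Zer_Hom]) (use assms(4) Hom_Ob [OF assms(3)] in auto)
  ultimately show ?case
    using Add_Hom [OF fg] Add_Comp [OF assms(3) fg] span_Add by simp
next
  case (span_Scl f b)
  have "b \<odot> Zer C T Y = Zer C T Y"
  proof (rule Add_self_eq_Zer)
    have z: "Zer C T Y \<in> Hom C T Y" using Zer_Hom assms(4) Hom_Ob [OF assms(3)] by simp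
    then show "b \<odot> Zer C T Y \<in> Hom C T Y" by (rule Scl_Hom)
    show "b \<odot> Zer C T Y \<oplus> b \<odot> Zer C T Y = b \<odot> Zer C T Y"
      using Scl_Add [OF z z] Zer_Add [OF z] by simp
  qed
  then show ?case
    using Scl_Hom Scl_Comp [OF assms(3)] span_Scl by auto
qed

text \<open>
  Hom spaces are finite-dimensional, so finitely many arrows to the unit object suffice to be jointly monic.
\<close>

lemma unit_cogen_power:
  assumes X: "unit_cogen C X"
  shows "\<exists>n. is_power C \<one> n X"
proof -
  have XO: "X \<in> Ob C" using X by (simp add: unit_cogen_def)
  obtain B where B: "finite B" "B \<subseteq> Hom C X \<one>" "lin_span C X \<one> B = Hom C X \<one>"
    using finite_dim_Hom [OF XO Unt_Ob] unfolding hom_finite_dim_def by blast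
  show ?thesis
  proof (rule power_of_joint_mono [OF order.refl B(1,2) XO])
    fix T a assume a: "a \<in> Hom C T X" "\<And>\<phi>. \<phi> \<in> B \<Longrightarrow> \<phi> \<cdot> a = Zer C T \<one>"
    have TO: "T \<in> Ob C" using Hom_Ob [OF a(1)] by simp
    show "a = Zer C T X"
    proof (rule unit_cogenD [OF X a(1) Zer_Hom [OF TO XO]])
      fix \<phi> assume p: "\<phi> \<in> Hom C X \<one>"
      then show "\<phi> \<cdot> a = \<phi> \<cdot> Zer C T X"
        using lin_span_annihilated [of \<phi> X \<one> B a T] B a Comp_Zer [OF p TO] by simp
    qed
  qed
qed

lemma dsum_unit_cogen:
  assumes ds: "is_dsum C X Y P" and X: "unit_cogen C X" and Y: "unit_cogen C Y"
  shows "unit_cogen C P"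
proof -
  obtain i j p q where i: "i \<in> Hom C X P" and j: "j \<in> Hom C Y P" and p: "p \<in> Hom C P X" and q: "q \<in> Hom C P Y"
    and id: "i \<cdot> p \<oplus> j \<cdot> q = Idn C P"
    using ds unfolding is_dsum_def by blast
  show ?thesis
  proof (rule unit_cogenI)
    show "P \<in> Ob C" using Hom_Ob [OF i] by simp
    fix T f g assume f: "f \<in> Hom C T P" and g: "g \<in> Hom C T P"
      and eq: "\<And>\<phi>. \<phi> \<in> Hom C P \<one> \<Longrightarrow> \<phi> \<cdot> f = \<phi> \<cdot> g"
    have "p \<cdot> f = p \<cdot> g"
      by (rule unit_cogenD [OF X Comp_Hom [OF f p] Comp_Hom [OF g p]])
        (use eq [OF Comp_Hom [OF p]] Comp_assoc [OF f p] Comp_assoc [OF g p] in metis)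
    moreover have "q \<cdot> f = q \<cdot> g"
      by (rule unit_cogenD [OF Y Comp_Hom [OF f q] Comp_Hom [OF g q]])
        (use eq [OF Comp_Hom [OF q]] Comp_assoc [OF f q] Comp_assoc [OF g q] in metis)
    moreover have "h = i \<cdot> (p \<cdot> h) \<oplus> j \<cdot> (q \<cdot> h)" if h: "h \<in> Hom C T P" for h
    proof -
      have "h = (i \<cdot> p \<oplus> j \<cdot> q) \<cdot> h"
        using id Idn_Comp [OF h] by simp
      then show ?thesis
        using Add_Comp [OF h Comp_Hom [OF p i] Comp_Hom [OF q j]] Comp_assoc [OF h p i] Comp_assoc [OF h q j]
        by simp
    qed
    ultimately show "f = g" using f g by metis
  qed
qed

lemma dsum_unit_gen:
  assumes ds: "is_dsum C X Y P" and X: "unit_gen C X" and Y: "unit_gen C Y"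
  shows "unit_gen C P"
proof -
  obtain i j p q where i: "i \<in> Hom C X P" and j: "j \<in> Hom C Y P" and p: "p \<in> Hom C P X" and q: "q \<in> Hom C P Y"
    and id: "i \<cdot> p \<oplus> j \<cdot> q = Idn C P"
    using ds unfolding is_dsum_def by blast
  show ?thesis
  proof (rule unit_genI)
    show "P \<in> Ob C" using Hom_Ob [OF i] by simp
    fix T f g assume f: "f \<in> Hom C P T" and g: "g \<in> Hom C P T"
      and eq: "\<And>s. s \<in> Hom C \<one> P \<Longrightarrow> f \<cdot> s = g \<cdot> s"
    have "f \<cdot> i = g \<cdot> i"
      by (rule unit_genD [OF X Comp_Hom [OF i f] Comp_Hom [OF i g]])
        (use eq [OF Comp_Hom [OF _ i]] Comp_assoc [OF _ i f] Comp_assoc [OF _ i g] in metis)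
    moreover have "f \<cdot> j = g \<cdot> j"
      by (rule unit_genD [OF Y Comp_Hom [OF j f] Comp_Hom [OF j g]])
        (use eq [OF Comp_Hom [OF _ j]] Comp_assoc [OF _ j f] Comp_assoc [OF _ j g] in metis)
    moreover have "h = (h \<cdot> i) \<cdot> p \<oplus> (h \<cdot> j) \<cdot> q" if h: "h \<in> Hom C P T" for h
    proof -
      have "h = h \<cdot> (i \<cdot> p \<oplus> j \<cdot> q)"
        using id Comp_Idn [OF h] by simp
      then show ?thesis
        using Comp_Add [OF Comp_Hom [OF p i] Comp_Hom [OF q j] h] Comp_assoc [OF p i h] Comp_assoc [OF q j h]
        by simp
    qed
    ultimately show "f = g" using f g by metis
  qed
qed

lemma unit_cogen_Unt: "unit_cogen C \<one>"
  by (rule unit_cogenI) (use Idn_Hom [OF Unt_Ob] Idn_Comp in \<open>auto, metis\<close>)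

lemma unit_gen_Unt: "unit_gen C \<one>"
  by (rule unit_genI) (use Idn_Hom [OF Unt_Ob] Comp_Idn in \<open>auto, metis\<close>)

lemma power_unit_cogen_gen: "is_power C \<one> n X \<Longrightarrow> unit_cogen C X \<and> unit_gen C X"
proof (induction n arbitrary: X)
  case 0
  then have z: "is_zero C X" by simp
  then have "X \<in> Ob C" by (simp add: is_zero_def)
  then show ?case
    using zero_Cod [OF z] zero_Dom [OF z] by (metis unit_cogenI unit_genI)
next
  case (Suc n)
  then show ?case
    using dsum_unit_cogen dsum_unit_gen unit_cogen_Unt unit_gen_Unt by auto
qed

lemma trivial_iff_cogen: "is_trivial C X \<longleftrightarrow> unit_cogen C X"
proof
  assume "is_trivial C X"
  then obtain n P f where P: "is_power C \<one> n P" "f \<in> Hom C X P" "is_iso C f"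
    by (auto simp: is_trivial_def isomorphic_def)
  then show "unit_cogen C X"
    using unit_cogen_mono [OF category_axioms conjunct1 [OF power_unit_cogen_gen [OF P(1)]] iso_mono [OF P(3)]]
      HomD [OF P(2)] by simp
next
  assume X: "unit_cogen C X"
  then have "X \<in> Ob C" by (simp add: unit_cogen_def)
  then show "is_trivial C X"
    unfolding is_trivial_def using unit_cogen_power [OF X] isomorphic_refl by blast
qed

text \<open>
  A dual of an object that is generated by the unit object is cogenerated by it, hence trivial, hence
  again generated; dualizing back shows that the object itself is cogenerated.
\<close>

lemma trivial_iff_gen: "is_trivial C X \<longleftrightarrow> unit_gen C X"
proof
  assume "is_trivial C X"
  then obtain n where n: "is_power C \<one> n X"
    using unit_cogen_power trivial_iff_cogen by blast
  then show "unit_gen C X"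
    using power_unit_cogen_gen by blast
next
  assume X: "unit_gen C X"
  then have "X \<in> Ob C" by (simp add: unit_gen_def)
  then obtain L ev coev where d: "dual_pair C L X ev coev"
    using left_dual by blast
  have "unit_cogen C L"
    by (rule unit_cogen_dual [OF d X right_dual])
  then have "unit_gen C L"
    using unit_cogen_power power_unit_cogen_gen by blast
  then have "unit_cogen C X"
    by (rule unit_cogen_dual' [OF d _ left_dual])
  then show "is_trivial C X"
    by (simp add: trivial_iff_cogen)
qed

lemma trivial_Ob: "is_trivial C X \<Longrightarrow> X \<in> Ob C"
  by (simp add: trivial_iff_cogen unit_cogen_def)

lemma trivial_dual:
  assumes "dual_pair C L X ev coev"
  shows "is_trivial C L \<longleftrightarrow> is_trivial C X"
  using unit_cogen_dual [OF assms _ right_dual] unit_cogen_dual' [OF assms _ left_dual]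
    trivial_iff_cogen trivial_iff_gen by blast

lemma trivial_mono: "is_mono C m \<Longrightarrow> is_trivial C (Cod C m) \<Longrightarrow> is_trivial C (Dom C m)"
  using unit_cogen_mono [OF category_axioms] by (simp add: trivial_iff_cogen)

lemma trivial_epi: "is_epi C e \<Longrightarrow> is_trivial C (Dom C e) \<Longrightarrow> is_trivial C (Cod C e)"
  using unit_gen_epi [OF category_axioms] by (simp add: trivial_iff_gen)

lemma trivial_isomorphic: "isomorphic C X Y \<Longrightarrow> is_trivial C Y \<Longrightarrow> is_trivial C X"
  unfolding isomorphic_def using trivial_mono iso_mono HomD by metis

lemma trivial_dsum: "is_dsum C X Y P \<Longrightarrow> is_trivial C X \<Longrightarrow> is_trivial C Y \<Longrightarrow> is_trivial C P"
  using dsum_unit_cogen by (simp add: trivial_iff_cogen)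

lemma trivial_zero: "is_zero C X \<Longrightarrow> is_trivial C X"
  using power_unit_cogen_gen [of 0 X] by (simp add: trivial_iff_cogen)

lemma trivial_Unt: "is_trivial C \<one>"
  by (simp add: trivial_iff_cogen unit_cogen_Unt)

lemma trivial_TOb: "is_trivial C X \<Longrightarrow> is_trivial C Y \<Longrightarrow> is_trivial C (X \<otimes> Y)"
  using unit_cogen_TOb right_dual trivial_Ob unfolding trivial_iff_cogen by blast

end

section \<open>The arrows from free modules given by the augmentation\<close>

context strong_monoidal_functor
begin

text \<open>A strong monoidal functor intertwines the transposition along a dual pair with the
  transposition along its image.\<close>

lemma functor_lower:
  assumes d: "dual_pair C L U ev coev" and g: "g \<in> Hom C X (U \<otimes>\<^bsub>C\<^esub> Z)" and Z: "Z \<in> Ob C"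
  shows "lower D (inv_arr D (F0 F) \<bullet> FAr F ev \<bullet> F2 F L U) (FOb F L) (FOb F U) (FOb F Z)
      (inv_arr D (F2 F U Z) \<bullet> FAr F g)
    = FAr F (lower C ev L U Z g) \<bullet> F2 F L X"
proof -
  note [simp] = dual_pairD(1-8) [OF d] HomD [OF g] Z C.Hom_Ob [OF g]
  let ?U = "FOb F U" and ?L = "FOb F L" and ?Z = "FOb F Z"
  let ?IZ = "Idn D (FOb F Z)" and ?IL = "Idn D (FOb F L)"
  have a: "inv_arr D (Asc D ?L ?U ?Z) \<bullet> (?IL \<boxtimes>\<^bsub>D\<^esub> inv_arr D (F2 F U Z))
    = (inv_arr D (F2 F L U) \<boxtimes>\<^bsub>D\<^esub> ?IZ) \<bullet> inv_arr D (F2 F (L \<otimes>\<^bsub>C\<^esub> U) Z) \<bullet> FAr F (inv_arr C (Asc C L U Z))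
      \<bullet> F2 F L (U \<otimes>\<^bsub>C\<^esub> Z)"
    (is "_ = ?rhs")
  proof -
    have "Asc D ?L ?U ?Z \<bullet> ?rhs
      = (Asc D ?L ?U ?Z \<bullet> (inv_arr D (F2 F L U) \<boxtimes>\<^bsub>D\<^esub> ?IZ) \<bullet> inv_arr D (F2 F (L \<otimes>\<^bsub>C\<^esub> U) Z))
        \<bullet> FAr F (inv_arr C (Asc C L U Z)) \<bullet> F2 F L (U \<otimes>\<^bsub>C\<^esub> Z)"
      by simp
    also have "\<dots> = (?IL \<boxtimes>\<^bsub>D\<^esub> inv_arr D (F2 F U Z)) \<bullet> inv_arr D (F2 F L (U \<otimes>\<^bsub>C\<^esub> Z))
        \<bullet> FAr F (Asc C L U Z \<cdot>\<^bsub>C\<^esub> inv_arr C (Asc C L U Z)) \<bullet> F2 F L (U \<otimes>\<^bsub>C\<^esub> Z)"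
      by (subst inv_F2_Asc [symmetric]) (simp_all del: C.inv_arr_simps(5) FAr_Idn)
    also have "\<dots> = ?IL \<boxtimes>\<^bsub>D\<^esub> inv_arr D (F2 F U Z)"
      by simp
    finally have eq: "Asc D ?L ?U ?Z \<bullet> ?rhs = ?IL \<boxtimes>\<^bsub>D\<^esub> inv_arr D (F2 F U Z)" .
    show ?thesis
      by (subst eq [symmetric]) simp
  qed
  have b: "(FAr F ev \<boxtimes>\<^bsub>D\<^esub> ?IZ) \<bullet> inv_arr D (F2 F (L \<otimes>\<^bsub>C\<^esub> U) Z)
    = inv_arr D (F2 F \<one>\<^bsub>C\<^esub> Z) \<bullet> FAr F (ev \<boxtimes>\<^bsub>C\<^esub> Idn C Z)"
    using inv_F2_nat [of ev "Idn C Z" "\<one>\<^bsub>C\<^esub>" Z] by simp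
  have c: "F2 F L (U \<otimes>\<^bsub>C\<^esub> Z) \<bullet> (?IL \<boxtimes>\<^bsub>D\<^esub> FAr F g) = FAr F (Idn C L \<boxtimes>\<^bsub>C\<^esub> g) \<bullet> F2 F L X"
    using F2_nat [of "Idn C L" g L "U \<otimes>\<^bsub>C\<^esub> Z"] by simp
  have l: "LUn D ?Z \<bullet> (inv_arr D (F0 F) \<boxtimes>\<^bsub>D\<^esub> ?IZ) \<bullet> inv_arr D (F2 F \<one>\<^bsub>C\<^esub> Z) = FAr F (LUn C Z)"
    by (simp add: F2_LUn [symmetric] D.merge)
  have "lower D (inv_arr D (F0 F) \<bullet> FAr F ev \<bullet> F2 F L U) ?L ?U ?Z (inv_arr D (F2 F U Z) \<bullet> FAr F g)
    = LUn D ?Z \<bullet> (inv_arr D (F0 F) \<boxtimes>\<^bsub>D\<^esub> ?IZ) \<bullet> (FAr F ev \<boxtimes>\<^bsub>D\<^esub> ?IZ) \<bullet> (F2 F L U \<boxtimes>\<^bsub>D\<^esub> ?IZ)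
      \<bullet> (inv_arr D (Asc D ?L ?U ?Z) \<bullet> (?IL \<boxtimes>\<^bsub>D\<^esub> inv_arr D (F2 F U Z))) \<bullet> (?IL \<boxtimes>\<^bsub>D\<^esub> FAr F g)"
    by (simp add: lower_def D.merge)
  also have "\<dots> = LUn D ?Z \<bullet> (inv_arr D (F0 F) \<boxtimes>\<^bsub>D\<^esub> ?IZ) \<bullet> ((FAr F ev \<boxtimes>\<^bsub>D\<^esub> ?IZ) \<bullet> inv_arr D (F2 F (L \<otimes>\<^bsub>C\<^esub> U) Z))
      \<bullet> FAr F (inv_arr C (Asc C L U Z)) \<bullet> (F2 F L (U \<otimes>\<^bsub>C\<^esub> Z) \<bullet> (?IL \<boxtimes>\<^bsub>D\<^esub> FAr F g))"
    unfolding a by (simp add: D.merge)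
  also have "\<dots> = (LUn D ?Z \<bullet> (inv_arr D (F0 F) \<boxtimes>\<^bsub>D\<^esub> ?IZ) \<bullet> inv_arr D (F2 F \<one>\<^bsub>C\<^esub> Z)) \<bullet> FAr F (ev \<boxtimes>\<^bsub>C\<^esub> Idn C Z)
      \<bullet> FAr F (inv_arr C (Asc C L U Z)) \<bullet> FAr F (Idn C L \<boxtimes>\<^bsub>C\<^esub> g) \<bullet> F2 F L X"
    unfolding b c by simp
  also have "\<dots> = FAr F (lower C ev L U Z g) \<bullet> F2 F L X"
    unfolding l by (simp add: lower_def)
  finally show ?thesis .
qed

end

locale tensor_adjunction =
  tensor_functor C D F + adjunction C D F R \<eta> \<epsilon>
  for C :: "('o, 'm, 'k::field, 'y) mon_cat_scheme" (structure) and D :: "('p, 'n, 'k, 'z) mon_cat_scheme"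
    and F :: "('o, 'm, 'p, 'n, 'w) mfctr_scheme" and R :: "('p, 'n, 'o, 'm, 'v) fctr_scheme"
    and \<eta> :: "'o \<Rightarrow> 'm" and \<epsilon> :: "'p \<Rightarrow> 'n"
begin

lemma unit_simps [simp]:
  assumes "X \<in> Ob C"
  shows "\<eta> X \<in> Arr C" "Dom C (\<eta> X) = X" "Cod C (\<eta> X) = FOb R (FOb F X)"
  using unit_Hom [OF assms] by (auto simp: Hom_def)

lemma counit_simps [simp]:
  assumes "Y \<in> Ob D"
  shows "\<epsilon> Y \<in> Arr D" "Dom D (\<epsilon> Y) = FOb F (FOb R Y)" "Cod D (\<epsilon> Y) = Y"
  using counit_Hom [OF assms] by (auto simp: Hom_def)

text \<open>The counit \<open>e : F A \<rightarrow> \<one>\<close> is an augmentation of the algebra \<open>F A\<close>.\<close>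

abbreviation Alg :: "('o, 'm) alg" where "Alg \<equiv> induced_algebra C D F R \<eta> \<epsilon>"
abbreviation A :: 'o where "A \<equiv> FOb R \<one>\<^bsub>D\<^esub>"
abbreviation m :: 'm where "m \<equiv> amul Alg"
abbreviation u :: 'm where "u \<equiv> aunit Alg"
abbreviation e :: 'n where "e \<equiv> \<epsilon> \<one>\<^bsub>D\<^esub>"

lemma aob_Alg [simp]: "aob Alg = A"
  by (simp add: induced_algebra_def)

text \<open>
  The algebra structure on \<open>R \<one>\<close> is defined by transposition along the adjunction. Transposing back
  gives the values of the counit on multiplication and unit (\<open>aug_mul\<close>, \<open>aug_unit\<close>); together
  with the universal property of the counit (\<open>aug_surj\<close>, \<open>aug_inj\<close>) they determine the algebra.
\<close>

lemma counit_transpose: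
  assumes "w \<in> Hom D (FOb F Z) Y" "Z \<in> Ob C"
  shows "\<epsilon> Y \<bullet> FAr F (FAr R w \<cdot> \<eta> Z) = w"
proof -
  note [simp] = HomD [OF assms(1)] assms(2) D.Hom_Ob [OF assms(1)]
  have "\<epsilon> Y \<bullet> FAr F (FAr R w \<cdot> \<eta> Z) = (\<epsilon> Y \<bullet> FAr F (FAr R w)) \<bullet> FAr F (\<eta> Z)"
    by simp
  also have "\<dots> = w \<bullet> (\<epsilon> (FOb F Z) \<bullet> FAr F (\<eta> Z))"
    by (subst counit_natural [OF assms(1), symmetric]) simp
  also have "\<dots> = w"
    by (simp add: triangle_F)
  finally show ?thesis .
qed

lemma unit_transpose:
  assumes "k \<in> Hom C X (FOb R Y)" "Y \<in> Ob D"
  shows "FAr R (\<epsilon> Y \<bullet> FAr F k) \<cdot> \<eta> X = k"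
proof -
  note [simp] = HomD [OF assms(1)] assms(2) C.Hom_Ob [OF assms(1)]
  have "FAr R (\<epsilon> Y \<bullet> FAr F k) \<cdot> \<eta> X = FAr R (\<epsilon> Y) \<cdot> (FAr R (FAr F k) \<cdot> \<eta> X)"
    by simp
  also have "\<dots> = (FAr R (\<epsilon> Y) \<cdot> \<eta> (FOb R Y)) \<cdot> k"
    using unit_natural [OF assms(1)] by simp
  also have "\<dots> = k"
    by (simp add: triangle_R)
  finally show ?thesis .
qed

lemma aug_surj:
  assumes "h \<in> Hom D (FOb F X) \<one>\<^bsub>D\<^esub>" "X \<in> Ob C"
  obtains k where "k \<in> Hom C X A" "e \<bullet> FAr F k = h"
  by (rule that [of "FAr R h \<cdot> \<eta> X"])
    (use counit_transpose [OF assms] assms in \<open>simp_all add: Hom_def\<close>)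

lemma aug_inj:
  assumes "k \<in> Hom C X A" "l \<in> Hom C X A" "e \<bullet> FAr F k = e \<bullet> FAr F l"
  shows "k = l"
  using unit_transpose [OF assms(1)] unit_transpose [OF assms(2)] assms(3) D.Unt_Ob by metis

lemma mul_Hom: "m \<in> Hom C (A \<otimes> A) A"
  and aug_mul: "e \<bullet> FAr F m = LUn D \<one>\<^bsub>D\<^esub> \<bullet> (e \<boxtimes>\<^bsub>D\<^esub> e) \<bullet> inv_arr D (F2 F A A)"
proof -
  let ?w = "LUn D \<one>\<^bsub>D\<^esub> \<bullet> (e \<boxtimes>\<^bsub>D\<^esub> e) \<bullet> inv_arr D (F2 F A A)"
  have m: "m = FAr R ?w \<cdot> \<eta> (A \<otimes> A)"
    by (simp add: induced_algebra_def adj_R2_def)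
  have w: "?w \<in> Hom D (FOb F (A \<otimes> A)) \<one>\<^bsub>D\<^esub>"
    by (simp add: Hom_def)
  show "m \<in> Hom C (A \<otimes> A) A"
    unfolding m using w by (simp add: Hom_def)
  show "e \<bullet> FAr F m = ?w"
    unfolding m by (rule counit_transpose [OF w]) simp
qed

lemma unit_Alg_Hom: "u \<in> Hom C \<one> A"
  and aug_unit: "e \<bullet> FAr F u = inv_arr D (F0 F)"
proof -
  have u: "u = FAr R (inv_arr D (F0 F)) \<cdot> \<eta> \<one>"
    by (simp add: induced_algebra_def adj_R0_def)
  have w: "inv_arr D (F0 F) \<in> Hom D (FOb F \<one>) \<one>\<^bsub>D\<^esub>"
    by (simp add: Hom_def)
  show "u \<in> Hom C \<one> A"
    unfolding u using w by (simp add: Hom_def)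
  show "e \<bullet> FAr F u = inv_arr D (F0 F)"
    unfolding u by (rule counit_transpose [OF w]) simp
qed

lemmas Alg_simps [simp] = HomD [OF mul_Hom] HomD [OF unit_Alg_Hom]

text \<open>
  The arrow \<open>F (Y \<otimes> A) \<rightarrow> F Y\<close> that forgets \<open>A\<close> by means of the augmentation. It is the adjoint transpose of the
  projection formula \<open>Y \<otimes> A \<cong> R (F Y)\<close>.
\<close>

definition q :: "'o \<Rightarrow> 'n" where
  "q Y = RUn D (FOb F Y) \<bullet> (Idn D (FOb F Y) \<boxtimes>\<^bsub>D\<^esub> e) \<bullet> inv_arr D (F2 F Y A)"

lemma q_simps [simp]:
  assumes "Y \<in> Ob C"
  shows "q Y \<in> Arr D" "Dom D (q Y) = FOb F (Y \<otimes> A)" "Cod D (q Y) = FOb F Y"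
  using assms by (simp_all add: q_def)

lemma q_nat:
  assumes "g \<in> Arr C" "Cod C g = Y"
  shows "q Y \<bullet> FAr F (g \<boxtimes> Idn C A) = FAr F g \<bullet> q (Dom C g)"
proof -
  note [simp] = assms
  have [simp]: "Y \<in> Ob C" using assms C.Cod_Ob by blast
  have 1: "inv_arr D (F2 F Y A) \<bullet> FAr F (g \<boxtimes> Idn C A)
    = (FAr F g \<boxtimes>\<^bsub>D\<^esub> Idn D (FOb F A)) \<bullet> inv_arr D (F2 F (Dom C g) A)"
    using inv_F2_nat [of g "Idn C A" Y A] by simp
  have 2: "RUn D (FOb F Y) \<bullet> (FAr F g \<boxtimes>\<^bsub>D\<^esub> Idn D \<one>\<^bsub>D\<^esub>) = FAr F g \<bullet> RUn D (FOb F (Dom C g))"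
    using D.RUn_nat [of "FAr F g" "FOb F Y"] by simp
  have "q Y \<bullet> FAr F (g \<boxtimes> Idn C A)
    = RUn D (FOb F Y) \<bullet> (Idn D (FOb F Y) \<boxtimes>\<^bsub>D\<^esub> e) \<bullet> (inv_arr D (F2 F Y A) \<bullet> FAr F (g \<boxtimes> Idn C A))"
    by (simp add: q_def)
  also have "\<dots> = (RUn D (FOb F Y) \<bullet> (FAr F g \<boxtimes>\<^bsub>D\<^esub> Idn D \<one>\<^bsub>D\<^esub>)) \<bullet> (Idn D (FOb F (Dom C g)) \<boxtimes>\<^bsub>D\<^esub> e) \<bullet> inv_arr D (F2 F (Dom C g) A)"
    unfolding 1 by (simp add: D.merge)
  also have "\<dots> = FAr F g \<bullet> q (Dom C g)"
    unfolding 2 by (simp add: q_def)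
  finally show ?thesis .
qed

lemma q_post:
  assumes "k \<in> Arr C" "Cod C k = A" "Z \<in> Ob C"
  shows "q Z \<bullet> FAr F (Idn C Z \<boxtimes> k)
    = RUn D (FOb F Z) \<bullet> (Idn D (FOb F Z) \<boxtimes>\<^bsub>D\<^esub> (e \<bullet> FAr F k)) \<bullet> inv_arr D (F2 F Z (Dom C k))"
proof -
  note [simp] = assms
  have 1: "inv_arr D (F2 F Z A) \<bullet> FAr F (Idn C Z \<boxtimes> k)
    = (Idn D (FOb F Z) \<boxtimes>\<^bsub>D\<^esub> FAr F k) \<bullet> inv_arr D (F2 F Z (Dom C k))"
    using inv_F2_nat [of "Idn C Z" k Z A] by simp
  have "q Z \<bullet> FAr F (Idn C Z \<boxtimes> k)
    = RUn D (FOb F Z) \<bullet> (Idn D (FOb F Z) \<boxtimes>\<^bsub>D\<^esub> e) \<bullet> (inv_arr D (F2 F Z A) \<bullet> FAr F (Idn C Z \<boxtimes> k))"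
    by (simp add: q_def)
  then show ?thesis
    unfolding 1 by (simp add: D.merge)
qed

lemma q_unit:
  assumes [simp]: "Z \<in> Ob C"
  shows "q Z \<bullet> FAr F (Idn C Z \<boxtimes> u) = FAr F (RUn C Z)"
  by (simp add: q_post aug_unit RUn_inv_F2)

text \<open>The action of \<open>A\<close> on the free module \<open>X \<otimes> A\<close>.\<close>

definition \<mu> :: "'o \<Rightarrow> 'm" where
  "\<mu> X = (Idn C X \<boxtimes> m) \<cdot> Asc C X A A"

lemma \<mu>_simps [simp]:
  assumes "X \<in> Ob C"
  shows "\<mu> X \<in> Arr C" "Dom C (\<mu> X) = (X \<otimes> A) \<otimes> A" "Cod C (\<mu> X) = X \<otimes> A"
  using assms by (simp_all add: \<mu>_def)

text \<open>
  The augmentation is multiplicative, so it makes no difference whether two factors \<open>A\<close> are multiplied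
  and then forgotten or forgotten one after the other.
\<close>

lemma q_mul:
  assumes [simp]: "X \<in> Ob C"
  shows "q X \<bullet> FAr F (\<mu> X) = q X \<bullet> q (X \<otimes> A)"
proof -
  let ?X = "FOb F X" and ?A = "FOb F A"
  let ?I = "Idn D (FOb F X)" and ?J = "Idn D (FOb F A)"
  have a: "Asc D ?X \<one>\<^bsub>D\<^esub> \<one>\<^bsub>D\<^esub> \<bullet> ((?I \<boxtimes>\<^bsub>D\<^esub> e) \<boxtimes>\<^bsub>D\<^esub> e) = (?I \<boxtimes>\<^bsub>D\<^esub> (e \<boxtimes>\<^bsub>D\<^esub> e)) \<bullet> Asc D ?X ?A ?A"
    using D.Asc_nat [of ?I e e ?X "\<one>\<^bsub>D\<^esub>" "\<one>\<^bsub>D\<^esub>"] by simp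
  have r: "RUn D ?X \<bullet> (q X \<boxtimes>\<^bsub>D\<^esub> Idn D \<one>\<^bsub>D\<^esub>) = q X \<bullet> RUn D (FOb F (X \<otimes> A))"
    using D.RUn_nat [of "q X" ?X] by simp
  have "q X \<bullet> FAr F (\<mu> X) = (q X \<bullet> FAr F (Idn C X \<boxtimes> m)) \<bullet> FAr F (Asc C X A A)"
    by (simp add: \<mu>_def)
  also have "\<dots> = RUn D ?X \<bullet> (?I \<boxtimes>\<^bsub>D\<^esub> LUn D \<one>\<^bsub>D\<^esub>) \<bullet> (?I \<boxtimes>\<^bsub>D\<^esub> (e \<boxtimes>\<^bsub>D\<^esub> e))
     \<bullet> ((?I \<boxtimes>\<^bsub>D\<^esub> inv_arr D (F2 F A A)) \<bullet> inv_arr D (F2 F X (A \<otimes> A)) \<bullet> FAr F (Asc C X A A))"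
    by (simp add: q_post aug_mul D.merge)
  also have "\<dots> = RUn D ?X \<bullet> (?I \<boxtimes>\<^bsub>D\<^esub> LUn D \<one>\<^bsub>D\<^esub>) \<bullet> ((?I \<boxtimes>\<^bsub>D\<^esub> (e \<boxtimes>\<^bsub>D\<^esub> e)) \<bullet> Asc D ?X ?A ?A)
     \<bullet> (inv_arr D (F2 F X A) \<boxtimes>\<^bsub>D\<^esub> ?J) \<bullet> inv_arr D (F2 F (X \<otimes> A) A)"
    by (subst inv_F2_Asc) simp_all
  also have "\<dots> = RUn D ?X \<bullet> ((?I \<boxtimes>\<^bsub>D\<^esub> LUn D \<one>\<^bsub>D\<^esub>) \<bullet> Asc D ?X \<one>\<^bsub>D\<^esub> \<one>\<^bsub>D\<^esub>) \<bullet> ((?I \<boxtimes>\<^bsub>D\<^esub> e) \<boxtimes>\<^bsub>D\<^esub> e)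
     \<bullet> (inv_arr D (F2 F X A) \<boxtimes>\<^bsub>D\<^esub> ?J) \<bullet> inv_arr D (F2 F (X \<otimes> A) A)"
    unfolding a [symmetric] by simp
  also have "\<dots> = (RUn D ?X \<bullet> (q X \<boxtimes>\<^bsub>D\<^esub> Idn D \<one>\<^bsub>D\<^esub>)) \<bullet> (Idn D (FOb F (X \<otimes> A)) \<boxtimes>\<^bsub>D\<^esub> e) \<bullet> inv_arr D (F2 F (X \<otimes> A) A)"
    by (subst D.triangle) (simp_all add: q_def D.merge)
  also have "\<dots> = q X \<bullet> q (X \<otimes> A)"
    unfolding r by (simp add: q_def)
  finally show ?thesis .
qed

text \<open>
  Together with \<open>q Y\<close>, the object \<open>Y \<otimes> A\<close> is a universal arrow from \<open>F\<close> to \<open>F Y\<close>: it represents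
  \<open>R (F Y)\<close>. To see this, a left dual \<open>L\<close> of \<open>Y\<close> is used to move \<open>Y\<close> to the other side, both in
  the source of \<open>F\<close> and, along the image of the dual pair, in the target. The present lemma says that the two
  transpositions turn composition with \<open>q Y\<close> into composition with the augmentation, so that \<open>q_inj\<close>
  and \<open>q_surj\<close> reduce to the universal property of the counit at \<open>\<one>\<close>.
\<close>

lemma q_lower:
  assumes d: "dual_pair C L Y ev coev" and g: "g \<in> Hom C X (Y \<otimes> A)"
  shows "lower D (inv_arr D (F0 F) \<bullet> FAr F ev \<bullet> F2 F L Y) (FOb F L) (FOb F Y) \<one>\<^bsub>D\<^esub>
      (inv_arr D (RUn D (FOb F Y)) \<bullet> (q Y \<bullet> FAr F g))
    = e \<bullet> FAr F (lower C ev L Y A g) \<bullet> F2 F L X"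
proof -
  note [simp] = dual_pairD(1-8) [OF d] HomD [OF g] C.Hom_Ob [OF g]
  let ?G = "inv_arr D (F2 F Y A) \<bullet> FAr F g"
  have G: "?G \<in> Hom D (FOb F X) (FOb F Y \<otimes>\<^bsub>D\<^esub> FOb F A)" by (simp add: Hom_def)
  have e: "e \<in> Hom D (FOb F A) \<one>\<^bsub>D\<^esub>" by (simp add: Hom_def)
  have "inv_arr D (RUn D (FOb F Y)) \<bullet> (q Y \<bullet> FAr F g) = (Idn D (FOb F Y) \<boxtimes>\<^bsub>D\<^esub> e) \<bullet> ?G"
    by (simp add: q_def)
  then show ?thesis
    using D.lower_post [OF functor_dual_pair [OF d] G e] functor_lower [OF d g] by simp
qed

lemma q_inj:
  assumes f: "f \<in> Hom C X (Y \<otimes> A)" and g: "g \<in> Hom C X (Y \<otimes> A)" and Y: "Y \<in> Ob C"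
    and eq: "q Y \<bullet> FAr F f = q Y \<bullet> FAr F g"
  shows "f = g"
proof -
  obtain L ev coev where d: "dual_pair C L Y ev coev"
    using C.left_dual [OF Y] by blast
  have A: "A \<in> Ob C" by simp
  note [simp] = dual_pairD(1-8) [OF d] C.Hom_Ob [OF f]
  note [simp] = HomD [OF C.lower_Hom [OF d f A]] HomD [OF C.lower_Hom [OF d g A]]
  have "(e \<bullet> FAr F (lower C ev L Y A f)) \<bullet> F2 F L X = (e \<bullet> FAr F (lower C ev L Y A g)) \<bullet> F2 F L X"
    using q_lower [OF d f] q_lower [OF d g] eq by simp
  then have "e \<bullet> FAr F (lower C ev L Y A f) = e \<bullet> FAr F (lower C ev L Y A g)"
    by (rule D.iso_cancel_right [rotated -1]) simp_all
  then have "lower C ev L Y A f = lower C ev L Y A g"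
    by (rule aug_inj [OF C.lower_Hom [OF d f A] C.lower_Hom [OF d g A]])
  then show ?thesis
    by (rule C.lower_inj [OF d f g A])
qed

lemma q_surj:
  assumes h: "h \<in> Hom D (FOb F X) (FOb F Y)" and X: "X \<in> Ob C" and Y: "Y \<in> Ob C"
  obtains g where "g \<in> Hom C X (Y \<otimes> A)" "q Y \<bullet> FAr F g = h"
proof -
  obtain L ev coev where d: "dual_pair C L Y ev coev"
    using C.left_dual [OF Y] by blast
  have A: "A \<in> Ob C" by simp
  note [simp] = dual_pairD(1-8) [OF d] HomD [OF h] X
  let ?lo = "lower D (inv_arr D (F0 F) \<bullet> FAr F ev \<bullet> F2 F L Y) (FOb F L) (FOb F Y) \<one>\<^bsub>D\<^esub>"
  let ?r = "inv_arr D (RUn D (FOb F Y))"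
  note d' = functor_dual_pair [OF d]
  have rh: "?r \<bullet> h \<in> Hom D (FOb F X) (FOb F Y \<otimes>\<^bsub>D\<^esub> \<one>\<^bsub>D\<^esub>)" by (simp add: Hom_def)
  have t: "?lo (?r \<bullet> h) \<in> Hom D (FOb F L \<otimes>\<^bsub>D\<^esub> FOb F X) \<one>\<^bsub>D\<^esub>"
    by (rule D.lower_Hom [OF d' rh]) simp
  note [simp] = HomD [OF t]
  have "?lo (?r \<bullet> h) \<bullet> inv_arr D (F2 F L X) \<in> Hom D (FOb F (L \<otimes> X)) \<one>\<^bsub>D\<^esub>"
    by (simp add: Hom_def)
  then obtain k where k: "k \<in> Hom C (L \<otimes> X) A"
    and ek: "e \<bullet> FAr F k = ?lo (?r \<bullet> h) \<bullet> inv_arr D (F2 F L X)"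
    by (rule aug_surj) simp
  note [simp] = HomD [OF k]
  define g where "g = upper C coev L Y X k"
  have g: "g \<in> Hom C X (Y \<otimes> A)"
    unfolding g_def by (rule C.upper_Hom [OF d k X])
  note [simp] = HomD [OF g]
  have qg: "?r \<bullet> (q Y \<bullet> FAr F g) \<in> Hom D (FOb F X) (FOb F Y \<otimes>\<^bsub>D\<^esub> \<one>\<^bsub>D\<^esub>)" by (simp add: Hom_def)
  have "?lo (?r \<bullet> (q Y \<bullet> FAr F g)) = e \<bullet> FAr F k \<bullet> F2 F L X"
    using q_lower [OF d g] C.lower_upper [OF d k X] by (simp add: g_def)
  also have "\<dots> = (e \<bullet> FAr F k) \<bullet> F2 F L X"
    by simp
  also have "\<dots> = ?lo (?r \<bullet> h)"
    unfolding ek by simp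
  finally have "?r \<bullet> (q Y \<bullet> FAr F g) = ?r \<bullet> h"
    by (rule D.lower_inj [OF d' qg rh, rotated]) simp
  then have "q Y \<bullet> FAr F g = h"
    by (rule D.iso_cancel_left [rotated -1]) simp_all
  then show ?thesis
    by (rule that [OF g])
qed

end

section \<open>Direct sums and additive functors\<close>

context preadditive_category
begin

lemma dsum_map_retract:
  assumes "i \<in> Hom C X P" "j \<in> Hom C Y P" "p \<in> Hom C P X" "q \<in> Hom C P Y" "i \<cdot> p \<oplus> j \<cdot> q = Idn C P"
    and "i' \<in> Hom C X' P'" "j' \<in> Hom C Y' P'" "p' \<in> Hom C P' X'" "q' \<in> Hom C P' Y'"
    and "p' \<cdot> i' = Idn C X'" "q' \<cdot> j' = Idn C Y'" "p' \<cdot> j' = Zer C Y' X'" "q' \<cdot> i' = Zer C X' Y'"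
    and "a \<in> Hom C X X'" "a' \<in> Hom C X' X" "a' \<cdot> a = Idn C X"
    and "b \<in> Hom C Y Y'" "b' \<in> Hom C Y' Y" "b' \<cdot> b = Idn C Y"
  shows "(i \<cdot> a' \<cdot> p' \<oplus> j \<cdot> b' \<cdot> q') \<cdot> (i' \<cdot> a \<cdot> p \<oplus> j' \<cdot> b \<cdot> q) = Idn C P"
proof -
  note H = assms(1-4,6-9,14,15,17,18)
  note [simp] = HomD [OF assms(1)] HomD [OF assms(2)] HomD [OF assms(3)] HomD [OF assms(4)]
    HomD [OF assms(6)] HomD [OF assms(7)] HomD [OF assms(8)] HomD [OF assms(9)]
    HomD [OF assms(14)] HomD [OF assms(15)] HomD [OF assms(17)] HomD [OF assms(18)]
    Hom_Ob [OF assms(1)] Hom_Ob [OF assms(2)] Hom_Ob [OF assms(6)] Hom_Ob [OF assms(7)]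
  let ?N = "i \<cdot> a' \<cdot> p' \<oplus> j \<cdot> b' \<cdot> q'"
  have n: "i \<cdot> a' \<cdot> p' \<in> Hom C P' P" "j \<cdot> b' \<cdot> q' \<in> Hom C P' P"
    "i' \<cdot> a \<cdot> p \<in> Hom C P P'" "j' \<cdot> b \<cdot> q \<in> Hom C P P'"
    by (simp_all add: Hom_def)
  have i': "?N \<cdot> i' = i \<cdot> a'"
    using Add_Comp [OF assms(6) n(1,2)] assms(10,13) Add_Zer [of "i \<cdot> a'" X' P] by (simp add: Hom_def)
  have j': "?N \<cdot> j' = j \<cdot> b'"
    using Add_Comp [OF assms(7) n(1,2)] assms(11,12) Zer_Add [of "j \<cdot> b'" Y' P] by (simp add: Hom_def)
  have "?N \<cdot> (i' \<cdot> a \<cdot> p \<oplus> j' \<cdot> b \<cdot> q) = (?N \<cdot> i') \<cdot> a \<cdot> p \<oplus> (?N \<cdot> j') \<cdot> b \<cdot> q"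
    using Comp_Add [OF n(3,4), of ?N P] by (simp add: Hom_def)
  also have "\<dots> = i \<cdot> (a' \<cdot> a) \<cdot> p \<oplus> j \<cdot> (b' \<cdot> b) \<cdot> q"
    unfolding i' j' by simp
  also have "\<dots> = Idn C P"
    unfolding assms(16,19) using assms(5) by simp
  finally show ?thesis .
qed

lemma dsum_isomorphic:
  assumes P: "is_dsum C X Y P" and P': "is_dsum C X' Y' P'"
    and X: "isomorphic C X X'" and Y: "isomorphic C Y Y'"
  shows "isomorphic C P P'"
proof -
  obtain i j p q where d: "i \<in> Hom C X P" "j \<in> Hom C Y P" "p \<in> Hom C P X" "q \<in> Hom C P Y"
    "p \<cdot> i = Idn C X" "q \<cdot> j = Idn C Y" "p \<cdot> j = Zer C Y X" "q \<cdot> i = Zer C X Y"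
    "i \<cdot> p \<oplus> j \<cdot> q = Idn C P"
    using P unfolding is_dsum_def by blast
  obtain i' j' p' q' where d': "i' \<in> Hom C X' P'" "j' \<in> Hom C Y' P'" "p' \<in> Hom C P' X'" "q' \<in> Hom C P' Y'"
    "p' \<cdot> i' = Idn C X'" "q' \<cdot> j' = Idn C Y'" "p' \<cdot> j' = Zer C Y' X'" "q' \<cdot> i' = Zer C X' Y'"
    "i' \<cdot> p' \<oplus> j' \<cdot> q' = Idn C P'"
    using P' unfolding is_dsum_def by blast
  have *: "\<exists>f g. f \<in> Hom C U V \<and> g \<in> Hom C V U \<and> g \<cdot> f = Idn C U \<and> f \<cdot> g = Idn C V"
    if iso: "isomorphic C U V" for U V
  proof -
    obtain f where f: "f \<in> Hom C U V" "is_iso C f"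
      using iso by (auto simp: isomorphic_def)
    then show ?thesis
      using inv_arr_simps [OF f(2)] HomD [OF f(1)] by (intro exI [of _ f] exI [of _ "inv_arr C f"]) (simp add: Hom_def)
  qed
  obtain a a' where a: "a \<in> Hom C X X'" "a' \<in> Hom C X' X" "a' \<cdot> a = Idn C X" "a \<cdot> a' = Idn C X'"
    using * [OF X] by blast
  obtain b b' where b: "b \<in> Hom C Y Y'" "b' \<in> Hom C Y' Y" "b' \<cdot> b = Idn C Y" "b \<cdot> b' = Idn C Y'"
    using * [OF Y] by blast
  have "i' \<cdot> a \<cdot> p \<oplus> j' \<cdot> b \<cdot> q \<in> Hom C P P'" "i \<cdot> a' \<cdot> p' \<oplus> j \<cdot> b' \<cdot> q' \<in> Hom C P' P"
    by (intro Add_Hom Comp_Hom [OF Comp_Hom]; fact d d' a b)+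
  then show ?thesis
    unfolding isomorphic_def
    using isoI(1) [OF _ _ dsum_map_retract [OF d(1-4,9) d'(1-8) a(1-3) b(1-3)]
        dsum_map_retract [OF d'(1-4,9) d(1-8) a(2,1,4) b(2,1,4)]] by blast
qed

lemma zero_isomorphic:
  assumes z: "is_zero C X" "is_zero C Y"
  shows "isomorphic C X Y"
proof -
  have [simp]: "X \<in> Ob C" "Y \<in> Ob C"
    using z by (auto simp: is_zero_def)
  have "Zer C X Y \<in> Hom C X Y" "Zer C Y X \<in> Hom C Y X"
    by (simp_all add: Hom_def)
  moreover have "Zer C Y X \<cdot> Zer C X Y = Idn C X" "Zer C X Y \<cdot> Zer C Y X = Idn C Y"
    using z by (simp_all add: is_zero_iff)
  ultimately show ?thesis
    unfolding isomorphic_def using isoI(1) by blast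
qed

lemma power_isomorphic:
  "is_power C X n P \<Longrightarrow> is_power C X' n P' \<Longrightarrow> isomorphic C X X' \<Longrightarrow> isomorphic C P P'"
proof (induction n arbitrary: P P')
  case 0
  then show ?case using zero_isomorphic by simp
next
  case (Suc n)
  then show ?case using dsum_isomorphic by auto
qed

end

lemma (in abelian_category) power_exists:
  assumes "X \<in> Ob C"
  shows "\<exists>P. is_power C X n P"
proof (induction n)
  case 0
  show ?case using has_zero by simp
next
  case (Suc n)
  then obtain Q where Q: "is_power C X n Q" ..
  have "Q \<in> Ob C"
    using Q Hom_Ob by (cases n) (auto simp: is_zero_def is_dsum_def)
  then show ?case
    using Q has_dsum assms by fastforce
qed

locale additive_functor = is_functor C D F + C: preadditive_category C + D: preadditive_category D
  for C :: "('o, 'm, 'y) preadd_cat_scheme" and D :: "('p, 'n, 'z) preadd_cat_scheme"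
    and F :: "('o, 'm, 'p, 'n, 'w) fctr_scheme" +
  assumes FAr_plus: "\<lbrakk>f \<in> Hom C X Y; g \<in> Hom C X Y\<rbrakk>
      \<Longrightarrow> FAr F (f \<oplus>\<^bsub>C\<^esub> g) = FAr F f \<oplus>\<^bsub>D\<^esub> FAr F g"
begin

lemma FAr_Zer:
  assumes "X \<in> Ob C" "Y \<in> Ob C"
  shows "FAr F (Zer C X Y) = Zer D (FOb F X) (FOb F Y)"
proof (rule D.Add_self_eq_Zer)
  have z: "Zer C X Y \<in> Hom C X Y" using C.Zer_Hom assms by simp
  show "FAr F (Zer C X Y) \<in> Hom D (FOb F X) (FOb F Y)"
    by (rule FAr_Hom [OF z])
  show "FAr F (Zer C X Y) \<oplus>\<^bsub>D\<^esub> FAr F (Zer C X Y) = FAr F (Zer C X Y)"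
    using FAr_plus [OF z z] C.Zer_Add [OF z] by simp
qed

lemma FOb_zero: "is_zero C X \<Longrightarrow> is_zero D (FOb F X)"
  using FAr_Zer [of X X] FAr_Idn [of X] by (simp add: C.is_zero_iff D.is_zero_iff)

lemma FOb_dsum:
  assumes "is_dsum C X Y P"
  shows "is_dsum D (FOb F X) (FOb F Y) (FOb F P)"
proof -
  obtain i j p q where d: "i \<in> Hom C X P" "j \<in> Hom C Y P" "p \<in> Hom C P X" "q \<in> Hom C P Y"
    "p \<cdot>\<^bsub>C\<^esub> i = Idn C X" "q \<cdot>\<^bsub>C\<^esub> j = Idn C Y" "p \<cdot>\<^bsub>C\<^esub> j = Zer C Y X" "q \<cdot>\<^bsub>C\<^esub> i = Zer C X Y"
    "(i \<cdot>\<^bsub>C\<^esub> p) \<oplus>\<^bsub>C\<^esub> (j \<cdot>\<^bsub>C\<^esub> q) = Idn C P"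
    using assms unfolding is_dsum_def by blast
  have Ob: "X \<in> Ob C" "Y \<in> Ob C" "P \<in> Ob C"
    using C.Hom_Ob [OF d(1)] C.Hom_Ob [OF d(2)] by auto
  have "FAr F p \<cdot>\<^bsub>D\<^esub> FAr F i = Idn D (FOb F X)" "FAr F q \<cdot>\<^bsub>D\<^esub> FAr F j = Idn D (FOb F Y)"
    "FAr F p \<cdot>\<^bsub>D\<^esub> FAr F j = Zer D (FOb F Y) (FOb F X)" "FAr F q \<cdot>\<^bsub>D\<^esub> FAr F i = Zer D (FOb F X) (FOb F Y)"
    "(FAr F i \<cdot>\<^bsub>D\<^esub> FAr F p) \<oplus>\<^bsub>D\<^esub> (FAr F j \<cdot>\<^bsub>D\<^esub> FAr F q) = Idn D (FOb F P)"
    using FAr_Comp [OF d(1,3)] FAr_Comp [OF d(2,4)] FAr_Comp [OF d(2,3)] FAr_Comp [OF d(1,4)]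
      FAr_Comp [OF d(3,1)] FAr_Comp [OF d(4,2)] FAr_plus [OF C.Comp_Hom [OF d(3,1)] C.Comp_Hom [OF d(4,2)]]
      d(5-9) FAr_Zer FAr_Idn Ob by simp_all
  then show ?thesis
    unfolding is_dsum_def using FAr_Hom [OF d(1)] FAr_Hom [OF d(2)] FAr_Hom [OF d(3)] FAr_Hom [OF d(4)] by blast
qed

lemma FOb_power: "is_power C X n P \<Longrightarrow> is_power D (FOb F X) n (FOb F P)"
proof (induction n arbitrary: P)
  case 0
  then show ?case using FOb_zero by simp
next
  case (Suc n)
  then obtain Q where Q: "is_power C X n Q" "is_dsum C Q X P"
    by auto
  show ?case
    using Suc.IH [OF Q(1)] FOb_dsum [OF Q(2)] by auto
qed

end

lemma (in exact_functor) additive: "additive_functor C D F"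
  by unfold_locales (rule FAr_Add)

section \<open>Free modules\<close>

lemma mod_cat_Hom:
  "Hom (mod_cat C A) M N = {(M, f, N) | f. is_right_module C A M \<and> is_right_module C A N \<and>
     f \<in> Hom C (fst M) (fst N) \<and> f \<cdot>\<^bsub>C\<^esub> snd M = snd N \<cdot>\<^bsub>C\<^esub> (f \<boxtimes>\<^bsub>C\<^esub> Idn C (aob A))}"
  unfolding Hom_def by (auto simp: mod_cat_def Hom_def)

lemma mod_cat_simps [simp]:
  "Ob (mod_cat C A) = {M. is_right_module C A M}" "Idn (mod_cat C A) M = (M, Idn C (fst M), M)"
  "Comp (mod_cat C A) (M', g, N') (M, f, N) = (M, g \<cdot>\<^bsub>C\<^esub> f, N')"
  "Zer (mod_cat C A) M N = (M, Zer C (fst M) (fst N), N)"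
  "Add (mod_cat C A) (M, f, N) (M', g, N'') = (M, f \<oplus>\<^bsub>C\<^esub> g, N)"
  "Dom (mod_cat C A) (M, f, N) = M" "Cod (mod_cat C A) (M, f, N) = N"
  by (simp_all add: mod_cat_def)

lemma right_moduleD:
  assumes "is_right_module C A M"
  shows "fst M \<in> Ob C" "snd M \<in> Arr C" "Dom C (snd M) = fst M \<otimes>\<^bsub>C\<^esub> aob A" "Cod C (snd M) = fst M"
  using assms by (auto simp: is_right_module_def Hom_def)

context tensor_category
begin

lemma mod_cat_category:
  assumes A [simp]: "aob A \<in> Ob C"
  shows "category (mod_cat C A)"
proof
  fix f assume f: "f \<in> Arr (mod_cat C A)"
  show "Dom (mod_cat C A) f \<in> Ob (mod_cat C A)" "Cod (mod_cat C A) f \<in> Ob (mod_cat C A)"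
    using f by (auto simp: mod_cat_def)
next
  fix M assume "M \<in> Ob (mod_cat C A)"
  then have M: "is_right_module C A M" by simp
  note [simp] = right_moduleD [OF M]
  show "Idn (mod_cat C A) M \<in> Hom (mod_cat C A) M M"
    using M by (simp add: mod_cat_Hom Hom_def [of C])
next
  fix f g L M N
  assume "f \<in> Hom (mod_cat C A) L M" "g \<in> Hom (mod_cat C A) M N"
  then obtain a b where ab: "f = (L, a, M)" "g = (M, b, N)" "is_right_module C A L" "is_right_module C A M"
    "is_right_module C A N" "a \<in> Hom C (fst L) (fst M)" "b \<in> Hom C (fst M) (fst N)"
    "a \<cdot> snd L = snd M \<cdot> (a \<boxtimes> Idn C (aob A))" "b \<cdot> snd M = snd N \<cdot> (b \<boxtimes> Idn C (aob A))"
    by (auto simp: mod_cat_Hom)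
  note [simp] = HomD [OF ab(6)] HomD [OF ab(7)] right_moduleD [OF ab(3)] right_moduleD [OF ab(4)] right_moduleD [OF ab(5)]
  have "(b \<cdot> a) \<cdot> snd L = (b \<cdot> snd M) \<cdot> (a \<boxtimes> Idn C (aob A))"
    using ab(8) by simp
  also have "\<dots> = snd N \<cdot> ((b \<cdot> a) \<boxtimes> Idn C (aob A))"
    unfolding ab(9) by (simp add: merge)
  finally show "g \<cdot>\<^bsub>mod_cat C A\<^esub> f \<in> Hom (mod_cat C A) L N"
    using ab(1-5) by (simp add: mod_cat_Hom Hom_def [of C])
next
  fix f L M
  assume "f \<in> Hom (mod_cat C A) L M"
  then show "f \<cdot>\<^bsub>mod_cat C A\<^esub> Idn (mod_cat C A) L = f" "Idn (mod_cat C A) M \<cdot>\<^bsub>mod_cat C A\<^esub> f = f"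
    by (auto simp: mod_cat_Hom Hom_def [of C])
next
  fix f g h K L M N
  assume "f \<in> Hom (mod_cat C A) K L" "g \<in> Hom (mod_cat C A) L M" "h \<in> Hom (mod_cat C A) M N"
  then show "(h \<cdot>\<^bsub>mod_cat C A\<^esub> g) \<cdot>\<^bsub>mod_cat C A\<^esub> f = h \<cdot>\<^bsub>mod_cat C A\<^esub> (g \<cdot>\<^bsub>mod_cat C A\<^esub> f)"
    by (auto simp: mod_cat_Hom Comp_assoc)
qed

lemma mod_cat_preadditive:
  assumes A [simp]: "aob A \<in> Ob C"
  shows "preadditive_category (mod_cat C A)"
proof -
  interpret M: category "mod_cat C A" by (rule mod_cat_category [OF A])
  have zero: "(M, Zer C (fst M) (fst N), N) \<in> Hom (mod_cat C A) M N"
    if "is_right_module C A M" "is_right_module C A N" for M N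
  proof -
    note [simp] = right_moduleD [OF that(1)] right_moduleD [OF that(2)]
    have "Zer C (fst M) (fst N) \<boxtimes> Idn C (aob A) = Zer C (fst M \<otimes> aob A) (fst N \<otimes> aob A)"
      by (rule Zer_TAr [OF Idn_Hom]) simp_all
    then show ?thesis
      using that Zer_Hom by (simp add: mod_cat_Hom)
  qed
  have add: "(M, a \<oplus> b, N) \<in> Hom (mod_cat C A) M N"
    if "(M, a, N) \<in> Hom (mod_cat C A) M N" "(M, b, N) \<in> Hom (mod_cat C A) M N" for M N a b
  proof -
    have ab: "a \<in> Hom C (fst M) (fst N)" "b \<in> Hom C (fst M) (fst N)"
      "a \<cdot> snd M = snd N \<cdot> (a \<boxtimes> Idn C (aob A))" "b \<cdot> snd M = snd N \<cdot> (b \<boxtimes> Idn C (aob A))"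
      "is_right_module C A M" "is_right_module C A N"
      using that by (auto simp: mod_cat_Hom)
    have r: "snd M \<in> Hom C (fst M \<otimes> aob A) (fst M)" "snd N \<in> Hom C (fst N \<otimes> aob A) (fst N)"
      using ab(5,6) by (auto simp: Hom_def right_moduleD)
    have I: "Idn C (aob A) \<in> Hom C (aob A) (aob A)" by (rule Idn_Hom) simp
    have "(a \<oplus> b) \<cdot> snd M = snd N \<cdot> ((a \<oplus> b) \<boxtimes> Idn C (aob A))"
      using Add_Comp [OF r(1) ab(1,2)] Add_TAr [OF ab(1,2) I]
        Comp_Add [OF TAr_Hom [OF ab(1) I] TAr_Hom [OF ab(2) I] r(2)] ab(3,4) by simp
    then show ?thesis
      using ab Add_Hom by (simp add: mod_cat_Hom)
  qed
  have Hom_elim: "\<exists>a. f = (M, a, N) \<and> a \<in> Hom C (fst M) (fst N) \<and> is_right_module C A M \<and> is_right_module C A N"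
    if "f \<in> Hom (mod_cat C A) M N" for f M N
    using that by (auto simp: mod_cat_Hom)
  show ?thesis
  proof
    fix M N assume "M \<in> Ob (mod_cat C A)" "N \<in> Ob (mod_cat C A)"
    then show "Zer (mod_cat C A) M N \<in> Hom (mod_cat C A) M N"
      using zero by simp
  next
    fix f g M N assume f: "f \<in> Hom (mod_cat C A) M N" and g: "g \<in> Hom (mod_cat C A) M N"
    obtain a b where "f = (M, a, N)" "g = (M, b, N)"
      using Hom_elim [OF f] Hom_elim [OF g] by blast
    then show "f \<oplus>\<^bsub>mod_cat C A\<^esub> g \<in> Hom (mod_cat C A) M N"
      using add f g by simp
  next
    fix f g h M N
    assume f: "f \<in> Hom (mod_cat C A) M N" and g: "g \<in> Hom (mod_cat C A) M N" and h: "h \<in> Hom (mod_cat C A) M N"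
    show "(f \<oplus>\<^bsub>mod_cat C A\<^esub> g) \<oplus>\<^bsub>mod_cat C A\<^esub> h = f \<oplus>\<^bsub>mod_cat C A\<^esub> (g \<oplus>\<^bsub>mod_cat C A\<^esub> h)"
      using Hom_elim [OF f] Hom_elim [OF g] Hom_elim [OF h] Add_assoc by fastforce
  next
    fix f g M N
    assume f: "f \<in> Hom (mod_cat C A) M N" and g: "g \<in> Hom (mod_cat C A) M N"
    show "f \<oplus>\<^bsub>mod_cat C A\<^esub> g = g \<oplus>\<^bsub>mod_cat C A\<^esub> f"
      using Hom_elim [OF f] Hom_elim [OF g] Add_commute by fastforce
  next
    fix f M N
    assume f: "f \<in> Hom (mod_cat C A) M N"
    obtain a where a: "f = (M, a, N)" "a \<in> Hom C (fst M) (fst N)" "is_right_module C A M" "is_right_module C A N"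
      using Hom_elim [OF f] by blast
    show "Zer (mod_cat C A) M N \<oplus>\<^bsub>mod_cat C A\<^esub> f = f"
      using a Zer_Add by simp
    have Ia: "Idn C (fst M) \<in> Hom C (fst M) (fst M)" "Idn C (aob A) \<in> Hom C (aob A) (aob A)"
      using Idn_Hom right_moduleD(1) [OF a(3)] by auto
    have r: "snd M \<in> Hom C (fst M \<otimes> aob A) (fst M)" "snd N \<in> Hom C (fst N \<otimes> aob A) (fst N)"
      using a(3,4) by (auto simp: Hom_def right_moduleD)
    \<comment> \<open>The additive inverse is multiplication by \<open>-1\<close>, hence again linear over the algebra.\<close>
    let ?n = "(-1) \<odot> a"
    have n: "?n \<in> Hom C (fst M) (fst N)"
      by (rule Scl_Hom [OF a(2)])
    have eq: "a \<cdot> snd M = snd N \<cdot> (a \<boxtimes> Idn C (aob A))"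
      using f a(1) by (simp add: mod_cat_Hom)
    have "?n \<cdot> snd M = snd N \<cdot> (?n \<boxtimes> Idn C (aob A))"
      using Scl_Comp [OF r(1) a(2)] Scl_TAr [OF a(2) Ia(2)] Comp_Scl [OF TAr_Hom [OF a(2) Ia(2)] r(2)] eq by simp
    then have nH: "(M, ?n, N) \<in> Hom (mod_cat C A) M N"
      using a n by (simp add: mod_cat_Hom)
    have "a \<oplus> ?n = Zer C (fst M) (fst N)"
    proof -
      have "a \<oplus> ?n = 0 \<odot> a"
        using plus_Scl [OF a(2), of 1 "-1"] one_Scl [OF a(2)] by simp
      also have "\<dots> = Zer C (fst M) (fst N)"
        using Add_self_eq_Zer [OF Scl_Hom [OF a(2), of 0]] plus_Scl [OF a(2), of 0 0] by simp
      finally show ?thesis .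
    qed
    then show "\<exists>g\<in>Hom (mod_cat C A) M N. f \<oplus>\<^bsub>mod_cat C A\<^esub> g = Zer (mod_cat C A) M N"
      using nH a(1) by (intro bexI [OF _ nH]) simp
  next
    fix f g h L M N
    assume f: "f \<in> Hom (mod_cat C A) L M" and g: "g \<in> Hom (mod_cat C A) L M" and h: "h \<in> Hom (mod_cat C A) M N"
    show "h \<cdot>\<^bsub>mod_cat C A\<^esub> (f \<oplus>\<^bsub>mod_cat C A\<^esub> g) = (h \<cdot>\<^bsub>mod_cat C A\<^esub> f) \<oplus>\<^bsub>mod_cat C A\<^esub> (h \<cdot>\<^bsub>mod_cat C A\<^esub> g)"
      using Hom_elim [OF f] Hom_elim [OF g] Hom_elim [OF h] Comp_Add by fastforce
  next
    fix f g h L M N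
    assume f: "f \<in> Hom (mod_cat C A) L M" and g: "g \<in> Hom (mod_cat C A) M N" and h: "h \<in> Hom (mod_cat C A) M N"
    show "(g \<oplus>\<^bsub>mod_cat C A\<^esub> h) \<cdot>\<^bsub>mod_cat C A\<^esub> f = (g \<cdot>\<^bsub>mod_cat C A\<^esub> f) \<oplus>\<^bsub>mod_cat C A\<^esub> (h \<cdot>\<^bsub>mod_cat C A\<^esub> f)"
      using Hom_elim [OF f] Hom_elim [OF g] Hom_elim [OF h] Add_Comp by fastforce
  qed
qed

lemma is_power_trivial: "is_power C X n P \<Longrightarrow> is_trivial C X \<Longrightarrow> is_trivial C P"
proof (induction n arbitrary: P)
  case 0
  then show ?case using trivial_zero by simp
next
  case (Suc n)
  then show ?case using trivial_dsum by auto
qed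

end

context tensor_adjunction
begin

lemma free_module_simp: "free_module C Alg X = (X \<otimes> A, \<mu> X)"
  by (simp add: free_module_def \<mu>_def)

lemma q_\<mu>_TAr:
  assumes "f \<in> Hom C X (Y \<otimes> A)" "Y \<in> Ob C"
  shows "q Y \<bullet> FAr F (\<mu> Y \<cdot> (f \<boxtimes> Idn C A)) = q Y \<bullet> FAr F f \<bullet> q X"
proof -
  note [simp] = assms(2) HomD [OF assms(1)] C.Hom_Ob [OF assms(1)]
  have "q Y \<bullet> FAr F (\<mu> Y \<cdot> (f \<boxtimes> Idn C A)) = (q Y \<bullet> FAr F (\<mu> Y)) \<bullet> FAr F (f \<boxtimes> Idn C A)"
    by simp
  also have "\<dots> = q Y \<bullet> (q (Y \<otimes> A) \<bullet> FAr F (f \<boxtimes> Idn C A))"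
    unfolding q_mul [OF assms(2)] by simp
  also have "\<dots> = q Y \<bullet> FAr F f \<bullet> q X"
    by (subst q_nat) simp_all
  finally show ?thesis .
qed

text \<open>The module axioms need no coherence argument: both sides of each axiom are arrows into a free
  object, so they may be compared after composing with \<open>q\<close>.\<close>

lemma free_right_module:
  assumes [simp]: "X \<in> Ob C"
  shows "is_right_module C Alg (free_module C Alg X)"
proof -
  have \<mu>: "\<mu> X \<in> Hom C ((X \<otimes> A) \<otimes> A) (X \<otimes> A)"
    by (simp add: Hom_def)
  have "\<mu> X \<cdot> (\<mu> X \<boxtimes> Idn C A) = \<mu> X \<cdot> \<mu> (X \<otimes> A)"
  proof (rule q_inj)
    have "q X \<bullet> FAr F (\<mu> X \<cdot> (\<mu> X \<boxtimes> Idn C A)) = (q X \<bullet> FAr F (\<mu> X)) \<bullet> q ((X \<otimes> A) \<otimes> A)"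
      using q_\<mu>_TAr [OF \<mu>] by simp
    also have "\<dots> = q X \<bullet> (q (X \<otimes> A) \<bullet> q ((X \<otimes> A) \<otimes> A))"
      by (subst q_mul) simp_all
    also have "\<dots> = q X \<bullet> (q (X \<otimes> A) \<bullet> FAr F (\<mu> (X \<otimes> A)))"
      by (subst q_mul) simp_all
    also have "\<dots> = (q X \<bullet> FAr F (\<mu> X)) \<bullet> FAr F (\<mu> (X \<otimes> A))"
      by (subst q_mul [of X]) simp_all
    finally show "q X \<bullet> FAr F (\<mu> X \<cdot> (\<mu> X \<boxtimes> Idn C A)) = q X \<bullet> FAr F (\<mu> X \<cdot> \<mu> (X \<otimes> A))"
      by simp
  qed (simp_all add: Hom_def)
  moreover have "\<mu> X \<cdot> (Idn C (X \<otimes> A) \<boxtimes> u) = RUn C (X \<otimes> A)"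
  proof (rule q_inj)
    have "q X \<bullet> FAr F (\<mu> X \<cdot> (Idn C (X \<otimes> A) \<boxtimes> u))
      = (q X \<bullet> FAr F (\<mu> X)) \<bullet> FAr F (Idn C (X \<otimes> A) \<boxtimes> u)"
      by simp
    also have "\<dots> = q X \<bullet> (q (X \<otimes> A) \<bullet> FAr F (Idn C (X \<otimes> A) \<boxtimes> u))"
      by (subst q_mul) simp_all
    also have "\<dots> = q X \<bullet> FAr F (RUn C (X \<otimes> A))"
      by (subst q_unit) simp_all
    finally show "q X \<bullet> FAr F (\<mu> X \<cdot> (Idn C (X \<otimes> A) \<boxtimes> u)) = q X \<bullet> FAr F (RUn C (X \<otimes> A))" .
  qed (simp_all add: Hom_def)
  ultimately show ?thesis
    using \<mu> by (simp add: free_module_simp is_right_module_def \<mu>_def [of "X \<otimes> A"])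
qed

text \<open>The arrow \<open>X \<rightarrow> X \<otimes> A\<close> that inserts the unit of \<open>A\<close>; it freely generates the module \<open>X \<otimes> A\<close>.\<close>

definition \<iota> :: "'o \<Rightarrow> 'm" where
  "\<iota> X = (Idn C X \<boxtimes> u) \<cdot> inv_arr C (RUn C X)"

lemma \<iota>_simps [simp]:
  assumes "X \<in> Ob C"
  shows "\<iota> X \<in> Arr C" "Dom C (\<iota> X) = X" "Cod C (\<iota> X) = X \<otimes> A"
  using assms by (simp_all add: \<iota>_def)

lemma q_\<iota>:
  assumes [simp]: "X \<in> Ob C"
  shows "q X \<bullet> FAr F (\<iota> X) = Idn D (FOb F X)"
proof -
  have "q X \<bullet> FAr F (\<iota> X) = (q X \<bullet> FAr F (Idn C X \<boxtimes> u)) \<bullet> FAr F (inv_arr C (RUn C X))"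
    by (simp add: \<iota>_def)
  also have "\<dots> = FAr F (RUn C X \<cdot> inv_arr C (RUn C X))"
    by (subst q_unit) (simp_all del: C.inv_arr_simps(5))
  finally show ?thesis by simp
qed

lemma \<mu>_\<iota>:
  assumes [simp]: "X \<in> Ob C"
  shows "\<mu> X \<cdot> (\<iota> X \<boxtimes> Idn C A) = Idn C (X \<otimes> A)"
proof (rule q_inj)
  have "\<iota> X \<in> Hom C X (X \<otimes> A)" by (simp add: Hom_def)
  then have "q X \<bullet> FAr F (\<mu> X \<cdot> (\<iota> X \<boxtimes> Idn C A)) = (q X \<bullet> FAr F (\<iota> X)) \<bullet> q X"
    using q_\<mu>_TAr [of "\<iota> X" X X] by simp
  also have "\<dots> = q X"
    unfolding q_\<iota> [OF assms] by simp
  finally show "q X \<bullet> FAr F (\<mu> X \<cdot> (\<iota> X \<boxtimes> Idn C A)) = q X \<bullet> FAr F (Idn C (X \<otimes> A))"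
    by simp
qed (simp_all add: Hom_def)

text \<open>
  A module arrow \<open>f\<close> is the linear extension of its restriction \<open>f \<cdot> \<iota> X\<close>, so by \<open>q_mul\<close> the image of \<open>f\<close>
  under \<open>F\<close>, followed by \<open>q Y\<close>, forgets the factor \<open>A\<close> of its source.
\<close>

lemma free_module_arrow_to_D:
  assumes f: "f \<in> Hom C (X \<otimes> A) (Y \<otimes> A)" and X: "X \<in> Ob C" and Y: "Y \<in> Ob C"
    and lin: "f \<cdot> \<mu> X = \<mu> Y \<cdot> (f \<boxtimes> Idn C A)"
  obtains h where "h \<in> Hom D (FOb F X) (FOb F Y)" "q Y \<bullet> FAr F f = h \<bullet> q X"
proof -
  note [simp] = HomD [OF f] X Y
  have fi: "f \<cdot> \<iota> X \<in> Hom C X (Y \<otimes> A)" by (simp add: Hom_def)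
  have "f = f \<cdot> (\<mu> X \<cdot> (\<iota> X \<boxtimes> Idn C A))"
    by (simp add: \<mu>_\<iota>)
  also have "\<dots> = (f \<cdot> \<mu> X) \<cdot> (\<iota> X \<boxtimes> Idn C A)"
    by simp
  also have "\<dots> = \<mu> Y \<cdot> ((f \<cdot> \<iota> X) \<boxtimes> Idn C A)"
    unfolding lin by (simp add: C.merge)
  finally have "q Y \<bullet> FAr F f = q Y \<bullet> FAr F (\<mu> Y \<cdot> ((f \<cdot> \<iota> X) \<boxtimes> Idn C A))"
    by (rule arg_cong)
  also have "\<dots> = (q Y \<bullet> FAr F (f \<cdot> \<iota> X)) \<bullet> q X"
    unfolding q_\<mu>_TAr [OF fi Y] by simp
  finally show ?thesis
    by (rule that [rotated]) (simp add: Hom_def)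
qed

text \<open>
  Universality of \<open>q Y\<close> provides \<open>f\<close>, and also shows that it is linear, because both sides of the linearity
  condition become equal to \<open>h\<close> after forgetting the two factors \<open>A\<close>.
\<close>

lemma free_module_arrow_from_D:
  assumes h: "h \<in> Hom D (FOb F X) (FOb F Y)" and X: "X \<in> Ob C" and Y: "Y \<in> Ob C"
  obtains f where "f \<in> Hom C (X \<otimes> A) (Y \<otimes> A)" "q Y \<bullet> FAr F f = h \<bullet> q X"
    "f \<cdot> \<mu> X = \<mu> Y \<cdot> (f \<boxtimes> Idn C A)"
proof -
  note [simp] = HomD [OF h] X Y
  have "h \<bullet> q X \<in> Hom D (FOb F (X \<otimes> A)) (FOb F Y)" by (simp add: Hom_def)
  then obtain f where f: "f \<in> Hom C (X \<otimes> A) (Y \<otimes> A)" "q Y \<bullet> FAr F f = h \<bullet> q X"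
    by (rule q_surj) (simp_all add: Y)
  note [simp] = HomD [OF f(1)]
  have "f \<cdot> \<mu> X = \<mu> Y \<cdot> (f \<boxtimes> Idn C A)"
  proof (rule q_inj)
    have "q Y \<bullet> FAr F (f \<cdot> \<mu> X) = (q Y \<bullet> FAr F f) \<bullet> FAr F (\<mu> X)"
      by simp
    also have "\<dots> = h \<bullet> (q X \<bullet> FAr F (\<mu> X))"
      unfolding f(2) by simp
    also have "\<dots> = (q Y \<bullet> FAr F f) \<bullet> q (X \<otimes> A)"
      unfolding f(2) by (subst q_mul) simp_all
    also have "\<dots> = q Y \<bullet> FAr F (\<mu> Y \<cdot> (f \<boxtimes> Idn C A))"
      using q_\<mu>_TAr [OF f(1) Y] by simp
    finally show "q Y \<bullet> FAr F (f \<cdot> \<mu> X) = q Y \<bullet> FAr F (\<mu> Y \<cdot> (f \<boxtimes> Idn C A))" .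
  qed (simp_all add: Hom_def)
  then show ?thesis
    by (rule that [OF f])
qed

lemma q_chain:
  assumes f: "f \<in> Hom C (X \<otimes> A) (Y \<otimes> A)" "q Y \<bullet> FAr F f = h \<bullet> q X" "h \<in> Hom D (FOb F X) (FOb F Y)"
    and g: "g \<in> Hom C (Y \<otimes> A) (Z \<otimes> A)" "q Z \<bullet> FAr F g = k \<bullet> q Y" "k \<in> Hom D (FOb F Y) (FOb F Z)"
    and Ob: "X \<in> Ob C" "Y \<in> Ob C" "Z \<in> Ob C"
  shows "q Z \<bullet> FAr F (g \<cdot> f) = (k \<bullet> h) \<bullet> q X"
proof -
  note [simp] = HomD [OF f(1)] HomD [OF f(3)] HomD [OF g(1)] HomD [OF g(3)] Ob
  have "q Z \<bullet> FAr F (g \<cdot> f) = (q Z \<bullet> FAr F g) \<bullet> FAr F f"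
    by simp
  also have "\<dots> = k \<bullet> (q Y \<bullet> FAr F f)"
    unfolding g(2) by simp
  also have "\<dots> = (k \<bullet> h) \<bullet> q X"
    unfolding f(2) by simp
  finally show ?thesis .
qed

lemma q_cancel:
  assumes "h \<in> Hom D (FOb F X) V" "k \<in> Hom D (FOb F X) V" "h \<bullet> q X = k \<bullet> q X" "X \<in> Ob C"
  shows "h = k"
proof -
  note [simp] = HomD [OF assms(1)] HomD [OF assms(2)] assms(4)
  have "(h \<bullet> q X) \<bullet> FAr F (\<iota> X) = (k \<bullet> q X) \<bullet> FAr F (\<iota> X)"
    using assms(3) by simp
  then show ?thesis by (simp add: q_\<iota>)
qed

text \<open>
  By the preceding lemmas, sending \<open>f\<close> to the arrow \<open>h\<close> with \<open>q Y \<bullet> F f = h \<bullet> q X\<close> is an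
  equivalence from the category of free modules to the full subcategory of \<open>D\<close> on the objects \<open>F X\<close>.
\<close>

lemma free_isomorphic_iff:
  assumes X: "X \<in> Ob C" and Y: "Y \<in> Ob C"
  shows "isomorphic (mod_cat C Alg) (free_module C Alg X) (free_module C Alg Y)
    \<longleftrightarrow> isomorphic D (FOb F X) (FOb F Y)"
proof
  interpret M: category "mod_cat C Alg"
    by (rule C.mod_cat_category) simp
  assume "isomorphic (mod_cat C Alg) (free_module C Alg X) (free_module C Alg Y)"
  then obtain f' where f': "f' \<in> Hom (mod_cat C Alg) (free_module C Alg X) (free_module C Alg Y)" "is_iso (mod_cat C Alg) f'"
    by (auto simp: isomorphic_def)
  have g': "inv_arr (mod_cat C Alg) f' \<in> Hom (mod_cat C Alg) (free_module C Alg Y) (free_module C Alg X)"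
    using M.inv_arr_simps(1-3) [OF f'(2)] HomD [OF f'(1)] by (simp add: Hom_def)
  obtain f g where f: "f' = (free_module C Alg X, f, free_module C Alg Y)"
      "f \<in> Hom C (X \<otimes> A) (Y \<otimes> A)" "f \<cdot> \<mu> X = \<mu> Y \<cdot> (f \<boxtimes> Idn C A)"
    and g: "inv_arr (mod_cat C Alg) f' = (free_module C Alg Y, g, free_module C Alg X)"
      "g \<in> Hom C (Y \<otimes> A) (X \<otimes> A)" "g \<cdot> \<mu> Y = \<mu> X \<cdot> (g \<boxtimes> Idn C A)"
    using f'(1) g' by (auto simp: mod_cat_Hom free_module_simp)
  have gf: "g \<cdot> f = Idn C (X \<otimes> A)" "f \<cdot> g = Idn C (Y \<otimes> A)"
    using M.inv_arr_simps(4,5) [OF f'(2)] unfolding g(1) unfolding f(1) by (simp_all add: free_module_simp)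
  obtain h where h: "h \<in> Hom D (FOb F X) (FOb F Y)" "q Y \<bullet> FAr F f = h \<bullet> q X"
    by (rule free_module_arrow_to_D [OF f(2) X Y f(3)])
  obtain k where k: "k \<in> Hom D (FOb F Y) (FOb F X)" "q X \<bullet> FAr F g = k \<bullet> q Y"
    by (rule free_module_arrow_to_D [OF g(2) Y X g(3)])
  have "k \<bullet> h = Idn D (FOb F X)"
    using q_chain [OF f(2) h(2,1) g(2) k(2,1) X Y X] gf(1) X
    by (intro q_cancel [OF D.Comp_Hom [OF h(1) k(1)] D.Idn_Hom]) simp_all
  moreover have "h \<bullet> k = Idn D (FOb F Y)"
    using q_chain [OF g(2) k(2,1) f(2) h(2,1) Y X Y] gf(2) Y
    by (intro q_cancel [OF D.Comp_Hom [OF k(1) h(1)] D.Idn_Hom]) simp_all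
  ultimately show "isomorphic D (FOb F X) (FOb F Y)"
    unfolding isomorphic_def using D.isoI(1) [OF h(1) k(1)] h(1) by blast
next
  interpret M: category "mod_cat C Alg"
    by (rule C.mod_cat_category) simp
  assume "isomorphic D (FOb F X) (FOb F Y)"
  then obtain h where h: "h \<in> Hom D (FOb F X) (FOb F Y)" "is_iso D h"
    by (auto simp: isomorphic_def)
  define k where "k = inv_arr D h"
  have k: "k \<in> Hom D (FOb F Y) (FOb F X)" "k \<bullet> h = Idn D (FOb F X)" "h \<bullet> k = Idn D (FOb F Y)"
    using D.inv_arr_simps [OF h(2)] HomD [OF h(1)] by (simp_all add: k_def Hom_def)
  obtain f where f: "f \<in> Hom C (X \<otimes> A) (Y \<otimes> A)" "q Y \<bullet> FAr F f = h \<bullet> q X"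
    "f \<cdot> \<mu> X = \<mu> Y \<cdot> (f \<boxtimes> Idn C A)"
    by (rule free_module_arrow_from_D [OF h(1) X Y])
  obtain g where g: "g \<in> Hom C (Y \<otimes> A) (X \<otimes> A)" "q X \<bullet> FAr F g = k \<bullet> q Y"
    "g \<cdot> \<mu> Y = \<mu> X \<cdot> (g \<boxtimes> Idn C A)"
    by (rule free_module_arrow_from_D [OF k(1) Y X])
  have "g \<cdot> f = Idn C (X \<otimes> A)"
    using q_chain [OF f(1,2) h(1) g(1,2) k(1) X Y X] k(2) X
    by (intro q_inj [OF C.Comp_Hom [OF f(1) g(1)] C.Idn_Hom]) simp_all
  moreover have "f \<cdot> g = Idn C (Y \<otimes> A)"
    using q_chain [OF g(1,2) k(1) f(1,2) h(1) Y X Y] k(3) Y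
    by (intro q_inj [OF C.Comp_Hom [OF g(1) f(1)] C.Idn_Hom]) simp_all
  moreover have fM: "(free_module C Alg X, f, free_module C Alg Y) \<in> Hom (mod_cat C Alg) (free_module C Alg X) (free_module C Alg Y)"
    "(free_module C Alg Y, g, free_module C Alg X) \<in> Hom (mod_cat C Alg) (free_module C Alg Y) (free_module C Alg X)"
    using f g free_right_module [OF X] free_right_module [OF Y] by (simp_all add: mod_cat_Hom free_module_simp)
  ultimately show "isomorphic (mod_cat C Alg) (free_module C Alg X) (free_module C Alg Y)"
    unfolding isomorphic_def
    by (intro bexI [of _ "(free_module C Alg X, f, free_module C Alg Y)"] M.isoI(1) [OF fM])
      (simp_all add: free_module_simp)
qed

lemma free_functor_additive: "additive_functor C (mod_cat C Alg) (free_functor C Alg)"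
proof -
  interpret M: preadditive_category "mod_cat C Alg"
    by (rule C.mod_cat_preadditive) simp
  have I: "Idn C A \<in> Hom C A A" by (simp add: Hom_def)
  show ?thesis
  proof
    fix X assume X: "X \<in> Ob C"
    show "FOb (free_functor C Alg) X \<in> Ob (mod_cat C Alg)"
      using free_right_module [OF X] by (simp add: free_functor_def)
    show "FAr (free_functor C Alg) (Idn C X) = Idn (mod_cat C Alg) (FOb (free_functor C Alg) X)"
      using X by (simp add: free_functor_def free_module_simp)
  next
    fix f X Y assume f: "f \<in> Hom C X Y"
    note [simp] = HomD [OF f] C.Hom_Ob [OF f]
    have a: "Asc C Y A A \<cdot> ((f \<boxtimes> Idn C A) \<boxtimes> Idn C A) = (f \<boxtimes> Idn C (A \<otimes> A)) \<cdot> Asc C X A A"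
      using C.Asc_nat [of f "Idn C A" "Idn C A" Y A A] by simp
    have "(f \<boxtimes> Idn C A) \<cdot> \<mu> X = \<mu> Y \<cdot> ((f \<boxtimes> Idn C A) \<boxtimes> Idn C A)"
      by (simp add: \<mu>_def a C.merge)
    then show "FAr (free_functor C Alg) f \<in> Hom (mod_cat C Alg) (FOb (free_functor C Alg) X) (FOb (free_functor C Alg) Y)"
      using free_right_module [of X] free_right_module [of Y] C.TAr_Hom [OF f I]
      by (simp add: free_functor_def mod_cat_Hom free_module_simp)
  next
    fix f g X Y Z assume f: "f \<in> Hom C X Y" and g: "g \<in> Hom C Y Z"
    note [simp] = HomD [OF f] HomD [OF g]
    show "FAr (free_functor C Alg) (g \<cdot> f) = FAr (free_functor C Alg) g \<cdot>\<^bsub>mod_cat C Alg\<^esub> FAr (free_functor C Alg) f"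
      by (simp add: free_functor_def C.merge)
  next
    fix f g X Y assume f: "f \<in> Hom C X Y" and g: "g \<in> Hom C X Y"
    show "FAr (free_functor C Alg) (f \<oplus> g) = FAr (free_functor C Alg) f \<oplus>\<^bsub>mod_cat C Alg\<^esub> FAr (free_functor C Alg) g"
      using C.Add_TAr [OF f g I] HomD [OF f] HomD [OF g] by (simp add: free_functor_def)
  qed
qed

lemma FOb_Unt_isomorphic: "isomorphic D \<one>\<^bsub>D\<^esub> (FOb F \<one>)"
  unfolding isomorphic_def using F0_iso F0_Hom by blast

lemma FOb_trivial_isomorphic_power:
  assumes "is_trivial D (FOb F X)"
  obtains n Q where "is_power C \<one> n Q" "Q \<in> Ob C" "isomorphic D (FOb F X) (FOb F Q)"
proof -
  obtain n where n: "is_power D \<one>\<^bsub>D\<^esub> n (FOb F X)"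
    using assms D.unit_cogen_power D.trivial_iff_cogen by blast
  obtain Q where Q: "is_power C \<one> n Q"
    using C.power_exists [of "\<one>" n] by auto
  have "Q \<in> Ob C"
    using C.power_unit_cogen_gen [OF Q] by (simp add: unit_cogen_def)
  moreover have "isomorphic D (FOb F X) (FOb F Q)"
    using D.power_isomorphic [OF n additive_functor.FOb_power [OF additive Q] FOb_Unt_isomorphic] .
  ultimately show ?thesis using that Q by blast
qed

text \<open>
  The free module functor and \<open>F\<close> are additive, so a power \<open>Q\<close> of the unit object of \<open>C\<close> is sent to a power of the
  free module on \<open>\<one>\<close> by the first and to a trivial object by the second; the equivalence
  compares \<open>X\<close> with \<open>Q\<close>.
\<close>

lemma trivializes_iff:
  assumes X: "X \<in> Ob C"
  shows "trivializes C Alg X \<longleftrightarrow> is_trivial D (FOb F X)"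
proof
  interpret M: preadditive_category "mod_cat C Alg"
    by (rule C.mod_cat_preadditive) simp
  interpret FA: additive_functor C "mod_cat C Alg" "free_functor C Alg"
    by (rule free_functor_additive)
  assume "trivializes C Alg X"
  then obtain n P where P: "is_power (mod_cat C Alg) (FOb (free_functor C Alg) \<one>) n P"
    "isomorphic (mod_cat C Alg) (FOb (free_functor C Alg) X) P"
    by (auto simp: trivializes_def)
  obtain Q where Q: "is_power C \<one> n Q"
    using C.power_exists [of "\<one>" n] by auto
  have QO: "Q \<in> Ob C"
    using C.power_unit_cogen_gen [OF Q] by (simp add: unit_cogen_def)
  have "isomorphic (mod_cat C Alg) P (FOb (free_functor C Alg) Q)"
    using M.power_isomorphic [OF P(1) FA.FOb_power [OF Q]] M.isomorphic_refl FA.FOb_Ob by simp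
  then have "isomorphic (mod_cat C Alg) (free_module C Alg X) (free_module C Alg Q)"
    using M.isomorphic_trans [OF P(2)] by (simp add: free_functor_def)
  then have "isomorphic D (FOb F X) (FOb F Q)"
    using free_isomorphic_iff [OF X QO] by simp
  moreover have "is_trivial D (FOb F Q)"
    using D.is_power_trivial [OF additive_functor.FOb_power [OF additive Q]]
      D.trivial_isomorphic [OF D.isomorphic_sym [OF FOb_Unt_isomorphic] D.trivial_Unt] by blast
  ultimately show "is_trivial D (FOb F X)"
    by (rule D.trivial_isomorphic)
next
  interpret FA: additive_functor C "mod_cat C Alg" "free_functor C Alg"
    by (rule free_functor_additive)
  assume "is_trivial D (FOb F X)"
  then obtain n Q where Q: "is_power C \<one> n Q" "Q \<in> Ob C" "isomorphic D (FOb F X) (FOb F Q)"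
    by (rule FOb_trivial_isomorphic_power)
  have "isomorphic (mod_cat C Alg) (FOb (free_functor C Alg) X) (FOb (free_functor C Alg) Q)"
    using free_isomorphic_iff [OF X Q(2)] Q(3) by (simp add: free_functor_def)
  then show "trivializes C Alg X"
    unfolding trivializes_def using FA.FOb_power [OF Q(1)] by blast
qed

end

section \<open>Images, and exact functors on monomorphisms and epimorphisms\<close>

context abelian_category
begin

lemma mono_short_exact:
  assumes m: "is_mono C m"
  shows "\<exists>q. short_exact C m q"
proof -
  obtain f where f: "is_kernel C m f"
    using mono_is_kernel [OF m] by blast
  obtain q where q: "is_cokernel C q m"
    using has_cokernel [of m] kernelD(2) [OF f] by blast
  note [simp] = kernelD(1-3) [OF f] cokernelD(2,3) [OF q]
  have fH: "f \<in> Hom C (Cod C m) (Cod C f)" by (simp add: Hom_def)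
  obtain f' where f': "f' \<in> Hom C (Cod C q) (Cod C f)" "f' \<cdot> q = f"
    using cokernel_factor [OF q fH kernelD(4) [OF f]] by blast
  have "is_kernel C m q"
    unfolding is_kernel_def
  proof (intro conjI allI ballI impI)
    fix T h assume h: "h \<in> Hom C T (Dom C q)" and z: "q \<cdot> h = Zer C T (Cod C q)"
    have qH: "q \<in> Hom C (Dom C q) (Cod C q)" by (simp only: Hom_def) simp
    have hf: "h \<in> Hom C T (Dom C f)" using h by simp
    have "f \<cdot> h = f' \<cdot> (q \<cdot> h)"
      using Comp_assoc [OF h qH f'(1)] f'(2) by simp
    also have "\<dots> = Zer C T (Cod C f)"
      unfolding z by (rule Comp_Zer [OF f'(1)]) (use Hom_Ob [OF h] in simp)
    finally obtain h' where h': "h' \<in> Hom C T (Dom C m)" "m \<cdot> h' = h"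
      using kernel_factor [OF f hf] by blast
    then show "\<exists>!h'. h' \<in> Hom C T (Dom C m) \<and> m \<cdot> h' = h"
      using mono_cancel [OF m] by blast
  qed (use cokernelD(4) [OF q] in simp_all)
  then show ?thesis
    unfolding short_exact_def using q by blast
qed

lemma epi_short_exact:
  assumes e: "is_epi C e"
  shows "\<exists>k. short_exact C k e"
proof -
  obtain f where f: "is_cokernel C e f"
    using epi_is_cokernel [OF e] by blast
  obtain k where k: "is_kernel C k e"
    using has_kernel [of e] cokernelD(2) [OF f] by blast
  note [simp] = cokernelD(1-3) [OF f] kernelD(2,3) [OF k]
  have fH: "f \<in> Hom C (Dom C f) (Dom C e)" by (simp add: Hom_def)
  obtain f' where f': "f' \<in> Hom C (Dom C f) (Dom C k)" "k \<cdot> f' = f"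
    using kernel_factor [OF k fH cokernelD(4) [OF f]] by blast
  have "is_cokernel C e k"
    unfolding is_cokernel_def
  proof (intro conjI allI ballI impI)
    fix T h assume h: "h \<in> Hom C (Cod C k) T" and z: "h \<cdot> k = Zer C (Dom C k) T"
    have kH: "k \<in> Hom C (Dom C k) (Cod C k)" by (simp only: Hom_def) simp
    have hf: "h \<in> Hom C (Cod C f) T" using h by simp
    have "h \<cdot> f = (h \<cdot> k) \<cdot> f'"
      using Comp_assoc [OF f'(1) kH h] f'(2) by simp
    also have "\<dots> = Zer C (Dom C f) T"
      unfolding z by (rule Zer_Comp [OF f'(1)]) (use Hom_Ob [OF h] in simp)
    finally obtain h' where h': "h' \<in> Hom C (Cod C e) T" "h' \<cdot> e = h"
      using cokernel_factor [OF f hf] by blast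
    then show "\<exists>!h'. h' \<in> Hom C (Cod C e) T \<and> h' \<cdot> e = h"
      using epi_cancel [OF e] by blast
  qed (use kernelD(4) [OF k] in simp_all)
  then show ?thesis
    unfolding short_exact_def using k by blast
qed

text \<open>
  The image of \<open>f\<close> is the kernel \<open>i\<close> of its cokernel. The induced arrow to it is epic because a
  subobject of \<open>i\<close> through which \<open>f\<close> factors is itself a kernel and therefore contains \<open>i\<close>.
\<close>

lemma image_factor:
  assumes f: "f \<in> Hom C X Y"
  obtains I e i where "e \<in> Hom C X I" "i \<in> Hom C I Y" "is_epi C e" "is_mono C i" "i \<cdot> e = f"
proof -
  note [simp] = HomD [OF f] Hom_Ob [OF f]
  obtain c where c: "is_cokernel C c f"
    using has_cokernel [of f] by auto
  have cH: "c \<in> Hom C Y (Cod C c)"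
    using cokernelD [OF c] by (simp add: Hom_def)
  note [simp] = HomD(1,2) [OF cH] Hom_Ob [OF cH]
  obtain i where i: "is_kernel C i c"
    using has_kernel [of c] by auto
  define I where "I = Dom C i"
  have iH: "i \<in> Hom C I Y"
    using kernelD [OF i] by (simp add: Hom_def I_def)
  have f0: "f \<in> Hom C X (Dom C c)" "c \<cdot> f = Zer C X (Cod C c)"
    using f cokernelD(4) [OF c] by simp_all
  obtain e where e: "e \<in> Hom C X I" "i \<cdot> e = f"
    by (rule kernel_factor [OF i f0, folded I_def]) (rule that)
  have "is_epi C e"
  proof (rule epi_if_zero [OF e(1)])
    fix T t assume t: "t \<in> Hom C I T" "t \<cdot> e = Zer C X T"
    note [simp] = HomD [OF t(1)] Hom_Ob [OF t(1)]
    obtain k where k: "is_kernel C k t"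
      using has_kernel [of t] by auto
    have kH: "k \<in> Hom C (Dom C k) I"
      using kernelD [OF k] by (simp add: Hom_def)
    have ik: "i \<cdot> k \<in> Hom C (Dom C k) Y"
      by (rule Comp_Hom [OF kH iH])
    have e': "e \<in> Hom C X (Dom C t)" using e(1) by simp
    obtain e1 where e1: "e1 \<in> Hom C X (Dom C k)" "k \<cdot> e1 = e"
      using kernel_factor [OF k e'] t(2) by auto
    have "is_mono C (i \<cdot> k)"
      by (rule mono_Comp [OF kernelD(5) [OF k] kernelD(5) [OF i]]) (use HomD [OF kH] HomD [OF iH] in simp)
    then obtain g where g: "is_kernel C (i \<cdot> k) g"
      using mono_is_kernel by blast
    have gH: "g \<in> Hom C Y (Cod C g)"
      using kernelD [OF g] HomD [OF ik] by (simp add: Hom_def)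
    have gik: "g \<cdot> (i \<cdot> k) = Zer C (Dom C k) (Cod C g)"
      using kernelD(4) [OF g] HomD [OF ik] by simp
    \<comment> \<open>\<open>f\<close> factors through \<open>i \<cdot> k\<close>, so every arrow that kills \<open>i \<cdot> k\<close> factors through the
      cokernel of \<open>f\<close> and therefore kills \<open>i\<close>.\<close>
    have "f = (i \<cdot> k) \<cdot> e1"
      using Comp_assoc [OF e1(1) kH iH] e1(2) e(2) by simp
    then have "g \<cdot> f = (g \<cdot> (i \<cdot> k)) \<cdot> e1"
      using Comp_assoc [OF e1(1) ik gH] by simp
    also have "\<dots> = Zer C X (Cod C g)"
      unfolding gik by (rule Zer_Comp [OF e1(1)]) (use Hom_Ob [OF gH] in simp)
    finally have gf: "g \<cdot> f = Zer C (Dom C f) (Cod C g)" by simp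
    have gH': "g \<in> Hom C (Cod C f) (Cod C g)" using gH by simp
    obtain g' where g': "g' \<in> Hom C (Cod C c) (Cod C g)" "g' \<cdot> c = g"
      using cokernel_factor [OF c gH' gf] by blast
    have "g \<cdot> i = g' \<cdot> (c \<cdot> i)"
      using Comp_assoc [OF iH cH g'(1)] g'(2) by simp
    also have "c \<cdot> i = Zer C I (Cod C c)"
      using kernelD(4) [OF i] by (simp add: I_def)
    also have "g' \<cdot> \<dots> = Zer C I (Cod C g)"
      by (rule Comp_Zer [OF g'(1)]) simp
    finally have gi: "g \<cdot> i = Zer C I (Cod C g)" .
    have iH': "i \<in> Hom C I (Dom C g)" using iH HomD(2) [OF gH] by simp
    obtain r where r: "r \<in> Hom C I (Dom C k)" "(i \<cdot> k) \<cdot> r = i"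
      using kernel_factor [OF g iH' gi] HomD [OF ik] by auto
    have "k \<cdot> r = Idn C I"
    proof (rule mono_cancel [OF kernelD(5) [OF i], where T = I])
      show "i \<cdot> (k \<cdot> r) = i \<cdot> Idn C I"
        using Comp_assoc [OF r(1) kH iH] r(2) Comp_Idn [OF iH] by simp
    qed (use Comp_Hom [OF r(1) kH] Idn_Hom in \<open>auto simp: I_def [symmetric]\<close>)
    then have "t = (t \<cdot> k) \<cdot> r"
      using Comp_assoc [OF r(1) kH t(1)] Comp_Idn [OF t(1)] by simp
    also have "t \<cdot> k = Zer C (Dom C k) T"
      using kernelD(4) [OF k] by simp
    also have "\<dots> \<cdot> r = Zer C I T"
      by (rule Zer_Comp [OF r(1)]) simp
    finally show "t = Zer C I T" .
  qed
  then show ?thesis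
    using that [OF e(1) iH _ kernelD(5) [OF i] e(2)] by blast
qed

end

context exact_functor
begin

lemma FAr_mono: "is_mono C m \<Longrightarrow> is_mono D (FAr F m)"
  using C.mono_short_exact FAr_exact D.kernelD(5) unfolding short_exact_def by blast

lemma FAr_epi: "is_epi C e \<Longrightarrow> is_epi D (FAr F e)"
  using C.epi_short_exact FAr_exact D.cokernelD(5) unfolding short_exact_def by blast

end

section \<open>Full subcategories\<close>

lemma full_sub_simps [simp]:
  fixes C :: "('o, 'm, 'k, 'z) mon_cat_scheme"
  shows "Ob (full_sub C S) = S" "Arr (full_sub C S) = {f \<in> Arr C. Dom C f \<in> S \<and> Cod C f \<in> S}"
  "Dom (full_sub C S) = Dom C" "Cod (full_sub C S) = Cod C" "Idn (full_sub C S) = Idn C"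
  "Comp (full_sub C S) = Comp C" "Zer (full_sub C S) = Zer C" "Add (full_sub C S) = Add C"
  "Scl (full_sub C S) = Scl C" "TOb (full_sub C S) = TOb C" "TAr (full_sub C S) = TAr C"
  "Unt (full_sub C S) = Unt C" "Asc (full_sub C S) = Asc C" "LUn (full_sub C S) = LUn C"
  "RUn (full_sub C S) = RUn C"
  by (simp_all add: full_sub_def)

lemma full_sub_Hom:
  fixes C :: "('o, 'm, 'k, 'z) mon_cat_scheme"
  shows "f \<in> Hom (full_sub C S) X Y \<longleftrightarrow> f \<in> Hom C X Y \<and> X \<in> S \<and> Y \<in> S"
  by (auto simp: Hom_def)

lemma full_sub_lin_span:
  fixes C :: "('o, 'm, 'k, 'z) mon_cat_scheme"
  shows "lin_span (full_sub C S) X Y B = lin_span C X Y B"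
proof (intro equalityI subsetI)
  fix f assume "f \<in> lin_span (full_sub C S) X Y B"
  then show "f \<in> lin_span C X Y B"
    by induction (auto intro: lin_span.intros)
next
  fix f assume "f \<in> lin_span C X Y B"
  then show "f \<in> lin_span (full_sub C S) X Y B"
    using lin_span.intros [where C = "full_sub C S" and X = X and Y = Y and B = B]
    by induction auto
qed

lemma inclusion_simps [simp]:
  "FOb (inclusion C) X = X" "FAr (inclusion C) f = f"
  "F2 (inclusion C) X Y = Idn C (X \<otimes>\<^bsub>C\<^esub> Y)" "F0 (inclusion C) = Idn C \<one>\<^bsub>C\<^esub>"
  by (simp_all add: inclusion_def)

text \<open>
  Kernels and cokernels in \<open>C\<close> of arrows between objects of \<open>S\<close> have their objects in \<open>S\<close>, so the full
  subcategory on \<open>S\<close> inherits the abelian structure.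
\<close>

locale stable_subcategory = tensor_category C
  for C :: "('o, 'm, 'k::field, 'z) mon_cat_scheme" (structure) +
  fixes S :: "'o set"
  assumes S_Ob: "S \<subseteq> Ob C" and S_stable: "stable C S" and S_zero: "\<exists>Z\<in>S. is_zero C Z"
begin

abbreviation E :: "('o, 'm, 'k, 'z) mon_cat_scheme" where "E \<equiv> full_sub C S"

lemma S_simps [simp]: "X \<in> S \<Longrightarrow> X \<in> Ob C"
  using S_Ob by blast

lemma S_mono: "is_mono C i \<Longrightarrow> Cod C i \<in> S \<Longrightarrow> Dom C i \<in> S"
  and S_epi: "is_epi C e \<Longrightarrow> Dom C e \<in> S \<Longrightarrow> Cod C e \<in> S"
  and S_dsum: "X \<in> S \<Longrightarrow> Y \<in> S \<Longrightarrow> is_dsum C X Y P \<Longrightarrow> P \<in> S"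
  using S_stable unfolding stable_def by blast+

lemma E_category: "category E"
  by unfold_locales
    (auto simp: full_sub_Hom Idn_Hom Comp_Hom Comp_Idn Idn_Comp Comp_assoc)

lemma E_preadditive: "preadditive_category E"
proof -
  interpret E: category E by (rule E_category)
  show ?thesis
  proof
    fix f X Y assume "f \<in> Hom E X Y"
    then show "\<exists>g\<in>Hom E X Y. f \<oplus>\<^bsub>E\<^esub> g = Zer E X Y"
      using Add_inverse [of f X Y] by (auto simp: full_sub_Hom)
  qed (auto simp: full_sub_Hom Zer_Hom Add_Hom Add_assoc Zer_Add Comp_Add Add_Comp intro: Add_commute)
qed

lemma E_linear: "linear_category E"
proof -
  interpret E: preadditive_category E by (rule E_preadditive)
  show ?thesis
    by unfold_locales
      (auto simp: full_sub_Hom Scl_Hom Scl_Add plus_Scl Scl_Scl one_Scl Comp_Scl Scl_Comp)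
qed

lemma E_zero: "is_zero E Z \<longleftrightarrow> Z \<in> S \<and> is_zero C Z"
  using preadditive_category.is_zero_iff [OF E_preadditive, of Z] is_zero_iff [of Z] by auto

lemma E_inverse: "inverse_arrows E f g \<longleftrightarrow> f \<in> Arr E \<and> inverse_arrows C f g"
  by (auto simp: inverse_arrows_def Hom_def)

lemma E_iso: "is_iso E f \<longleftrightarrow> f \<in> Arr E \<and> is_iso C f"
  by (simp add: is_iso_def E_inverse)

lemma E_inv: "f \<in> Arr E \<Longrightarrow> inv_arr E f = inv_arr C f"
  by (simp add: inv_arr_def E_inverse)

lemma E_dsum:
  assumes "X \<in> S" "Y \<in> S" "P \<in> S" "is_dsum C X Y P"
  shows "is_dsum E X Y P"
  using assms by (simp add: is_dsum_def full_sub_Hom Bex_def)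

lemma E_kernel:
  assumes k: "is_kernel C k f" and f: "f \<in> Arr E"
  shows "is_kernel E k f"
proof -
  have "Dom C k \<in> S"
    using S_mono [OF kernelD(5) [OF k]] kernelD(3) [OF k] f by simp
  then show ?thesis
    using k f unfolding is_kernel_def by (auto simp: full_sub_Hom)
qed

lemma E_cokernel:
  assumes q: "is_cokernel C q f" and f: "f \<in> Arr E"
  shows "is_cokernel E q f"
proof -
  have "Cod C q \<in> S"
    using S_epi [OF cokernelD(5) [OF q]] cokernelD(3) [OF q] f by simp
  then show ?thesis
    using q f unfolding is_cokernel_def by (auto simp: full_sub_Hom)
qed

lemma E_monoD:
  assumes m: "is_mono E m"
  shows "is_mono C m"
proof -
  have mA [simp]: "m \<in> Arr C" "Dom C m \<in> S" "Cod C m \<in> S"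
    using m by (auto simp: is_mono_def)
  have mH: "m \<in> Hom C (Dom C m) (Cod C m)" by (simp add: Hom_def)
  obtain k where k: "is_kernel C k m"
    using has_kernel [OF mA(1)] by blast
  have kH: "k \<in> Hom C (Dom C k) (Dom C m)"
    using kernelD [OF k] by (simp add: Hom_def)
  have kS: "Dom C k \<in> S"
    using S_mono [OF kernelD(5) [OF k]] kernelD(3) [OF k] by simp
  have "k = Zer C (Dom C k) (Dom C m)"
  proof -
    have "m \<cdot> k = m \<cdot> Zer C (Dom C k) (Dom C m)"
      using kernelD(4) [OF k] kS by simp
    then show ?thesis
      using m kH kS Zer_Hom [of "Dom C k" "Dom C m"] by (auto simp: is_mono_def full_sub_Hom)
  qed
  show ?thesis
  proof (rule mono_if_zero [OF mH])
    fix T a assume a: "a \<in> Hom C T (Dom C m)" "m \<cdot> a = Zer C T (Cod C m)"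
    then obtain a' where a': "a' \<in> Hom C T (Dom C k)" "k \<cdot> a' = a"
      using kernel_factor [OF k] by blast
    have "Zer C (Dom C k) (Dom C m) \<cdot> a' = Zer C T (Dom C m)"
      by (rule Zer_Comp [OF a'(1)]) simp
    then show "a = Zer C T (Dom C m)"
      using a'(2) \<open>k = Zer C (Dom C k) (Dom C m)\<close> by metis
  qed
qed

lemma E_epiD:
  assumes e: "is_epi E e"
  shows "is_epi C e"
proof -
  have eA [simp]: "e \<in> Arr C" "Dom C e \<in> S" "Cod C e \<in> S"
    using e by (auto simp: is_epi_def)
  have eH: "e \<in> Hom C (Dom C e) (Cod C e)" by (simp add: Hom_def)
  obtain q where q: "is_cokernel C q e"
    using has_cokernel [OF eA(1)] by blast
  have qH: "q \<in> Hom C (Cod C e) (Cod C q)"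
    using cokernelD [OF q] by (simp add: Hom_def)
  have qS: "Cod C q \<in> S"
    using S_epi [OF cokernelD(5) [OF q]] cokernelD(3) [OF q] by simp
  have "q = Zer C (Cod C e) (Cod C q)"
  proof -
    have "q \<cdot> e = Zer C (Cod C e) (Cod C q) \<cdot> e"
      using cokernelD(4) [OF q] qS by simp
    then show ?thesis
      using e qH qS Zer_Hom [of "Cod C e" "Cod C q"] by (auto simp: is_epi_def full_sub_Hom)
  qed
  show ?thesis
  proof (rule epi_if_zero [OF eH])
    fix T a assume a: "a \<in> Hom C (Cod C e) T" "a \<cdot> e = Zer C (Dom C e) T"
    then obtain a' where a': "a' \<in> Hom C (Cod C q) T" "a' \<cdot> q = a"
      using cokernel_factor [OF q] by blast
    have "a' \<cdot> Zer C (Cod C e) (Cod C q) = Zer C (Cod C e) T"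
      by (rule Comp_Zer [OF a'(1)]) simp
    then show "a = Zer C (Cod C e) T"
      using a'(2) \<open>q = Zer C (Cod C e) (Cod C q)\<close> by metis
  qed
qed

lemma E_abelian: "abelian_category E"
proof -
  interpret E: preadditive_category E by (rule E_preadditive)
  show ?thesis
  proof
    show "\<exists>Z. is_zero E Z"
      using S_zero E_zero by blast
    show "\<exists>P. is_dsum E X Y P" if XY: "X \<in> Ob E" "Y \<in> Ob E" for X Y
    proof -
      have S: "X \<in> S" "Y \<in> S" using XY by simp_all
      then obtain P where P: "is_dsum C X Y P" using has_dsum S_simps by blast
      then have "is_dsum E X Y P"
        using E_dsum S S_dsum by blast
      then show ?thesis ..
    qed
    show "\<exists>k. is_kernel E k f" if "f \<in> Arr E" for f
      using has_kernel [of f] E_kernel that by auto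
    show "\<exists>q. is_cokernel E q f" if "f \<in> Arr E" for f
      using has_cokernel [of f] E_cokernel that by auto
    show "\<exists>f. is_kernel E m f" if m: "is_mono E m" for m
    proof -
      obtain q where q: "is_kernel C m q" "is_cokernel C q m"
        using mono_short_exact [OF E_monoD [OF m]] by (auto simp: short_exact_def)
      have mE: "m \<in> Arr E" using m by (simp add: is_mono_def)
      have "q \<in> Arr E"
        using cokernelD [OF q(2)] mE S_epi [OF cokernelD(5) [OF q(2)]] by simp
      then show ?thesis using E_kernel [OF q(1)] by blast
    qed
    show "\<exists>f. is_cokernel E e f" if e: "is_epi E e" for e
    proof -
      obtain k where k: "is_kernel C k e" "is_cokernel C e k"
        using epi_short_exact [OF E_epiD [OF e]] by (auto simp: short_exact_def)
      have eE: "e \<in> Arr E" using e by (simp add: is_epi_def)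
      have "k \<in> Arr E"
        using kernelD [OF k(1)] eE S_mono [OF kernelD(5) [OF k(1)]] by simp
      then show ?thesis using E_cokernel [OF k(2)] by blast
    qed
  qed
qed

text \<open>
  A kernel or cokernel in \<open>C\<close> of an arrow of the subcategory lies in the subcategory, so it can be compared
  with the one that is computed there.
\<close>

lemma E_short_exactD:
  assumes "short_exact E i p"
  shows "short_exact C i p"
proof -
  interpret E: abelian_category E by (rule E_abelian)
  have i: "is_kernel E i p" and p: "is_cokernel E p i"
    using assms by (auto simp: short_exact_def)
  have im: "is_mono C i" and pe: "is_epi C p"
    using E_monoD E.kernelD(5) [OF i] E_epiD E.cokernelD(5) [OF p] by auto
  have iA: "i \<in> Arr E" and pA: "p \<in> Arr E" and ip: "Cod C i = Dom C p" and z: "p \<cdot> i = Zer C (Dom C i) (Cod C p)"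
    using E.kernelD [OF i] by auto
  have iH: "i \<in> Hom C (Dom C i) (Dom C p)" and pH: "p \<in> Hom C (Cod C i) (Cod C p)"
    using iA pA ip by (auto simp: Hom_def)
  have "is_kernel C i p"
    unfolding is_kernel_def
  proof (intro conjI allI ballI impI)
    fix T h assume h: "h \<in> Hom C T (Dom C p)" "p \<cdot> h = Zer C T (Cod C p)"
    obtain k where k: "is_kernel C k p"
      using has_kernel [of p] pA by auto
    have kH: "k \<in> Hom C (Dom C k) (Dom C p)"
      using kernelD [OF k] by (simp add: Hom_def)
    have kE: "k \<in> Hom E (Dom C k) (Dom E p)"
      using S_mono [OF kernelD(5) [OF k]] kernelD(3) [OF k] pA kH by (simp add: full_sub_Hom)
    have k0: "p \<cdot>\<^bsub>E\<^esub> k = Zer E (Dom C k) (Cod E p)"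
      using kernelD(4) [OF k] by simp
    obtain t where t: "t \<in> Hom E (Dom C k) (Dom E i)" "i \<cdot>\<^bsub>E\<^esub> t = k"
      using E.kernel_factor [OF i kE k0] by blast
    then have tH: "t \<in> Hom C (Dom C k) (Dom C i)" by (simp add: full_sub_Hom)
    obtain h' where h': "h' \<in> Hom C T (Dom C k)" "k \<cdot> h' = h"
      using kernel_factor [OF k h] by blast
    have "i \<cdot> (t \<cdot> h') = h"
      using Comp_assoc [OF h'(1) tH iH] t(2) h'(2) by simp
    then show "\<exists>!h'. h' \<in> Hom C T (Dom C i) \<and> i \<cdot> h' = h"
      using Comp_Hom [OF h'(1) tH] mono_cancel [OF im] by blast
  qed (use iA pA ip z in simp_all)
  moreover have "is_cokernel C p i"
    unfolding is_cokernel_def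
  proof (intro conjI allI ballI impI)
    fix T h assume h: "h \<in> Hom C (Cod C i) T" "h \<cdot> i = Zer C (Dom C i) T"
    obtain q where q: "is_cokernel C q i"
      using has_cokernel [of i] iA by auto
    have qH: "q \<in> Hom C (Cod C i) (Cod C q)"
      using cokernelD [OF q] by (simp add: Hom_def)
    have qE: "q \<in> Hom E (Cod E i) (Cod C q)"
      using S_epi [OF cokernelD(5) [OF q]] cokernelD(3) [OF q] iA qH by (simp add: full_sub_Hom)
    have q0: "q \<cdot>\<^bsub>E\<^esub> i = Zer E (Dom E i) (Cod C q)"
      using cokernelD(4) [OF q] by simp
    obtain t where t: "t \<in> Hom E (Cod E p) (Cod C q)" "t \<cdot>\<^bsub>E\<^esub> p = q"
      using E.cokernel_factor [OF p qE q0] by blast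
    then have tH: "t \<in> Hom C (Cod C p) (Cod C q)" by (simp add: full_sub_Hom)
    obtain h' where h': "h' \<in> Hom C (Cod C q) T" "h' \<cdot> q = h"
      using cokernel_factor [OF q h] by blast
    have "(h' \<cdot> t) \<cdot> p = h"
      using Comp_assoc [OF pH tH h'(1)] t(2) h'(2) by simp
    then show "\<exists>!h'. h' \<in> Hom C (Cod C p) T \<and> h' \<cdot> p = h"
      using Comp_Hom [OF tH h'(1)] epi_cancel [OF pe] by blast
  qed (use iA pA ip z in simp_all)
  ultimately show ?thesis by (simp add: short_exact_def)
qed

lemma inclusion_exact: "exact_functor E C (inclusion C)"
proof -
  interpret E: abelian_category E by (rule E_abelian)
  show ?thesis
    by unfold_locales (auto simp: full_sub_Hom E_short_exactD)
qed

lemma S_abelian_subcategory: "abelian_subcategory C S"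
  using S_Ob inclusion_exact by (simp add: abelian_subcategory_def)

lemma E_simple:
  assumes "is_simple C X" "X \<in> S"
  shows "is_simple E X"
  unfolding is_simple_def
proof (intro conjI allI impI)
  show "X \<in> Ob E" "\<not> is_zero E X"
    using assms by (auto simp: is_simple_def E_zero)
  fix i assume i: "is_mono E i \<and> Cod E i = X"
  then have "i \<in> Arr E" using assms(2) by (simp add: is_mono_def)
  then show "is_zero E (Dom E i) \<or> is_iso E i"
    using assms i E_monoD by (auto simp: is_simple_def E_zero E_iso)
qed

lemma E_finite_length:
  assumes Y: "Y \<in> S"
  shows "finite_length E Y"
proof -
  obtain n :: nat and X i p where *: "is_zero C (X 0) \<and> X n = Y \<and>
      (\<forall>k<n. i k \<in> Hom C (X k) (X (Suc k)) \<and> short_exact C (i k) (p k) \<and> is_simple C (Cod C (p k)))"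
    using finite_length_Ob [OF S_simps [OF Y]] unfolding finite_length_def by (elim exE) (rule that)
  have XS: "X (n - k) \<in> S" if "k \<le> n" for k
    using that
  proof (induction k)
    case 0
    then show ?case using * Y by simp
  next
    case (Suc k)
    then have l: "n - Suc k < n" "Suc (n - Suc k) = n - k" by auto
    then have i: "i (n - Suc k) \<in> Hom C (X (n - Suc k)) (X (n - k))" "is_mono C (i (n - Suc k))"
      using * kernelD(5) unfolding short_exact_def by metis+
    show ?case
      using S_mono [OF i(2)] HomD [OF i(1)] Suc by simp
  qed
  have XS: "X k \<in> S" if "k \<le> n" for k
    using XS [of "n - k"] that by simp
  have "i k \<in> Hom E (X k) (X (Suc k)) \<and> short_exact E (i k) (p k) \<and> is_simple E (Cod E (p k))" if k: "k < n" for k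
  proof -
    have i: "i k \<in> Hom C (X k) (X (Suc k))" and e: "is_kernel C (i k) (p k)" "is_cokernel C (p k) (i k)"
      and s: "is_simple C (Cod C (p k))"
      using * k by (auto simp: short_exact_def)
    have S: "X k \<in> S" "X (Suc k) \<in> S" using XS k by auto
    have pS: "Cod C (p k) \<in> S"
      using S_epi [OF cokernelD(5) [OF e(2)]] cokernelD(3) [OF e(2)] HomD [OF i] S by simp
    have "i k \<in> Arr E" "p k \<in> Arr E"
      using HomD [OF i] S pS cokernelD [OF e(2)] by auto
    then show ?thesis
      using i S E_kernel [OF e(1)] E_cokernel [OF e(2)] E_simple [OF s pS]
      by (simp add: full_sub_Hom short_exact_def)
  qed
  then show ?thesis
    unfolding finite_length_def using * XS [of 0] E_zero by (intro exI [of _ n] exI [of _ X] exI [of _ i] exI [of _ p]) simp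
qed

end

text \<open>With the unit object, products and duals, the subcategory is again a tensor category.\<close>

locale tensor_subcategory = stable_subcategory +
  assumes S_Unt: "\<one> \<in> S"
    and S_TOb: "X \<in> S \<Longrightarrow> Y \<in> S \<Longrightarrow> X \<otimes> Y \<in> S"
    and S_left_dual: "dual_pair C L X ev coev \<Longrightarrow> X \<in> S \<Longrightarrow> L \<in> S"
    and S_right_dual: "dual_pair C L X ev coev \<Longrightarrow> L \<in> S \<Longrightarrow> X \<in> S"
begin

lemma E_monoidal: "monoidal_category E"
proof -
  interpret E: category E by (rule E_category)
  show ?thesis
    by unfold_locales
      (use S_Unt S_TOb in \<open>auto simp: full_sub_Hom TAr_Hom TAr_Comp Asc_Hom Asc_natural LUn_Hom LUn_natural
        RUn_Hom RUn_natural pentagon triangle E_iso\<close>)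
qed

lemma E_dual_pair:
  assumes d: "dual_pair C L X ev coev" and S: "L \<in> S" "X \<in> S"
  shows "dual_pair E L X ev coev"
proof -
  have "inv_arr E (Asc C L X L) = inv_arr C (Asc C L X L)"
    by (rule E_inv) (use S S_TOb in simp)
  then show ?thesis
    using d S S_Unt S_TOb by (simp add: dual_pair_def full_sub_Hom)
qed

lemma E_tensor: "tensor_category E"
proof -
  interpret E: abelian_category E by (rule E_abelian)
  interpret E: linear_category E by (rule E_linear)
  interpret E: monoidal_category E by (rule E_monoidal)
  show ?thesis
  proof
    fix X assume X: "X \<in> Ob E"
    then have XS: "X \<in> S" "X \<in> Ob C" by auto
    show "\<exists>L ev coev. dual_pair E L X ev coev"
      using left_dual [OF XS(2)] S_left_dual E_dual_pair XS by metis
    show "\<exists>R ev coev. dual_pair E X R ev coev"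
      using right_dual [OF XS(2)] S_right_dual E_dual_pair XS by metis
    show "finite_length E X"
      by (rule E_finite_length [OF XS(1)])
  next
    fix X Y assume XY: "X \<in> Ob E" "Y \<in> Ob E"
    then have "Hom E X Y = Hom C X Y"
      by (auto simp: full_sub_Hom)
    then show "hom_finite_dim E X Y"
      using finite_dim_Hom [of X Y] XY by (simp add: hom_finite_dim_def full_sub_lin_span)
  next
    have "Hom E \<one> \<one> = Hom C \<one> \<one>"
      using S_Unt by (auto simp: full_sub_Hom)
    then show "bij_betw (\<lambda>a. a \<odot>\<^bsub>E\<^esub> Idn E \<one>\<^bsub>E\<^esub>) UNIV (Hom E \<one>\<^bsub>E\<^esub> \<one>\<^bsub>E\<^esub>)"
      using End_Unt by simp
  qed (auto simp: full_sub_Hom TAr_Add Add_TAr TAr_Scl Scl_TAr)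
qed

lemma inclusion_tensor: "tensor_functor E C (inclusion C)"
proof -
  interpret E: tensor_category E by (rule E_tensor)
  interpret I: exact_functor E C "inclusion C" by (rule inclusion_exact)
  show ?thesis
    by unfold_locales (auto simp: full_sub_Hom Hom_def)
qed

end

section \<open>The universal arrow given by a dual of the algebra\<close>

context monoidal_category
begin

text \<open>A coevaluation \<open>\<one> \<rightarrow> B \<otimes> A\<close> is universal among the arrows \<open>\<one> \<rightarrow> X \<otimes> A\<close>; this is the adjunction
  \<open>- \<otimes> B \<stileturn> - \<otimes> A\<close> at \<open>\<one>\<close>.\<close>

lemma upper_rev_unit:
  assumes d: "dual_pair C A B ev coev" and g: "g \<in> Hom C B X"
  shows "upper (rev_mon C) coev B A \<one> (g \<cdot> LUn C B) = (g \<boxtimes> Idn C A) \<cdot> coev"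
proof -
  note [simp] = dual_pairD(1-8) [OF d] HomD [OF g]
  have a: "(LUn C B \<boxtimes> Idn C A) \<cdot> inv_arr C (Asc C \<one> B A) = LUn C (B \<otimes> A)"
    by (rule iso_move_right [symmetric]) (simp_all add: LUn_TOb)
  have "upper (rev_mon C) coev B A \<one> (g \<cdot> LUn C B)
    = (g \<boxtimes> Idn C A) \<cdot> ((LUn C B \<boxtimes> Idn C A) \<cdot> inv_arr C (Asc C \<one> B A)) \<cdot> (Idn C \<one> \<boxtimes> coev) \<cdot> inv_arr C (RUn C \<one>)"
    by (simp add: upper_def merge)
  also have "\<dots> = (g \<boxtimes> Idn C A) \<cdot> (LUn C (B \<otimes> A) \<cdot> (Idn C \<one> \<boxtimes> coev)) \<cdot> inv_arr C (RUn C \<one>)"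
    unfolding a by simp
  also have "\<dots> = (g \<boxtimes> Idn C A) \<cdot> coev"
    by (simp add: LUn_nat RUn_Unt)
  finally show ?thesis .
qed

lemma coev_universal_inj:
  assumes d: "dual_pair C A B ev coev" and g: "g \<in> Hom C B X" "h \<in> Hom C B X"
    and eq: "(g \<boxtimes> Idn C A) \<cdot> coev = (h \<boxtimes> Idn C A) \<cdot> coev"
  shows "g = h"
proof -
  interpret R: monoidal_category "rev_mon C" by (rule monoidal_rev_mon)
  note [simp] = dual_pairD(1-2) [OF d] HomD [OF g(1)] HomD [OF g(2)]
  have "g \<cdot> LUn C B = h \<cdot> LUn C B"
  proof (rule R.upper_inj [OF dual_pair_rev [OF d]])
    show "upper (rev_mon C) coev B A \<one> (g \<cdot> LUn C B) = upper (rev_mon C) coev B A \<one> (h \<cdot> LUn C B)"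
      using upper_rev_unit [OF d] g eq by simp
  qed (simp_all add: Hom_def)
  then show ?thesis
    by (rule iso_cancel_right [rotated -1]) simp_all
qed

lemma coev_universal_surj:
  assumes d: "dual_pair C A B ev coev" and c: "c \<in> Hom C \<one> (X \<otimes> A)" and X: "X \<in> Ob C"
  obtains g where "g \<in> Hom C B X" "(g \<boxtimes> Idn C A) \<cdot> coev = c"
proof -
  interpret R: monoidal_category "rev_mon C" by (rule monoidal_rev_mon)
  note [simp] = dual_pairD(1-2) [OF d] X
  note d' = dual_pair_rev [OF d]
  have c': "c \<in> Hom (rev_mon C) \<one>\<^bsub>rev_mon C\<^esub> (A \<otimes>\<^bsub>rev_mon C\<^esub> X)" and X': "X \<in> Ob (rev_mon C)"
    using c by simp_all
  define k where "k = lower (rev_mon C) ev B A X c"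
  have k: "k \<in> Hom C (\<one> \<otimes> B) X"
    using R.lower_Hom [OF d' c' X'] by (simp add: k_def)
  note [simp] = HomD [OF k]
  define g where "g = k \<cdot> inv_arr C (LUn C B)"
  have g: "g \<in> Hom C B X" by (simp add: g_def Hom_def)
  have "(g \<boxtimes> Idn C A) \<cdot> coev = upper (rev_mon C) coev B A \<one> (g \<cdot> LUn C B)"
    by (rule upper_rev_unit [OF d g, symmetric])
  also have "g \<cdot> LUn C B = k"
    by (simp add: g_def)
  also have "upper (rev_mon C) coev B A \<one> k = c"
    using R.upper_lower [OF d' c' X'] by (simp add: k_def)
  finally show ?thesis
    by (rule that [OF g])
qed

end

section \<open>Normality\<close>

context tensor_adjunction
begin

text \<open>For a dual \<open>B\<close> of \<open>A\<close>, the object \<open>F B\<close> carries a universal arrow from \<open>F \<one>\<close>: the functor \<open>F\<close>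
  behaves at \<open>\<one>\<close> as if it had a left adjoint with value \<open>B\<close>.\<close>

lemma universal_from_unit:
  "\<exists>B \<nu>. B \<in> Ob C \<and> \<nu> \<in> Hom D (FOb F \<one>) (FOb F B) \<and>
    (is_trivial D (FOb F B) \<longleftrightarrow> is_trivial D (FOb F A)) \<and>
    (\<forall>X\<in>Ob C. \<forall>s\<in>Hom D (FOb F \<one>) (FOb F X). \<exists>g\<in>Hom C B X. FAr F g \<bullet> \<nu> = s) \<and>
    (\<forall>X. \<forall>g\<in>Hom C B X. \<forall>h\<in>Hom C B X. FAr F g \<bullet> \<nu> = FAr F h \<bullet> \<nu> \<longrightarrow> g = h)"
proof -
  have "A \<in> Ob C" by simp
  then obtain B ev coev where d: "dual_pair C A B ev coev"
    using C.right_dual by blast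
  note [simp] = dual_pairD(1-8) [OF d]
  define \<nu> where "\<nu> = q B \<bullet> FAr F coev"
  have \<nu>: "\<nu> \<in> Hom D (FOb F \<one>) (FOb F B)"
    by (simp add: \<nu>_def Hom_def)
  have *: "FAr F g \<bullet> \<nu> = q X \<bullet> FAr F ((g \<boxtimes> Idn C A) \<cdot> coev)" if g: "g \<in> Hom C B X" for g X
  proof -
    note [simp] = HomD [OF g] C.Hom_Ob [OF g]
    have "FAr F g \<bullet> \<nu> = (FAr F g \<bullet> q B) \<bullet> FAr F coev"
      by (simp add: \<nu>_def)
    also have "FAr F g \<bullet> q B = q X \<bullet> FAr F (g \<boxtimes> Idn C A)"
      by (subst q_nat) simp_all
    finally show ?thesis by simp
  qed
  show ?thesis
  proof (intro exI [of _ B] exI [of _ \<nu>] conjI ballI allI impI)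
    show "B \<in> Ob C" "\<nu> \<in> Hom D (FOb F \<one>) (FOb F B)"
      by (simp, rule \<nu>)
    show "is_trivial D (FOb F B) \<longleftrightarrow> is_trivial D (FOb F A)"
      using D.trivial_dual [OF functor_dual_pair [OF d]] by simp
  next
    fix X s assume X: "X \<in> Ob C" and s: "s \<in> Hom D (FOb F \<one>) (FOb F X)"
    obtain c where c: "c \<in> Hom C \<one> (X \<otimes> A)" "q X \<bullet> FAr F c = s"
      by (rule q_surj [OF s _ X]) simp
    obtain g where g: "g \<in> Hom C B X" "(g \<boxtimes> Idn C A) \<cdot> coev = c"
      by (rule C.coev_universal_surj [OF d c(1) X])
    show "\<exists>g\<in>Hom C B X. FAr F g \<bullet> \<nu> = s"
      using * [OF g(1)] g c(2) by auto
  next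
    fix X g h assume g: "g \<in> Hom C B X" and h: "h \<in> Hom C B X" and eq: "FAr F g \<bullet> \<nu> = FAr F h \<bullet> \<nu>"
    note [simp] = HomD [OF g] HomD [OF h] C.Hom_Ob [OF g]
    have "(g \<boxtimes> Idn C A) \<cdot> coev = (h \<boxtimes> Idn C A) \<cdot> coev"
      by (rule q_inj [of _ "\<one>" X]) (use * [OF g] * [OF h] eq in \<open>simp_all add: Hom_def\<close>)
    then show "g = h"
      by (rule C.coev_universal_inj [OF d g h])
  qed
qed

lemma F_unit_trivial: "is_trivial D (FOb F \<one>)"
  by (rule D.trivial_isomorphic [OF D.isomorphic_sym [OF FOb_Unt_isomorphic] D.trivial_Unt])

text \<open>
  Let \<open>S\<close> be the subobject of \<open>B\<close> whose image is the largest trivial subobject of \<open>F B\<close>. The universal arrow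
  starts at a trivial object and is zero or monic, so it factors through \<open>F S\<close>. By universality the
  factorization is induced by an arrow \<open>B \<rightarrow> S\<close>, and the composite \<open>B \<rightarrow> S \<rightarrow> B\<close> is the identity. Hence
  \<open>S\<close> is all of \<open>B\<close>, and \<open>F B\<close> is trivial.
\<close>

lemma normal_imp_trivial:
  assumes "normal C D F"
  shows "is_trivial D (FOb F A)"
proof -
  obtain B \<nu> where B: "B \<in> Ob C" and \<nu>: "\<nu> \<in> Hom D (FOb F \<one>) (FOb F B)"
    and AB: "is_trivial D (FOb F B) \<longleftrightarrow> is_trivial D (FOb F A)"
    and surj: "\<forall>X\<in>Ob C. \<forall>s\<in>Hom D (FOb F \<one>) (FOb F X). \<exists>g\<in>Hom C B X. FAr F g \<bullet> \<nu> = s"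
    and inj: "\<forall>X. \<forall>g\<in>Hom C B X. \<forall>h\<in>Hom C B X. FAr F g \<bullet> \<nu> = FAr F h \<bullet> \<nu> \<longrightarrow> g = h"
    using universal_from_unit by (elim exE conjE) (rule that)
  note [simp] = HomD [OF \<nu>] B
  obtain i where i: "is_mono C i" "Cod C i = B" and l: "largest_trivial_sub D (FAr F i) (FOb F B)"
    using assms B unfolding normal_def by blast
  define S where "S = Dom C i"
  have iH: "i \<in> Hom C S B"
    using i by (simp add: is_mono_def Hom_def S_def)
  note [simp] = HomD [OF iH] C.Hom_Ob [OF iH]
  let ?s = "\<nu> \<bullet> F0 F"
  have s: "?s \<in> Hom D \<one>\<^bsub>D\<^esub> (FOb F B)" by (simp add: Hom_def)
  have "\<exists>t\<in>Hom D \<one>\<^bsub>D\<^esub> (FOb F S). FAr F i \<bullet> t = ?s"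
  proof (cases "?s = Zer D \<one>\<^bsub>D\<^esub> (FOb F B)")
    case True
    then show ?thesis
      using D.Zer_Hom [of "\<one>\<^bsub>D\<^esub>" "FOb F S"] by (intro bexI [of _ "Zer D \<one>\<^bsub>D\<^esub> (FOb F S)"]) simp_all
  next
    case False
    then have "is_mono D ?s"
      by (rule D.from_unit_mono [OF s])
    then show ?thesis
      using l D.trivial_Unt HomD [OF s] unfolding largest_trivial_sub_def
      by (auto dest!: spec [of _ ?s])
  qed
  then obtain t where t: "t \<in> Hom D \<one>\<^bsub>D\<^esub> (FOb F S)" "FAr F i \<bullet> t = ?s" ..
  note [simp] = HomD [OF t(1)]
  have "t \<bullet> inv_arr D (F0 F) \<in> Hom D (FOb F \<one>) (FOb F S)" by (simp add: Hom_def)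
  then obtain g where g: "g \<in> Hom C B S" "FAr F g \<bullet> \<nu> = t \<bullet> inv_arr D (F0 F)"
    using surj \<open>S \<in> Ob C\<close> by blast
  note [simp] = HomD [OF g(1)]
  have "i \<cdot> g = Idn C B"
  proof (rule inj [rule_format])
    show "i \<cdot> g \<in> Hom C B B" "Idn C B \<in> Hom C B B"
      by (simp_all add: Hom_def)
    have "FAr F (i \<cdot> g) \<bullet> \<nu> = (FAr F i \<bullet> t) \<bullet> inv_arr D (F0 F)"
      using g(2) by simp
    also have "\<dots> = \<nu>"
      unfolding t(2) by simp
    finally show "FAr F (i \<cdot> g) \<bullet> \<nu> = FAr F (Idn C B) \<bullet> \<nu>"
      by simp
  qed
  then have iso: "is_iso C i"
    using C.mono_split_epi_iso(1) [OF i(1)] g(1) by simp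
  have "is_trivial D (FOb F S)"
    using l by (simp add: largest_trivial_sub_def)
  then have "is_trivial D (FOb F B)"
    using D.trivial_epi [OF D.iso_epi [OF FAr_iso(1) [OF iso]]] by simp
  then show ?thesis
    using AB by simp
qed

text \<open>
  The sum of the images of finitely many arrows is built one arrow at a time; each step takes a quotient of a
  direct sum, and both operations preserve triviality of the value of \<open>F\<close>.
\<close>

lemma image_family:
  assumes B: "is_trivial D (FOb F B)" and X: "X \<in> Ob C" and G: "finite G" "G \<subseteq> Hom C B X"
  shows "\<exists>S i. i \<in> Hom C S X \<and> is_mono C i \<and> is_trivial D (FOb F S) \<and> (\<forall>g\<in>G. \<exists>g'\<in>Hom C B S. i \<cdot> g' = g)"
  using G
proof (induction G rule: finite_induct)
  case empty
  obtain Z where Z: "is_zero C Z" using C.has_zero by blast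
  then have ZO: "Z \<in> Ob C" by (simp add: is_zero_def)
  have z: "Zer C Z X \<in> Hom C Z X" by (rule C.Zer_Hom [OF ZO X])
  have "is_mono C (Zer C Z X)"
    by (rule C.mono_if_zero [OF z]) (rule C.zero_Cod [OF Z])
  moreover have "is_trivial D (FOb F Z)"
    by (rule D.trivial_zero [OF additive_functor.FOb_zero [OF additive Z]])
  ultimately show ?case using z by blast
next
  case (insert g G)
  then obtain S i where i: "i \<in> Hom C S X" "is_mono C i" and S: "is_trivial D (FOb F S)"
    and fac: "\<And>h. h \<in> G \<Longrightarrow> \<exists>h'\<in>Hom C B S. i \<cdot> h' = h"
    by blast
  have g: "g \<in> Hom C B X" using insert.prems by simp
  obtain P where P: "is_dsum C S B P"
    using C.has_dsum C.Hom_Ob i(1) g by blast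
  obtain j k p r where d: "j \<in> Hom C S P" "k \<in> Hom C B P" "p \<in> Hom C P S" "r \<in> Hom C P B"
    "p \<cdot> j = Idn C S" "r \<cdot> k = Idn C B" "p \<cdot> k = Zer C B S" "r \<cdot> j = Zer C S B"
    using P unfolding is_dsum_def by blast
  note [simp] = HomD [OF i(1)] HomD [OF g] HomD [OF d(1)] HomD [OF d(2)] HomD [OF d(3)] HomD [OF d(4)]
    C.Hom_Ob [OF i(1)] C.Hom_Ob [OF g]
  define h where "h = (i \<cdot> p) \<oplus> (g \<cdot> r)"
  have ip: "i \<cdot> p \<in> Hom C P X" and gr: "g \<cdot> r \<in> Hom C P X"
    by (simp_all add: Hom_def)
  have h: "h \<in> Hom C P X"
    unfolding h_def by (rule C.Add_Hom [OF ip gr])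
  have hj: "h \<cdot> j = i"
    unfolding h_def using C.Add_Comp [OF d(1) ip gr] d(5,8) C.Add_Zer [OF i(1)] by simp
  have hk: "h \<cdot> k = g"
    unfolding h_def using C.Add_Comp [OF d(2) ip gr] d(6,7) C.Zer_Add [OF g] by simp
  obtain I e' i' where e': "e' \<in> Hom C P I" "i' \<in> Hom C I X" "is_epi C e'" "is_mono C i'" "i' \<cdot> e' = h"
    by (rule C.image_factor [OF h])
  note [simp] = HomD [OF e'(1)] HomD [OF e'(2)]
  have "is_trivial D (FOb F P)"
    by (rule D.trivial_dsum [OF additive_functor.FOb_dsum [OF additive P] S B])
  then have "is_trivial D (FOb F I)"
    using D.trivial_epi [OF FAr_epi [OF e'(3)]] by simp
  moreover have "\<exists>h'\<in>Hom C B I. i' \<cdot> h' = f" if f: "f \<in> insert g G" for f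
  proof (cases "f = g")
    case True
    have "i' \<cdot> (e' \<cdot> k) = g"
      using C.Comp_assoc [OF d(2) e'(1,2)] e'(5) hk by simp
    then show ?thesis
      using True C.Comp_Hom [OF d(2) e'(1)] by blast
  next
    case False
    then obtain f' where f': "f' \<in> Hom C B S" "i \<cdot> f' = f"
      using fac f by blast
    have ej: "e' \<cdot> j \<in> Hom C S I" by (rule C.Comp_Hom [OF d(1) e'(1)])
    have "i' \<cdot> ((e' \<cdot> j) \<cdot> f') = (i' \<cdot> (e' \<cdot> j)) \<cdot> f'"
      by (rule C.Comp_assoc [OF f'(1) ej e'(2), symmetric])
    also have "i' \<cdot> (e' \<cdot> j) = i"
      using C.Comp_assoc [OF d(1) e'(1,2)] e'(5) hj by simp
    finally show ?thesis
      using f' C.Comp_Hom [OF f'(1) ej] by blast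
  qed
  ultimately show ?case
    using e'(2,4) by blast
qed

text \<open>
  The required subobject of \<open>X\<close> is the sum of the images of all arrows \<open>B \<rightarrow> X\<close>. Every arrow from the unit object to
  \<open>F X\<close> factors through the universal arrow, hence through the image of this subobject; as trivial
  objects are generated by the unit object, so does every arrow from a trivial object.
\<close>

lemma trivial_imp_normal:
  assumes A: "is_trivial D (FOb F A)"
  shows "normal C D F"
  unfolding normal_def
proof
  obtain B \<nu> where B: "B \<in> Ob C" and \<nu>: "\<nu> \<in> Hom D (FOb F \<one>) (FOb F B)"
    and AB: "is_trivial D (FOb F B) \<longleftrightarrow> is_trivial D (FOb F A)"
    and surj: "\<forall>X\<in>Ob C. \<forall>s\<in>Hom D (FOb F \<one>) (FOb F X). \<exists>g\<in>Hom C B X. FAr F g \<bullet> \<nu> = s"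
    using universal_from_unit by (elim exE conjE) (rule that)
  note [simp] = HomD [OF \<nu>] B
  fix X assume X [simp]: "X \<in> Ob C"
  obtain G where G: "finite G" "G \<subseteq> Hom C B X" "lin_span C B X G = Hom C B X"
    using C.finite_dim_Hom [OF B X] unfolding hom_finite_dim_def by blast
  obtain S i where i: "i \<in> Hom C S X" "is_mono C i" and S: "is_trivial D (FOb F S)"
    and fac: "\<And>g. g \<in> G \<Longrightarrow> \<exists>g'\<in>Hom C B S. i \<cdot> g' = g"
    using image_family [OF _ X G(1,2)] AB A by blast
  note [simp] = HomD [OF i(1)] C.Hom_Ob [OF i(1)]
  have fac: "\<exists>g'\<in>Hom C B S. i \<cdot> g' = g" if g: "g \<in> Hom C B X" for g
  proof -
    have "g \<in> lin_span C B X G" using g G(3) by simp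
    then show ?thesis
    proof induction
      case span_zero
      show ?case
        by (rule bexI [of _ "Zer C B S"]) (simp_all add: Hom_def)
    next
      case (span_base f)
      then show ?case by (rule fac)
    next
      case (span_Add f g)
      then obtain f' g' where "f' \<in> Hom C B S" "i \<cdot> f' = f" "g' \<in> Hom C B S" "i \<cdot> g' = g"
        by blast
      then show ?case
        using C.Comp_Add [of f' B S g' i X] C.Add_Hom [of f' B S g'] i(1) by metis
    next
      case (span_Scl f a)
      then obtain f' where "f' \<in> Hom C B S" "i \<cdot> f' = f"
        by blast
      then show ?case
        using C.Comp_Scl [of f' B S i X] C.Scl_Hom [of f' B S a] i(1) by metis
    qed
  qed
  have Fi: "is_mono D (FAr F i)" by (rule FAr_mono [OF i(2)])
  have "largest_trivial_sub D (FAr F i) (FOb F X)"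
    unfolding largest_trivial_sub_def
  proof (intro conjI allI impI)
    show "is_mono D (FAr F i)" by (rule Fi)
    show "Cod D (FAr F i) = FOb F X" "is_trivial D (Dom D (FAr F i))"
      using S by simp_all
    fix t assume t: "is_mono D t \<and> Cod D t = FOb F X \<and> is_trivial D (Dom D t)"
    define T where "T = Dom D t"
    have tH: "t \<in> Hom D T (FOb F X)"
      using t by (simp add: is_mono_def Hom_def T_def)
    have gen: "unit_gen D T"
      using t D.trivial_iff_gen by (simp add: T_def)
    obtain f where f: "is_kernel D (FAr F i) f"
      using D.mono_is_kernel [OF Fi] by blast
    have fH: "f \<in> Hom D (FOb F X) (Cod D f)"
      using D.kernelD [OF f] by (simp add: Hom_def)
    have TO: "T \<in> Ob D" and fO: "Cod D f \<in> Ob D"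
      using D.Hom_Ob [OF tH] D.Hom_Ob [OF fH] by auto
    have "f \<bullet> t = Zer D T (Cod D f)"
    proof (rule unit_genD [OF gen D.Comp_Hom [OF tH fH] D.Zer_Hom [OF TO fO]])
      fix s assume s: "s \<in> Hom D \<one>\<^bsub>D\<^esub> T"
      note [simp] = HomD [OF s] HomD [OF tH] HomD(1,2) [OF fH]
      have "(t \<bullet> s) \<bullet> inv_arr D (F0 F) \<in> Hom D (FOb F \<one>) (FOb F X)"
        by (simp add: Hom_def)
      then obtain g where g: "g \<in> Hom C B X" "FAr F g \<bullet> \<nu> = (t \<bullet> s) \<bullet> inv_arr D (F0 F)"
        using surj X by blast
      obtain g' where g': "g' \<in> Hom C B S" "i \<cdot> g' = g"
        using fac [OF g(1)] by blast
      note [simp] = HomD [OF g'(1)]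
      have "t \<bullet> s = ((t \<bullet> s) \<bullet> inv_arr D (F0 F)) \<bullet> F0 F"
        by simp
      also have "\<dots> = FAr F i \<bullet> (FAr F g' \<bullet> \<nu> \<bullet> F0 F)"
        unfolding g(2) [symmetric] g'(2) [symmetric] by simp
      finally have ts: "t \<bullet> s = FAr F i \<bullet> (FAr F g' \<bullet> \<nu> \<bullet> F0 F)" .
      have "(f \<bullet> t) \<bullet> s = (f \<bullet> FAr F i) \<bullet> (FAr F g' \<bullet> \<nu> \<bullet> F0 F)"
        using ts by simp
      also have "f \<bullet> FAr F i = Zer D (FOb F S) (Cod D f)"
        using D.kernelD(4) [OF f] by simp
      also have "\<dots> \<bullet> (FAr F g' \<bullet> \<nu> \<bullet> F0 F) = Zer D \<one>\<^bsub>D\<^esub> (Cod D f)"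
        using fO by simp
      finally show "(f \<bullet> t) \<bullet> s = Zer D T (Cod D f) \<bullet> s"
        using fO by simp
    qed
    moreover have "t \<in> Hom D T (Dom D f)"
      using tH D.kernelD(3) [OF f] by simp
    ultimately show "\<exists>h\<in>Hom D (Dom D t) (Dom D (FAr F i)). FAr F i \<bullet> h = t"
      using D.kernel_factor [OF f] unfolding T_def by blast
  qed
  then show "\<exists>i. is_mono C i \<and> Cod C i = X \<and> largest_trivial_sub D (FAr F i) (FOb F X)"
    using i by auto
qed

section \<open>The kernel of a normal functor\<close>

text \<open>Tensor functors are faithful: an arrow \<open>T \<rightarrow> X\<close> transposes to an arrow \<open>L \<otimes> T \<rightarrow> \<one>\<close>, which is zero or
  epic, and \<open>F\<close> preserves epimorphisms.\<close>

lemma F_reflects_zero: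
  assumes a: "a \<in> Hom C T X" and z: "FAr F a = Zer D (FOb F T) (FOb F X)"
  shows "a = Zer C T X"
proof -
  note [simp] = HomD [OF a] C.Hom_Ob [OF a]
  have "X \<in> Ob C" by simp
  then obtain L ev coev where d: "dual_pair C L X ev coev"
    using C.left_dual by blast
  note [simp] = dual_pairD(1-8) [OF d]
  let ?r = "inv_arr C (RUn C X)"
  have ra: "?r \<cdot> a \<in> Hom C T (X \<otimes> \<one>)" by (simp add: Hom_def)
  have U: "\<one> \<in> Ob C" by simp
  define b where "b = lower C ev L X \<one> (?r \<cdot> a)"
  have b: "b \<in> Hom C (L \<otimes> T) \<one>"
    unfolding b_def by (rule C.lower_Hom [OF d ra U])
  note [simp] = HomD [OF b]
  have "FAr F b \<bullet> F2 F L T = Zer D (FOb F L \<otimes>\<^bsub>D\<^esub> FOb F T) (FOb F \<one>)"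
  proof -
    have "inv_arr D (F2 F X \<one>) \<bullet> FAr F (?r \<cdot> a) = Zer D (FOb F T) (FOb F X \<otimes>\<^bsub>D\<^esub> FOb F \<one>)"
      using z by simp
    moreover have "Idn D (FOb F L) \<boxtimes>\<^bsub>D\<^esub> Zer D (FOb F T) (FOb F X \<otimes>\<^bsub>D\<^esub> FOb F \<one>)
      = Zer D (FOb F L \<otimes>\<^bsub>D\<^esub> FOb F T) (FOb F L \<otimes>\<^bsub>D\<^esub> FOb F X \<otimes>\<^bsub>D\<^esub> FOb F \<one>)"
      by (rule D.TAr_Zer [OF D.Idn_Hom]) simp_all
    ultimately show ?thesis
      using functor_lower [OF d ra U] unfolding b_def lower_def by simp
  qed
  then have Fb: "FAr F b = Zer D (FOb F (L \<otimes> T)) (FOb F \<one>)"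
    by (intro D.iso_cancel_right [of "F2 F L T" "FAr F b"]) simp_all
  have "b = Zer C (L \<otimes> T) \<one>"
  proof (rule ccontr)
    assume "b \<noteq> Zer C (L \<otimes> T) \<one>"
    then have "is_epi D (FAr F b)"
      using FAr_epi C.to_unit_epi [OF b] by blast
    then have "Idn D (FOb F \<one>) = Zer D (FOb F \<one>) (FOb F \<one>)"
      by (rule D.epi_zero [of "FAr F b" "FOb F (L \<otimes> T)"]) (simp_all add: Fb Hom_def)
    then have "inv_arr D (F0 F) \<bullet> Idn D (FOb F \<one>) \<bullet> F0 F
      = inv_arr D (F0 F) \<bullet> Zer D (FOb F \<one>) (FOb F \<one>) \<bullet> F0 F"
      by simp
    then show False
      using D.unit_nonzero by (simp add: D.is_zero_iff)
  qed
  also have "\<dots> = lower C ev L X \<one> (Zer C T (X \<otimes> \<one>))"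
  proof -
    have "Idn C L \<boxtimes> Zer C T (X \<otimes> \<one>) = Zer C (L \<otimes> T) (L \<otimes> X \<otimes> \<one>)"
      by (rule C.TAr_Zer [OF C.Idn_Hom]) simp_all
    then show ?thesis by (simp add: lower_def)
  qed
  finally have "?r \<cdot> a = Zer C T (X \<otimes> \<one>)"
    unfolding b_def by (rule C.lower_inj [OF d ra _ U, rotated]) (simp add: Hom_def)
  then have "RUn C X \<cdot> ?r \<cdot> a = RUn C X \<cdot> Zer C T (X \<otimes> \<one>)"
    by simp
  then show ?thesis by simp
qed

text \<open>It has a left inverse after applying the faithful functor \<open>F\<close>, namely \<open>q X\<close>.\<close>

lemma \<iota>_mono:
  assumes [simp]: "X \<in> Ob C"
  shows "is_mono C (\<iota> X)"
proof (rule C.mono_if_zero)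
  show "\<iota> X \<in> Hom C X (X \<otimes> A)" by (simp add: Hom_def)
  fix T a assume a: "a \<in> Hom C T X" "\<iota> X \<cdot> a = Zer C T (X \<otimes> A)"
  note [simp] = HomD [OF a(1)] C.Hom_Ob [OF a(1)]
  have "FAr F a = (q X \<bullet> FAr F (\<iota> X)) \<bullet> FAr F a"
    by (simp add: q_\<iota>)
  also have "\<dots> = q X \<bullet> FAr F (\<iota> X \<cdot> a)"
    by simp
  also have "\<dots> = Zer D (FOb F T) (FOb F X)"
    unfolding a(2) by (simp add: additive_functor.FAr_Zer [OF additive])
  finally show "a = Zer C T X"
    by (rule F_reflects_zero [OF a(1)])
qed

abbreviation K :: "'o set" where "K \<equiv> {X \<in> Ob C. is_trivial D (FOb F X)}"

lemma K_tensor_subcategory: "tensor_subcategory C K"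
proof
  show "K \<subseteq> Ob C" by blast
  show "stable C K"
    unfolding stable_def
  proof (intro conjI ballI allI impI)
    fix X Y P assume "X \<in> K" "Y \<in> K" and P: "is_dsum C X Y P"
    then have "is_trivial D (FOb F P)"
      using D.trivial_dsum [OF additive_functor.FOb_dsum [OF additive P]] by simp
    moreover have "P \<in> Ob C"
      using P C.Hom_Ob unfolding is_dsum_def by blast
    ultimately show "P \<in> K" by simp
  next
    fix i assume i: "is_mono C i \<and> Cod C i \<in> K"
    then have "i \<in> Arr C" by (simp add: is_mono_def)
    then show "Dom C i \<in> K"
      using D.trivial_mono [OF FAr_mono, of i] i by simp
  next
    fix e assume e: "is_epi C e \<and> Dom C e \<in> K"
    then have "e \<in> Arr C" by (simp add: is_epi_def)
    then show "Cod C e \<in> K"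
      using D.trivial_epi [OF FAr_epi, of e] e by simp
  qed
  obtain Z where Z: "is_zero C Z" using C.has_zero by blast
  then show "\<exists>Z\<in>K. is_zero C Z"
    using D.trivial_zero [OF additive_functor.FOb_zero [OF additive Z]] by (auto simp: is_zero_def)
  show "\<one> \<in> K"
    using F_unit_trivial by simp
  show "X \<otimes> Y \<in> K" if "X \<in> K" "Y \<in> K" for X Y
  proof -
    have XY: "X \<in> Ob C" "Y \<in> Ob C" using that by auto
    have "is_trivial D (FOb F X \<otimes>\<^bsub>D\<^esub> FOb F Y)"
      using D.trivial_TOb that by simp
    then show ?thesis
      using D.trivial_epi [OF D.iso_epi [OF F2_iso [OF XY]]] XY by simp
  qed
  fix L X ev coev assume d: "dual_pair C L X ev coev"
  note [simp] = dual_pairD(1,2) [OF d]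
  show "L \<in> K" if "X \<in> K"
    using D.trivial_dual [OF functor_dual_pair [OF d]] that by simp
  show "X \<in> K" if "L \<in> K"
    using D.trivial_dual [OF functor_dual_pair [OF d]] that by simp
qed

lemma tensor_A_additive: "additive_functor C C \<lparr>FOb = (\<lambda>X. X \<otimes> A), FAr = (\<lambda>f. f \<boxtimes> Idn C A)\<rparr>"
proof -
  have I: "Idn C A \<in> Hom C A A" by (simp add: Hom_def)
  show ?thesis
    by unfold_locales (auto simp: C.TAr_Hom [OF _ I] Hom_def C.merge C.Add_TAr [OF _ _ I])
qed

lemma mod_isomorphic_underlying:
  assumes "isomorphic (mod_cat C Alg) M N"
  shows "isomorphic C (fst M) (fst N)"
proof -
  interpret M: category "mod_cat C Alg"
    by (rule C.mod_cat_category) simp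
  obtain f' where f': "f' \<in> Hom (mod_cat C Alg) M N" "is_iso (mod_cat C Alg) f'"
    using assms by (auto simp: isomorphic_def)
  have g': "inv_arr (mod_cat C Alg) f' \<in> Hom (mod_cat C Alg) N M"
    using M.inv_arr_simps(1-3) [OF f'(2)] HomD [OF f'(1)] by (simp add: Hom_def)
  obtain f g where f: "f' = (M, f, N)" "f \<in> Hom C (fst M) (fst N)"
    and g: "inv_arr (mod_cat C Alg) f' = (N, g, M)" "g \<in> Hom C (fst N) (fst M)"
    using f'(1) g' by (auto simp: mod_cat_Hom)
  have "g \<cdot> f = Idn C (fst M)" "f \<cdot> g = Idn C (fst N)"
    using M.inv_arr_simps(4,5) [OF f'(2)] unfolding g(1) unfolding f(1) by simp_all
  then show ?thesis
    unfolding isomorphic_def using C.isoI(1) [OF f(2) g(2)] f(2) by blast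
qed

text \<open>
  Any object \<open>X\<close> embeds in \<open>X \<otimes> A\<close>. If \<open>F X\<close> is trivial, then \<open>X \<otimes> A\<close> is isomorphic, already as
  a module, to \<open>Q \<otimes> A\<close> for a power \<open>Q\<close> of the unit object, that is, to a power of \<open>A\<close>.
\<close>

lemma K_subset:
  assumes S: "stable C S" and A: "A \<in> S" and X: "X \<in> K"
  shows "X \<in> S"
proof -
  have mono: "\<And>i. is_mono C i \<Longrightarrow> Cod C i \<in> S \<Longrightarrow> Dom C i \<in> S"
    and dsum: "\<And>X Y P. X \<in> S \<Longrightarrow> Y \<in> S \<Longrightarrow> is_dsum C X Y P \<Longrightarrow> P \<in> S"
    using S unfolding stable_def by blast+
  have iso: "Y \<in> S" if "isomorphic C Y Y'" "Y' \<in> S" for Y Y'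
    using that mono C.iso_mono HomD unfolding isomorphic_def by metis
  interpret T: additive_functor C C "\<lparr>FOb = (\<lambda>X. X \<otimes> A), FAr = (\<lambda>f. f \<boxtimes> Idn C A)\<rparr>"
    by (rule tensor_A_additive)
  have A1: "\<one> \<otimes> A \<in> S"
    using mono [OF C.iso_mono [OF C.LUn_iso [of A]]] A by simp
  have zero: "Z \<in> S" if Z: "is_zero C Z" for Z
  proof -
    have ZO: "Z \<in> Ob C" using Z by (simp add: is_zero_def)
    have z: "Zer C Z A \<in> Hom C Z A" by (rule C.Zer_Hom [OF ZO]) simp
    have "is_mono C (Zer C Z A)"
      by (rule C.mono_if_zero [OF z]) (rule C.zero_Cod [OF Z])
    then show ?thesis
      using mono [of "Zer C Z A"] A HomD [OF z] by simp
  qed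
  have power: "Q \<otimes> A \<in> S" if "is_power C \<one> n Q" for n Q
    using that
  proof (induction n arbitrary: Q)
    case 0
    then show ?case using zero T.FOb_zero by simp
  next
    case (Suc n)
    then obtain Q' where Q': "is_power C \<one> n Q'" "is_dsum C Q' \<one> Q" by auto
    then show ?case
      using dsum [OF Suc.IH [OF Q'(1)] A1] T.FOb_dsum [OF Q'(2)] by simp
  qed
  have XO: "X \<in> Ob C" using X by simp
  have "is_trivial D (FOb F X)" using X by simp
  then obtain n Q where Q: "is_power C \<one> n Q" "Q \<in> Ob C" "isomorphic D (FOb F X) (FOb F Q)"
    by (rule FOb_trivial_isomorphic_power)
  have "isomorphic C (X \<otimes> A) (Q \<otimes> A)"
    using mod_isomorphic_underlying free_isomorphic_iff [OF XO Q(2)] Q(3) by (fastforce simp: free_module_simp)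
  then have "X \<otimes> A \<in> S"
    using iso power [OF Q(1)] by blast
  then show ?thesis
    using mono [OF \<iota>_mono [OF XO]] XO by simp
qed

lemma gen_sub_eq_Ker:
  assumes "is_trivial D (FOb F A)"
  shows "gen_sub C A = Ker C D F"
proof -
  interpret K: tensor_subcategory C K by (rule K_tensor_subcategory)
  \<comment> \<open>Membership in \<open>K\<close> includes membership in \<open>Ob C\<close>, so as a rewrite rule this fact loops.\<close>
  note K.S_simps [simp del]
  have "A \<in> K" using assms by simp
  then have "\<Inter> {S. abelian_subcategory C S \<and> stable C S \<and> A \<in> S} = K"
    using K.S_abelian_subcategory K.S_stable K_subset by blast
  then show ?thesis
    by (simp add: gen_sub_def Ker_def)
qed

lemma Ker_exact_sequence:
  assumes "dominant C D F" "normal C D F"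
  shows "exact_sequence (Ker C D F) (inclusion C) C F D"
proof -
  interpret K: tensor_subcategory C K by (rule K_tensor_subcategory)
  \<comment> \<open>Membership in \<open>K\<close> includes membership in \<open>Ob C\<close>, so as a rewrite rule this fact loops.\<close>
  note K.S_simps [simp del]
  have KE: "Ker C D F = K.E" by (simp add: Ker_def)
  have "fully_faithful K.E C (inclusion C)"
    unfolding fully_faithful_def
  proof (intro ballI)
    fix X Y assume "X \<in> Ob K.E" "Y \<in> Ob K.E"
    then have "Hom K.E X Y = Hom C X Y" by (auto simp: full_sub_Hom)
    then show "bij_betw (FAr (inclusion C)) (Hom K.E X Y) (Hom C (FOb (inclusion C) X) (FOb (inclusion C) Y))"
      by (simp add: bij_betw_def inj_on_def)
  qed
  moreover have "{Y \<in> Ob C. \<exists>X\<in>K. isomorphic C X Y} = K"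
  proof (intro equalityI subsetI)
    fix Y assume "Y \<in> {Y \<in> Ob C. \<exists>X\<in>K. isomorphic C X Y}"
    then obtain X f where f: "X \<in> K" "f \<in> Hom C X Y" "is_iso C f"
      unfolding isomorphic_def by blast
    show "Y \<in> K"
      using K.S_epi [OF C.iso_epi [OF f(3)]] f(1) HomD [OF f(2)] by blast
  next
    fix Y assume "Y \<in> K"
    then show "Y \<in> {Y \<in> Ob C. \<exists>X\<in>K. isomorphic C X Y}"
      using C.isomorphic_refl by blast
  qed
  then have "ess_image K.E C (inclusion C) = Ker C D F"
    by (simp add: ess_image_def Ker_def)
  ultimately show ?thesis
    using assms K.inclusion_tensor tensor_functor_axioms unfolding exact_sequence_def KE by blast
qed

end

theorem proposition5p7:
  fixes C :: "('o, 'm, 'k::field) mon_cat"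
    and D :: "('p, 'n, 'k) mon_cat"
    and F :: "('o, 'm, 'p, 'n) mfctr"
    and R :: "('p, 'n, 'o, 'm) fctr"
    and \<eta> :: "'o \<Rightarrow> 'm" and \<epsilon> :: "'p \<Rightarrow> 'n"
    and A :: "('o, 'm) alg" and \<sigma> :: "'o \<Rightarrow> 'm"
  assumes "tensor_category C" and "tensor_category D"
    and "tensor_functor C D F" and "dominant C D F"
    and "adjunction C D F R \<eta> \<epsilon>" and "exact_functor D C R"
    and "(A, \<sigma>) = induced_central_algebra C D F R \<eta> \<epsilon>"
  shows "(normal C D F \<longleftrightarrow> self_trivializing C A) \<and>
    (normal C D F \<longrightarrow>
       Ker C D F = gen_sub C (aob A) \<and>
       exact_sequence (gen_sub C (aob A)) (inclusion C) C F D)"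
proof -
  interpret F: tensor_functor C D F by fact
  interpret J: adjunction C D F R \<eta> \<epsilon> by fact
  interpret T: tensor_adjunction C D F R \<eta> \<epsilon> ..
  have A: "A = T.Alg"
    using assms(7) by (simp add: induced_central_algebra_def)
  have iff: "normal C D F \<longleftrightarrow> is_trivial D (FOb F T.A)"
    using T.normal_imp_trivial T.trivial_imp_normal by blast
  have "self_trivializing C A \<longleftrightarrow> is_trivial D (FOb F T.A)"
    unfolding A self_trivializing_def using T.trivializes_iff [of T.A] by simp
  moreover have "Ker C D F = gen_sub C (aob A)" if "normal C D F"
    using T.gen_sub_eq_Ker that iff by (simp add: A)
  moreover have "exact_sequence (Ker C D F) (inclusion C) C F D" if "normal C D F"
    by (rule T.Ker_exact_sequence [OF assms(4) that])
  ultimately show ?thesis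
    using iff by auto
qed

end
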